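(* Let $P$ be a unital subsemigroup of a discrete group $G$ and let $X_P$ be the induced product system in $\mathcal{T}(P)$, i.e. $X_{P,p}=\mathbb{C}v_p$ for $p\in P$. Then the association $$t=\{t_p\}_{p\in P}\longmapsto w_t=\{t_p(v_p)\}_{p\in P}$$ defines a bijection between the unital equivariant Fock covariant representations of $X_P$ and the equivariant representations of $P$ that satisfy conditions (T1)--(T4) listed in the context.
   Context: Semigroup representations. $e$ is the unit of $G$ and $e\in P$. A map $w\colon P\to\mathcal{B}(H)$ is a representation of $P$ if it is a semigroup homomorphism; it is isometric if every $w_p$ is an isometry. $\mathcal{T}(P)$ is the universal C*-algebra for isometric representations of $P$, generated by the universal isometric representation $v=\{v_p\}_{p\in P}$. A representation $w$ is equivariant if there is a $*$-homomorphism $\mathrm{C}^*(w)\to\mathrm{C}^*(w)\otimes\mathrm{C}^*_{\max}(G)$ (minimal tensor product) with $w_p\mapsto w_p\otimes u_p$, where $u_g$ are the canonical unitaries of $\mathrm{C}^*_{\max}(G)$. Words. For $Z\subseteq P$, $pZ=\{px:x\in Z\}$ and $p^{-1}Z=\{y\in P:py\in Z\}$. For a word $\alpha=(p_1,q_1,\dots,p_n,q_n)$ with entries in $P$: $\alpha$ is neutral if $p_1^{-1}q_1\cdots p_n^{-1}q_n=e$ in $G$; $K(\alpha):=q_n^{-1}p_n\cdots q_1^{-1}p_1P$; and $\dot w_\alpha:=w_{p_1}^*w_{q_1}\cdots w_{p_n}^*w_{q_n}$. Conditions on $w\colon P\to\mathcal{B}(H)$: (T1) $w_e=1$; (T2)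 $\dot w_\alpha=0$ for every neutral word $\alpha$ with $K(\alpha)=\emptyset$; (T3) $\dot w_\alpha=\dot w_\beta$ for all neutral words $\alpha,\beta$ with $K(\alpha)=K(\beta)$; (T4) $\prod_{\beta\in F}(\dot w_\alpha-\dot w_\beta)=0$ whenever $\alpha$ is a neutral word, $F$ is a finite nonempty set of neutral words and $K(\alpha)=\bigcup_{\beta\in F}K(\beta)$. (Conditions (T1)--(T3) imply that $w$ is an isometric representation and that the $\dot w_\alpha$, $\alpha$ neutral, are commuting projections.) Product systems. A product system $X$ over $P$ is a family $\{X_p\}_{p\in P}$ of norm-closed subspaces of a common $\mathcal{B}(H)$ with $X_e$ a C*-algebra, $X_pX_q\subseteq X_{pq}$ and $X_p^*X_{pq}\subseteq X_q$. $X_P=\{\mathbb{C}v_p\}_{p\in P}$ is one. A representation $t$ of $X$ consists of linear maps $t_p$ from $X_p$ to a common $\mathcal{B}(K)$ with $t_e$ a $*$-representation, $t_p(\xi_p)t_q(\xi_q)=t_{pq}(\xi_p\xi_q)$ and $t_p(\xi_p)^*t_{pq}(\xi_{pq})=t_q(\xi_p^*\xi_{pq})$. $t$ is equivariant if there is a $*$-homomorphism $\mathrm{C}^*(t)\to\mathrm{C}^*(t)\otimes\mathrm{C}^*_{\max}(G)$ with $t_p(\xi_p)\mapsto t_p(\xi_p)\otimes u_p$. A representation $t$ of $X_P$ is unital if $t_e(v_e)=1$. Fock covariance. $\mathcal{T}(X)$ is the universal C*-algebra for representations of $X$, with universal representation $\hat t$ (which is equivariant, with coaction $\delta$), $[\mathcal{T}(X)]_e=\{c:\delta(c)=c\otimes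 u_e\}$, and $t_\ast\colon\mathcal{T}(X)\to\mathrm{C}^*(t)$ satisfies $t_\ast\circ\hat t_p=t_p$. The Fock representation $\lambda$ on the Hilbert $X_e$-module $\mathcal{F}X=\bigoplus_{r\in P}X_r$ (inner product $\langle\xi,\eta\rangle=\xi^*\eta$ on each $X_r$) is $\lambda_p(\xi_p)\eta_r=\xi_p\eta_r$. $\mathcal{J}^{\mathrm{F}}_{\mathrm{c}}$ is the ideal of $\mathcal{T}(X)$ generated by $\ker\lambda_\ast\cap[\mathcal{T}(X)]_e$; $t$ is Fock covariant if $t_\ast$ factors through $\mathcal{T}(X)/\mathcal{J}^{\mathrm{F}}_{\mathrm{c}}$ (equivalently, $t$ promotes to a representation of the Fell bundle of spectral spaces of this quotient). *)

theory Defs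
  imports "HOL-Analysis.Analysis" "HOL-Algebra.Coset"
begin

section \<open>Complex Hilbert spaces\<close>

(* The inner product is linear in the second variable.  The last axiom expresses positivity,
   definiteness and the compatibility with the norm at once. *)
class complex_hilbert = banach +
  fixes scaleC :: "complex \<Rightarrow> 'a \<Rightarrow> 'a" (infixr \<open>*\<^sub>C\<close> 75)
    and cinner :: "'a \<Rightarrow> 'a \<Rightarrow> complex"
  assumes scaleC_add_right: "c *\<^sub>C (x + y) = c *\<^sub>C x + c *\<^sub>C y"
    and scaleC_add_left: "(c + d) *\<^sub>C x = c *\<^sub>C x + d *\<^sub>C x"
    and scaleC_scaleC: "c *\<^sub>C d *\<^sub>C x = (c * d) *\<^sub>C x"
    and scaleC_of_real: "complex_of_real r *\<^sub>C x = r *\<^sub>R x"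
    and cinner_commute: "cinner x y = cnj (cinner y x)"
    and cinner_add_right: "cinner x (y + z) = cinner x y + cinner x z"
    and cinner_scaleC_right: "cinner x (c *\<^sub>C y) = c * cinner x y"
    and cinner_self: "cinner x x = complex_of_real ((norm x)\<^sup>2)"

lemma scaleC_one [simp]:
  fixes x :: "'a::complex_hilbert"
  shows "1 *\<^sub>C x = x"
  using scaleC_of_real[of 1 x] by simp

lemma scaleC_zero [simp]:
  fixes x :: "'a::complex_hilbert"
  shows "0 *\<^sub>C x = 0"
  using scaleC_of_real[of 0 x] by simp

lemma cinner_add_left:
  fixes x y z :: "'a::complex_hilbert"
  shows "cinner (x + y) z = cinner x z + cinner y z"
  by (metis cinner_add_right cinner_commute complex_cnj_add)

lemma cinner_scaleC_left:
  fixes x y :: "'a::complex_hilbert"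
  shows "cinner (c *\<^sub>C x) y = cnj c * cinner x y"
  by (metis cinner_commute cinner_scaleC_right complex_cnj_mult)

lemma norm_scaleC:
  fixes x :: "'a::complex_hilbert"
  shows "norm (c *\<^sub>C x) = cmod c * norm x"
proof -
  have "complex_of_real ((norm (c *\<^sub>C x))\<^sup>2) = c * cnj c * complex_of_real ((norm x)\<^sup>2)"
    unfolding cinner_self[symmetric] by (simp add: cinner_scaleC_left cinner_scaleC_right)
  also have "\<dots> = complex_of_real ((cmod c * norm x)\<^sup>2)"
    by (simp add: complex_norm_square power_mult_distrib del: of_real_power)
  finally show ?thesis
    by (metis mult_nonneg_nonneg norm_ge_zero of_real_eq_iff power2_eq_imp_eq)
qed

lemma cinner_zero_right [simp]:
  fixes x :: "'a::complex_hilbert"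
  shows "cinner x 0 = 0"
  using cinner_scaleC_right[of x 0 0] by simp

lemma cinner_zero_left [simp]:
  fixes x :: "'a::complex_hilbert"
  shows "cinner 0 x = 0"
  using cinner_commute[of 0 x] by simp

lemma norm_add_sq:
  fixes x y :: "'a::complex_hilbert"
  shows "(norm (x + y))\<^sup>2 = (norm x)\<^sup>2 + 2 * Re (cinner x y) + (norm y)\<^sup>2"
proof -
  have "complex_of_real ((norm (x + y))\<^sup>2) = cinner x x + cinner x y + cnj (cinner x y) + cinner y y"
    unfolding cinner_self[symmetric] by (simp add: cinner_add_left cinner_add_right cinner_commute[of y x])
  hence "Re (complex_of_real ((norm (x + y))\<^sup>2)) = Re (cinner x x + cinner x y + cnj (cinner x y) + cinner y y)"
    by simp
  thus ?thesis by (simp add: cinner_self)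
qed

lemma cauchy_schwarz:
  fixes x y :: "'a::complex_hilbert"
  shows "cmod (cinner x y) \<le> norm x * norm y"
proof (cases "norm y = 0")
  case True
  hence "y = 0" by simp
  thus ?thesis by simp
next
  case False
  let ?a = "cinner y x"
  let ?n = "(norm y)\<^sup>2"
  have n: "?n > 0" using False by simp
  let ?c = "- (?a / complex_of_real ?n)"
  have ci: "cinner x y = cnj ?a" by (rule cinner_commute)
  have "0 \<le> (norm (x + ?c *\<^sub>C y))\<^sup>2" by simp
  also have "\<dots> = (norm x)\<^sup>2 + 2 * Re (?c * cinner x y) + (cmod ?c * norm y)\<^sup>2"
    by (simp only: norm_add_sq cinner_scaleC_right norm_scaleC)
  also have "?c * cinner x y = - complex_of_real ((cmod ?a)\<^sup>2 / ?n)"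
    unfolding ci by (simp only: of_real_divide complex_norm_square) simp
  also have "(cmod ?c * norm y)\<^sup>2 = (cmod ?a)\<^sup>2 / ?n"
    using n by (simp add: norm_divide norm_mult power_mult_distrib power_divide norm_power power2_eq_square field_simps)
  finally have "(cmod ?a)\<^sup>2 / ?n \<le> (norm x)\<^sup>2" by simp
  hence "(cmod ?a)\<^sup>2 \<le> (norm x * norm y)\<^sup>2"
    using n by (simp add: field_simps power_mult_distrib)
  hence "cmod ?a \<le> norm x * norm y"
    by (rule power2_le_imp_le) simp
  moreover have "cmod ?a = cmod (cinner x y)" unfolding ci by simp
  ultimately show ?thesis by simp
qed

instantiation complex :: complex_hilbert
begin

definition scaleC_complex :: "complex \<Rightarrow> complex \<Rightarrow> complex"
  where "scaleC_complex = (*)"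

definition cinner_complex :: "complex \<Rightarrow> complex \<Rightarrow> complex"
  where "cinner_complex x y = cnj x * y"

instance
  by standard
    (auto simp: scaleC_complex_def cinner_complex_def algebra_simps scaleR_conv_of_real
      complex_norm_square[symmetric] simp flip: of_real_power)

end


section \<open>The Hilbert spaces of square summable families\<close>

(* For the index set 'i and a Hilbert space 'h this is the Hilbert space tensor product of 'h with
   the square summable complex families over 'i. *)
typedef (overloaded) ('i, 'h::complex_hilbert) ell2 =
  "{f :: 'i \<Rightarrow> 'h. (\<lambda>i. (norm (f i))\<^sup>2) summable_on UNIV}"
  by (rule exI[of _ "\<lambda>_. 0"]) simp

setup_lifting type_definition_ell2

lemma sq_summable_add:
  fixes f g :: "'i \<Rightarrow> 'h::complex_hilbert"
  assumes "(\<lambda>i. (norm (f i))\<^sup>2) summable_on A" "(\<lambda>i. (norm (g i))\<^sup>2) summable_on A"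
  shows "(\<lambda>i. (norm (f i + g i))\<^sup>2) summable_on A"
    and "sqrt (\<Sum>\<^sub>\<infinity>i\<in>A. (norm (f i + g i))\<^sup>2)
      \<le> sqrt (\<Sum>\<^sub>\<infinity>i\<in>A. (norm (f i))\<^sup>2) + sqrt (\<Sum>\<^sub>\<infinity>i\<in>A. (norm (g i))\<^sup>2)" (is "_ \<le> ?R")
proof -
  have R0: "0 \<le> ?R" by (intro add_nonneg_nonneg real_sqrt_ge_zero infsum_nonneg) simp_all
  have fin: "(\<Sum>i\<in>F. (norm (f i + g i))\<^sup>2) \<le> ?R\<^sup>2" if F: "finite F" "F \<subseteq> A" for F
  proof -
    have "sqrt (\<Sum>i\<in>F. (norm (f i + g i))\<^sup>2) \<le> L2_set (\<lambda>i. norm (f i) + norm (g i)) F"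
      unfolding L2_set_def by (intro real_sqrt_le_mono sum_mono power_mono norm_triangle_ineq) simp
    also have "\<dots> \<le> L2_set (\<lambda>i. norm (f i)) F + L2_set (\<lambda>i. norm (g i)) F"
      by (rule L2_set_triangle_ineq)
    also have "\<dots> \<le> ?R"
      unfolding L2_set_def using assms F
      by (intro add_mono real_sqrt_le_mono finite_sum_le_infsum) auto
    finally show ?thesis using real_le_lsqrt sqrt_le_D by blast
  qed
  show s: "(\<lambda>i. (norm (f i + g i))\<^sup>2) summable_on A"
    by (rule nonneg_bdd_above_summable_on) (auto intro!: bdd_aboveI[where M = "?R\<^sup>2"] fin)
  have "(\<Sum>\<^sub>\<infinity>i\<in>A. (norm (f i + g i))\<^sup>2) \<le> ?R\<^sup>2"
    by (rule infsum_le_finite_sums[OF s]) (auto intro: fin)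
  thus "sqrt (\<Sum>\<^sub>\<infinity>i\<in>A. (norm (f i + g i))\<^sup>2) \<le> ?R"
    using R0 by (simp add: real_le_lsqrt)
qed

lemma sq_summable_scale:
  fixes f :: "'i \<Rightarrow> 'h::complex_hilbert"
  assumes "(\<lambda>i. (norm (f i))\<^sup>2) summable_on A"
  shows "(\<lambda>i. (norm (c *\<^sub>C f i))\<^sup>2) summable_on A"
  using assms by (simp add: norm_scaleC power_mult_distrib summable_on_cmult_right)

lemma cinner_summable:
  fixes f g :: "'i \<Rightarrow> 'h::complex_hilbert"
  assumes "(\<lambda>i. (norm (f i))\<^sup>2) summable_on A" "(\<lambda>i. (norm (g i))\<^sup>2) summable_on A"
  shows "(\<lambda>i. cinner (f i) (g i)) summable_on A"
proof (rule abs_summable_summable, rule summable_on_comparison_test)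
  show "(\<lambda>i. (norm (f i))\<^sup>2 + (norm (g i))\<^sup>2) summable_on A"
    using assms by (rule summable_on_add)
  show "cmod (cinner (f i) (g i)) \<le> (norm (f i))\<^sup>2 + (norm (g i))\<^sup>2" for i
  proof -
    have "2 * (norm (f i) * norm (g i)) \<le> (norm (f i))\<^sup>2 + (norm (g i))\<^sup>2"
      using sum_squares_bound[of "norm (f i)" "norm (g i)"] by (simp add: mult.assoc)
    moreover have "0 \<le> norm (f i) * norm (g i)" by simp
    ultimately show ?thesis using cauchy_schwarz[of "f i" "g i"] by linarith
  qed
qed auto

instantiation ell2 :: (type, complex_hilbert) real_normed_vector
begin

lift_definition zero_ell2 :: "('a, 'b) ell2" is "\<lambda>_. 0" by simp

lift_definition plus_ell2 :: "('a, 'b) ell2 \<Rightarrow> ('a, 'b) ell2 \<Rightarrow> ('a, 'b) ell2"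
  is "\<lambda>f g i. f i + g i" by (rule sq_summable_add)

lift_definition uminus_ell2 :: "('a, 'b) ell2 \<Rightarrow> ('a, 'b) ell2" is "\<lambda>f i. - f i" by simp

lift_definition minus_ell2 :: "('a, 'b) ell2 \<Rightarrow> ('a, 'b) ell2 \<Rightarrow> ('a, 'b) ell2"
  is "\<lambda>f g i. f i - g i"
proof -
  fix f g :: "'a \<Rightarrow> 'b"
  assume "(\<lambda>i. (norm (f i))\<^sup>2) summable_on UNIV" "(\<lambda>i. (norm (g i))\<^sup>2) summable_on UNIV"
  thus "(\<lambda>i. (norm (f i - g i))\<^sup>2) summable_on UNIV"
    using sq_summable_add(1)[of f UNIV "\<lambda>i. - g i"] by simp
qed

lift_definition scaleR_ell2 :: "real \<Rightarrow> ('a, 'b) ell2 \<Rightarrow> ('a, 'b) ell2"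
  is "\<lambda>r f i. r *\<^sub>R f i" by (simp add: power_mult_distrib summable_on_cmult_right)

lift_definition norm_ell2 :: "('a, 'b) ell2 \<Rightarrow> real"
  is "\<lambda>f. sqrt (\<Sum>\<^sub>\<infinity>i. (norm (f i))\<^sup>2)" .

definition "sgn (f :: ('a, 'b) ell2) = inverse (norm f) *\<^sub>R f"

definition "dist (f :: ('a, 'b) ell2) g = norm (f - g)"

definition [code del]:
  "(uniformity :: (('a, 'b) ell2 \<times> ('a, 'b) ell2) filter) = (INF e\<in>{0<..}. principal {(x, y). dist x y < e})"

definition [code del]:
  "open (U :: ('a, 'b) ell2 set) \<longleftrightarrow> (\<forall>x\<in>U. \<forall>\<^sub>F (x', y) in uniformity. x' = x \<longrightarrow> y \<in> U)"

lemma norm_le_ell2: "norm (Rep_ell2 f i) \<le> norm (f :: ('a, 'b) ell2)"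
proof transfer
  fix f :: "'a \<Rightarrow> 'b" and i
  assume "(\<lambda>i. (norm (f i))\<^sup>2) summable_on UNIV"
  hence "(\<Sum>i\<in>{i}. (norm (f i))\<^sup>2) \<le> (\<Sum>\<^sub>\<infinity>i. (norm (f i))\<^sup>2)"
    by (intro finite_sum_le_infsum) auto
  thus "norm (f i) \<le> sqrt (\<Sum>\<^sub>\<infinity>i. (norm (f i))\<^sup>2)"
    by (simp add: real_le_rsqrt)
qed

instance
proof
  fix x y z :: "('a, 'b) ell2" and a b :: real
  show "x + y + z = x + (y + z)" by transfer (simp add: add.assoc)
  show "x + y = y + x" by transfer (simp add: add.commute)
  show "0 + x = x" by transfer simp
  show "- x + x = 0" by transfer simp
  show "x - y = x + - y" by transfer simp
  show "a *\<^sub>R (x + y) = a *\<^sub>R x + a *\<^sub>R y" by transfer (simp add: scaleR_add_right)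
  show "(a + b) *\<^sub>R x = a *\<^sub>R x + b *\<^sub>R x" by transfer (simp add: scaleR_add_left)
  show "a *\<^sub>R b *\<^sub>R x = (a * b) *\<^sub>R x" by transfer simp
  show "1 *\<^sub>R x = x" by transfer simp
  show "dist x y = norm (x - y)" by (rule dist_ell2_def)
  show "sgn x = inverse (norm x) *\<^sub>R x" by (rule sgn_ell2_def)
  show "(uniformity :: (('a, 'b) ell2 \<times> ('a, 'b) ell2) filter)
      = (INF e\<in>{0<..}. principal {(x, y). dist x y < e})"
    by (rule uniformity_ell2_def)
  fix U :: "('a, 'b) ell2 set"
  show "open U \<longleftrightarrow> (\<forall>x\<in>U. \<forall>\<^sub>F (x', y) in uniformity. x' = x \<longrightarrow> y \<in> U)"
    by (rule open_ell2_def)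
  show "norm x = 0 \<longleftrightarrow> x = 0"
  proof
    assume n: "norm x = 0"
    have "Rep_ell2 x i = 0" for i using norm_le_ell2[of x i] n by simp
    thus "x = 0" by transfer auto
  next
    assume "x = 0" thus "norm x = 0" by transfer simp
  qed
  show "norm (x + y) \<le> norm x + norm y" by transfer (rule sq_summable_add)
  show "norm (a *\<^sub>R x) = \<bar>a\<bar> * norm x"
    by transfer (simp add: power_mult_distrib infsum_cmult_right' real_sqrt_mult)
qed

end

instantiation ell2 :: (type, complex_hilbert) complex_hilbert
begin

lift_definition scaleC_ell2 :: "complex \<Rightarrow> ('a, 'b) ell2 \<Rightarrow> ('a, 'b) ell2"
  is "\<lambda>c f i. c *\<^sub>C f i" by (rule sq_summable_scale)

lift_definition cinner_ell2 :: "('a, 'b) ell2 \<Rightarrow> ('a, 'b) ell2 \<Rightarrow> complex"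
  is "\<lambda>f g. \<Sum>\<^sub>\<infinity>i. cinner (f i) (g i)" .

instance
proof
  fix x y z :: "('a, 'b) ell2" and a :: real and c d :: complex
  show "c *\<^sub>C (x + y) = c *\<^sub>C x + c *\<^sub>C y" by transfer (simp add: scaleC_add_right)
  show "(c + d) *\<^sub>C x = c *\<^sub>C x + d *\<^sub>C x" by transfer (simp add: scaleC_add_left)
  show "c *\<^sub>C d *\<^sub>C x = (c * d) *\<^sub>C x" by transfer (simp add: scaleC_scaleC)
  show "complex_of_real a *\<^sub>C x = a *\<^sub>R x" by transfer (simp add: scaleC_of_real)
  show "cinner x y = cnj (cinner y x)"
    by transfer (simp flip: infsum_cnj cinner_commute)
  show "cinner x (y + z) = cinner x y + cinner x z"
    by transfer (simp add: cinner_add_right infsum_add cinner_summable)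
  show "cinner x (c *\<^sub>C y) = c * cinner x y"
    by transfer (simp add: cinner_scaleC_right infsum_cmult_right')
  show "cinner x x = complex_of_real ((norm x)\<^sup>2)"
  proof transfer
    fix f :: "'a \<Rightarrow> 'b"
    assume f: "(\<lambda>i. (norm (f i))\<^sup>2) summable_on UNIV"
    have "(\<Sum>\<^sub>\<infinity>i. cinner (f i) (f i)) = (\<Sum>\<^sub>\<infinity>i. complex_of_real ((norm (f i))\<^sup>2))"
      by (simp only: cinner_self)
    also have "\<dots> = complex_of_real (\<Sum>\<^sub>\<infinity>i. (norm (f i))\<^sup>2)"
      by (rule infsumI, rule has_sum_of_real, rule has_sum_infsum, rule f)
    finally show "(\<Sum>\<^sub>\<infinity>i. cinner (f i) (f i)) = complex_of_real ((sqrt (\<Sum>\<^sub>\<infinity>i. (norm (f i))\<^sup>2))\<^sup>2)"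
      by (simp add: infsum_nonneg)
  qed
next
  fix X :: "nat \<Rightarrow> ('a, 'b) ell2"
  assume X: "Cauchy X"
  have C: "Cauchy (\<lambda>n. Rep_ell2 (X n) i)" for i
  proof (rule metric_CauchyI)
    fix e :: real assume "e > 0"
    with X obtain M where M: "\<And>m n. m \<ge> M \<Longrightarrow> n \<ge> M \<Longrightarrow> dist (X m) (X n) < e"
      unfolding Cauchy_def by blast
    have "dist (Rep_ell2 (X m) i) (Rep_ell2 (X n) i) < e" if "m \<ge> M" "n \<ge> M" for m n
    proof -
      have "norm (Rep_ell2 (X m - X n) i) \<le> norm (X m - X n)" by (rule norm_le_ell2)
      thus ?thesis using M[OF that] by (simp add: dist_norm dist_ell2_def minus_ell2.rep_eq)
    qed
    thus "\<exists>M. \<forall>m\<ge>M. \<forall>n\<ge>M. dist (Rep_ell2 (X m) i) (Rep_ell2 (X n) i) < e" by blast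
  qed
  then obtain g where g: "\<And>i. (\<lambda>n. Rep_ell2 (X n) i) \<longlonglongrightarrow> g i"
    unfolding Cauchy_convergent_iff convergent_def by metis
  have fin: "(\<Sum>i\<in>F. (norm (g i - Rep_ell2 (X n) i))\<^sup>2) \<le> e\<^sup>2"
    if "finite F" and M: "\<And>m. m \<ge> M \<Longrightarrow> dist (X m) (X n) \<le> e" and "e > 0" for F e M n
  proof (rule tendsto_upperbound)
    show "(\<lambda>m. \<Sum>i\<in>F. (norm (Rep_ell2 (X m) i - Rep_ell2 (X n) i))\<^sup>2)
      \<longlonglongrightarrow> (\<Sum>i\<in>F. (norm (g i - Rep_ell2 (X n) i))\<^sup>2)"
      by (intro tendsto_intros g)
    show "\<forall>\<^sub>F m in sequentially. (\<Sum>i\<in>F. (norm (Rep_ell2 (X m) i - Rep_ell2 (X n) i))\<^sup>2) \<le> e\<^sup>2"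
      using eventually_ge_at_top[of M]
    proof eventually_elim
      case (elim m)
      have "(\<lambda>i. (norm (Rep_ell2 (X m - X n) i))\<^sup>2) summable_on UNIV" using Rep_ell2 by blast
      hence "(\<Sum>i\<in>F. (norm (Rep_ell2 (X m - X n) i))\<^sup>2) \<le> (\<Sum>\<^sub>\<infinity>i. (norm (Rep_ell2 (X m - X n) i))\<^sup>2)"
        using \<open>finite F\<close> by (intro finite_sum_le_infsum) auto
      also have "\<dots> = (dist (X m) (X n))\<^sup>2"
        by (simp add: dist_ell2_def norm_ell2.rep_eq infsum_nonneg)
      also have "\<dots> \<le> e\<^sup>2" by (rule power_mono[OF M[OF elim] zero_le_dist])
      finally show ?case by (simp add: minus_ell2.rep_eq)
    qed
  qed simp
  have key: "\<exists>M. \<forall>n\<ge>M. (\<lambda>i. (norm (g i - Rep_ell2 (X n) i))\<^sup>2) summable_on UNIV \<and>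
      sqrt (\<Sum>\<^sub>\<infinity>i. (norm (g i - Rep_ell2 (X n) i))\<^sup>2) \<le> e" if e: "e > 0" for e
  proof -
    obtain M where M: "\<And>m n. m \<ge> M \<Longrightarrow> n \<ge> M \<Longrightarrow> dist (X m) (X n) < e"
      using X e unfolding Cauchy_def by blast
    have "(\<lambda>i. (norm (g i - Rep_ell2 (X n) i))\<^sup>2) summable_on UNIV \<and>
      sqrt (\<Sum>\<^sub>\<infinity>i. (norm (g i - Rep_ell2 (X n) i))\<^sup>2) \<le> e" if n: "n \<ge> M" for n
    proof -
      have f: "(\<Sum>i\<in>F. (norm (g i - Rep_ell2 (X n) i))\<^sup>2) \<le> e\<^sup>2" if "finite F" for F
        using fin[OF that _ e, of M n] M n by (meson less_imp_le)
      have s: "(\<lambda>i. (norm (g i - Rep_ell2 (X n) i))\<^sup>2) summable_on UNIV"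
        by (rule nonneg_bdd_above_summable_on) (auto intro!: bdd_aboveI[where M = "e\<^sup>2"] f)
      have "(\<Sum>\<^sub>\<infinity>i. (norm (g i - Rep_ell2 (X n) i))\<^sup>2) \<le> e\<^sup>2"
        by (rule infsum_le_finite_sums[OF s]) (auto intro: f)
      thus ?thesis using s e by (simp add: real_le_lsqrt)
    qed
    thus ?thesis by blast
  qed
  obtain N where "(\<lambda>i. (norm (g i - Rep_ell2 (X N) i))\<^sup>2) summable_on UNIV"
    using key[of 1] by auto
  moreover have "(\<lambda>i. (norm (Rep_ell2 (X N) i))\<^sup>2) summable_on UNIV" using Rep_ell2 by blast
  ultimately have "(\<lambda>i. (norm (g i))\<^sup>2) summable_on UNIV"
    using sq_summable_add(1)[of "\<lambda>i. g i - Rep_ell2 (X N) i" UNIV "Rep_ell2 (X N)"] by simp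
  hence Rg: "Rep_ell2 (Abs_ell2 g) = g" by (simp add: Abs_ell2_inverse)
  have "X \<longlonglongrightarrow> Abs_ell2 g"
  proof (rule metric_LIMSEQ_I)
    fix r :: real assume "r > 0"
    hence "r / 2 > 0" by simp
    from key[OF this] obtain M where M: "\<And>n. n \<ge> M \<Longrightarrow>
      sqrt (\<Sum>\<^sub>\<infinity>i. (norm (g i - Rep_ell2 (X n) i))\<^sup>2) \<le> r / 2" by blast
    have "dist (X n) (Abs_ell2 g) < r" if "n \<ge> M" for n
    proof -
      have "dist (X n) (Abs_ell2 g) = sqrt (\<Sum>\<^sub>\<infinity>i. (norm (g i - Rep_ell2 (X n) i))\<^sup>2)"
        by (simp add: dist_ell2_def norm_ell2.rep_eq minus_ell2.rep_eq Rg norm_minus_commute)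
      thus ?thesis using M[OF that] \<open>r > 0\<close> by simp
    qed
    thus "\<exists>no. \<forall>n\<ge>no. dist (X n) (Abs_ell2 g) < r" by blast
  qed
  thus "convergent X" unfolding convergent_def by blast
qed

end


section \<open>Bounded operators and concrete C*-algebras\<close>

type_synonym 'h op = "'h \<Rightarrow>\<^sub>L 'h"

(* The library type of bounded linear maps consists of the real linear ones. *)
definition bops :: "'h::complex_hilbert op set"
  where "bops = {T :: 'h op. \<forall>c x. T (c *\<^sub>C x) = c *\<^sub>C T x}"

lift_definition scale_op :: "complex \<Rightarrow> 'h::complex_hilbert op \<Rightarrow> 'h op" (infixr \<open>\<cdot>\<^sub>C\<close> 75)
  is "\<lambda>c T x. c *\<^sub>C T x"
proof -
  fix c :: complex and T :: "'h \<Rightarrow> 'h"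
  assume T: "bounded_linear T"
  have "bounded_linear (\<lambda>x::'h. c *\<^sub>C x)"
  proof (rule bounded_linear_intro)
    show "c *\<^sub>C (r *\<^sub>R x) = r *\<^sub>R c *\<^sub>C x" for r and x :: 'h
      by (simp add: scaleC_of_real[symmetric] scaleC_scaleC mult.commute)
    show "norm (c *\<^sub>C x) \<le> norm x * cmod c" for x :: 'h by (simp add: norm_scaleC mult.commute)
  qed (rule scaleC_add_right)
  thus "bounded_linear (\<lambda>x. c *\<^sub>C T x)" using T by (rule bounded_linear_compose)
qed

definition adj :: "'h::complex_hilbert op \<Rightarrow> 'h op"
  where "adj T = (THE S :: 'h op. \<forall>x y. cinner (S x) y = cinner x (T y))"

definition isometry_op :: "'h::complex_hilbert op \<Rightarrow> bool"
  where "isometry_op T \<longleftrightarrow> T \<in> bops \<and> (\<forall>x. norm (T x) = norm x)"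

definition unitary_op :: "'h::complex_hilbert op \<Rightarrow> bool"
  where "unitary_op T \<longleftrightarrow> T \<in> bops \<and> adj T o\<^sub>L T = id_blinfun \<and> T o\<^sub>L adj T = id_blinfun"

definition cstar_algebra :: "'h::complex_hilbert op set \<Rightarrow> bool"
  where "cstar_algebra A \<longleftrightarrow> A \<subseteq> bops \<and> 0 \<in> A \<and> closed A \<and>
    (\<forall>S\<in>A. \<forall>T\<in>A. S + T \<in> A \<and> S o\<^sub>L T \<in> A) \<and>
    (\<forall>T\<in>A. adj T \<in> A \<and> (\<forall>c. c \<cdot>\<^sub>C T \<in> A))"

definition cstar :: "'h::complex_hilbert op set \<Rightarrow> 'h op set"
  where "cstar S = cstar_algebra hull S"

definition closed_ideal :: "'h::complex_hilbert op set \<Rightarrow> 'h op set \<Rightarrow> bool"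
  where "closed_ideal A J \<longleftrightarrow> J \<subseteq> A \<and> 0 \<in> J \<and> closed J \<and>
    (\<forall>S\<in>J. \<forall>T\<in>J. S + T \<in> J) \<and> (\<forall>T\<in>J. \<forall>c. c \<cdot>\<^sub>C T \<in> J) \<and>
    (\<forall>S\<in>A. \<forall>T\<in>J. S o\<^sub>L T \<in> J \<and> T o\<^sub>L S \<in> J)"

definition star_hom ::
  "'h::complex_hilbert op set \<Rightarrow> 'k::complex_hilbert op set \<Rightarrow> ('h op \<Rightarrow> 'k op) \<Rightarrow> bool"
  where "star_hom A B \<phi> \<longleftrightarrow> \<phi> \<in> A \<rightarrow> B \<and>
    (\<forall>S\<in>A. \<forall>T\<in>A. \<phi> (S + T) = \<phi> S + \<phi> T \<and> \<phi> (S o\<^sub>L T) = \<phi> S o\<^sub>L \<phi> T) \<and>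
    (\<forall>T\<in>A. \<phi> (adj T) = adj (\<phi> T) \<and> (\<forall>c. \<phi> (c \<cdot>\<^sub>C T) = c \<cdot>\<^sub>C \<phi> T))"


subsection \<open>Direct sums and minimal tensor products\<close>

lift_definition slice :: "('r \<times> 'i, 'h::complex_hilbert) ell2 \<Rightarrow> 'r \<Rightarrow> ('i, 'h) ell2"
  is "\<lambda>f r i. f (r, i)"
proof -
  fix f :: "'r \<times> 'i \<Rightarrow> 'h" and r
  assume "(\<lambda>x. (norm (f x))\<^sup>2) summable_on UNIV"
  hence "(\<lambda>x. (norm (f x))\<^sup>2) summable_on range (Pair r)"
    by (rule summable_on_subset_banach) simp
  thus "(\<lambda>i. (norm (f (r, i)))\<^sup>2) summable_on UNIV"
    by (subst (asm) summable_on_reindex) (auto simp: inj_on_def o_def)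
qed

(* The direct sum of a uniformly bounded family of operators, where the direct sum over r of the
   spaces of families over 'i is realised as the space of families over pairs (r, i). *)
definition dsum :: "('r \<Rightarrow> ('i, 'h::complex_hilbert) ell2 op) \<Rightarrow> ('r \<times> 'i, 'h) ell2 op"
  where "dsum T = (THE S :: ('r \<times> 'i, 'h) ell2 op. \<forall>f r. slice (S f) r = T r (slice f r))"

lift_definition tensor_vec :: "'h::complex_hilbert \<Rightarrow> ('i, complex) ell2 \<Rightarrow> ('i, 'h) ell2"
  is "\<lambda>x f i. f i *\<^sub>C x"
  by (simp add: norm_scaleC power_mult_distrib summable_on_cmult_left)

definition tensor_op ::
  "'h::complex_hilbert op \<Rightarrow> ('i, complex) ell2 op \<Rightarrow> ('i, 'h) ell2 op" (infixr \<open>\<otimes>\<^sub>C\<close> 70)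
  where "S \<otimes>\<^sub>C T = (THE R :: ('i, 'h) ell2 op. R \<in> bops \<and> (\<forall>x f. R (tensor_vec x f) = tensor_vec (S x) (T f)))"

(* The real span suffices, since the set of elementary tensors is closed under complex scalars. *)
definition min_tensor ::
  "'h::complex_hilbert op set \<Rightarrow> ('i, complex) ell2 op set \<Rightarrow> ('i, 'h) ell2 op set"
  where "min_tensor A B = closure (span {S \<otimes>\<^sub>C T | S T. S \<in> A \<and> T \<in> B})"


section \<open>Representations of groups and semigroups\<close>

(* Universal C*-algebras are realised on the direct sum of all representations on one sufficiently
   large Hilbert space.  Any space generated from one vector by the generators and their adjoints
   has Hilbert dimension at most the number of words in the generators and their adjoints, whence
   the families over such words suffice. *)
type_synonym 'a word_space = "(('a \<times> bool) list, complex) ell2"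

definition unitary_reps :: "('g, 'm) monoid_scheme \<Rightarrow> ('g \<Rightarrow> 'h::complex_hilbert op) set"
  where "unitary_reps G = {\<rho> \<in> carrier G \<rightarrow>\<^sub>E {U. unitary_op U}.
    \<forall>g\<in>carrier G. \<forall>h\<in>carrier G. \<rho> (g \<otimes>\<^bsub>G\<^esub> h) = \<rho> g o\<^sub>L \<rho> h}"

type_synonym 'g group_space =
  "(('g \<Rightarrow> 'g word_space op) \<times> ('g \<times> bool) list, complex) ell2"

(* Indices that are not representations contribute a copy of the trivial representation. *)
definition group_unitary :: "('g, 'm) monoid_scheme \<Rightarrow> 'g \<Rightarrow> 'g group_space op"
  where "group_unitary G g = dsum (\<lambda>\<rho>. if \<rho> \<in> unitary_reps G then \<rho> g else id_blinfun)"

definition group_cstar :: "('g, 'm) monoid_scheme \<Rightarrow> 'g group_space op set"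
  where "group_cstar G = cstar (group_unitary G ` carrier G)"

definition semigroup_reps ::
  "('g, 'm) monoid_scheme \<Rightarrow> 'g set \<Rightarrow> ('g \<Rightarrow> 'h::complex_hilbert op) set"
  where "semigroup_reps G P = {w \<in> P \<rightarrow>\<^sub>E bops.
    \<forall>p\<in>P. \<forall>q\<in>P. w (p \<otimes>\<^bsub>G\<^esub> q) = w p o\<^sub>L w q}"

definition isometric_reps ::
  "('g, 'm) monoid_scheme \<Rightarrow> 'g set \<Rightarrow> ('g \<Rightarrow> 'h::complex_hilbert op) set"
  where "isometric_reps G P = {w \<in> semigroup_reps G P. \<forall>p\<in>P. isometry_op (w p)}"

(* The universal isometric representation; it generates the C*-algebra T(P).  Indices that are not
   isometric representations contribute a copy of the trivial representation. *)
definition univ_isometry :: "('g, 'm) monoid_scheme \<Rightarrow> 'g set \<Rightarrow> 'g \<Rightarrow> 'g group_space op"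
  where "univ_isometry G P p = dsum (\<lambda>\<rho>. if \<rho> \<in> isometric_reps G P then \<rho> p else id_blinfun)"

definition equivariant_semigroup_rep ::
  "('g, 'm) monoid_scheme \<Rightarrow> 'g set \<Rightarrow> ('g \<Rightarrow> 'h::complex_hilbert op) \<Rightarrow> bool"
  where "equivariant_semigroup_rep G P w \<longleftrightarrow>
    (\<exists>\<delta>. star_hom (cstar (w ` P)) (min_tensor (cstar (w ` P)) (group_cstar G)) \<delta> \<and>
      (\<forall>p\<in>P. \<delta> (w p) = w p \<otimes>\<^sub>C group_unitary G p))"


subsection \<open>Words\<close>

(* The list [(p1, q1), ..., (pn, qn)] stands for the word (p1, q1, ..., pn, qn). *)

fun word_val :: "('g, 'm) monoid_scheme \<Rightarrow> ('g \<times> 'g) list \<Rightarrow> 'g"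
  where
    "word_val G [] = \<one>\<^bsub>G\<^esub>"
  | "word_val G ((p, q) # \<alpha>) = (inv\<^bsub>G\<^esub> p \<otimes>\<^bsub>G\<^esub> q) \<otimes>\<^bsub>G\<^esub> word_val G \<alpha>"

definition neutral_words :: "('g, 'm) monoid_scheme \<Rightarrow> 'g set \<Rightarrow> ('g \<times> 'g) list set"
  where "neutral_words G P = {\<alpha>. \<alpha> \<noteq> [] \<and> set \<alpha> \<subseteq> P \<times> P \<and> word_val G \<alpha> = \<one>\<^bsub>G\<^esub>}"

definition left_preimage :: "('g, 'm) monoid_scheme \<Rightarrow> 'g set \<Rightarrow> 'g \<Rightarrow> 'g set \<Rightarrow> 'g set"
  where "left_preimage G P p Z = {y \<in> P. p \<otimes>\<^bsub>G\<^esub> y \<in> Z}"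

definition word_ideal :: "('g, 'm) monoid_scheme \<Rightarrow> 'g set \<Rightarrow> ('g \<times> 'g) list \<Rightarrow> 'g set"
  where "word_ideal G P \<alpha> = foldl (\<lambda>Z (p, q). left_preimage G P q (p <#\<^bsub>G\<^esub> Z)) P \<alpha>"

definition word_op :: "('g \<Rightarrow> 'h::complex_hilbert op) \<Rightarrow> ('g \<times> 'g) list \<Rightarrow> 'h op"
  where "word_op w \<alpha> = foldr (\<lambda>(p, q) T. adj (w p) o\<^sub>L w q o\<^sub>L T) \<alpha> id_blinfun"

definition cond_T1 :: "('g, 'm) monoid_scheme \<Rightarrow> ('g \<Rightarrow> 'h::complex_hilbert op) \<Rightarrow> bool"
  where "cond_T1 G w \<longleftrightarrow> w \<one>\<^bsub>G\<^esub> = id_blinfun"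

definition cond_T2 :: "('g, 'm) monoid_scheme \<Rightarrow> 'g set \<Rightarrow> ('g \<Rightarrow> 'h::complex_hilbert op) \<Rightarrow> bool"
  where "cond_T2 G P w \<longleftrightarrow> (\<forall>\<alpha>\<in>neutral_words G P. word_ideal G P \<alpha> = {} \<longrightarrow> word_op w \<alpha> = 0)"

definition cond_T3 :: "('g, 'm) monoid_scheme \<Rightarrow> 'g set \<Rightarrow> ('g \<Rightarrow> 'h::complex_hilbert op) \<Rightarrow> bool"
  where "cond_T3 G P w \<longleftrightarrow> (\<forall>\<alpha>\<in>neutral_words G P. \<forall>\<beta>\<in>neutral_words G P.
    word_ideal G P \<alpha> = word_ideal G P \<beta> \<longrightarrow> word_op w \<alpha> = word_op w \<beta>)"

(* The product over the finite set F = set bs is formed along every enumeration bs of F; the factors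
   commute as soon as T1--T3 hold. *)
definition cond_T4 :: "('g, 'm) monoid_scheme \<Rightarrow> 'g set \<Rightarrow> ('g \<Rightarrow> 'h::complex_hilbert op) \<Rightarrow> bool"
  where "cond_T4 G P w \<longleftrightarrow> (\<forall>\<alpha>\<in>neutral_words G P. \<forall>bs. bs \<noteq> [] \<and> distinct bs \<and>
    set bs \<subseteq> neutral_words G P \<and> word_ideal G P \<alpha> = (\<Union>\<beta>\<in>set bs. word_ideal G P \<beta>) \<longrightarrow>
    foldr (\<lambda>\<beta> T. (word_op w \<alpha> - word_op w \<beta>) o\<^sub>L T) bs id_blinfun = 0)"


section \<open>Product systems\<close>

definition product_system ::
  "('g, 'm) monoid_scheme \<Rightarrow> 'g set \<Rightarrow> ('g \<Rightarrow> 'x::complex_hilbert op set) \<Rightarrow> bool"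
  where "product_system G P X \<longleftrightarrow>
    (\<forall>p\<in>P. X p \<subseteq> bops \<and> 0 \<in> X p \<and> closed (X p) \<and>
      (\<forall>\<xi>\<in>X p. \<forall>\<eta>\<in>X p. \<xi> + \<eta> \<in> X p) \<and> (\<forall>\<xi>\<in>X p. \<forall>c. c \<cdot>\<^sub>C \<xi> \<in> X p)) \<and>
    cstar_algebra (X \<one>\<^bsub>G\<^esub>) \<and>
    (\<forall>p\<in>P. \<forall>q\<in>P. \<forall>\<xi>\<in>X p. \<forall>\<eta>\<in>X q. \<xi> o\<^sub>L \<eta> \<in> X (p \<otimes>\<^bsub>G\<^esub> q)) \<and>
    (\<forall>p\<in>P. \<forall>q\<in>P. \<forall>\<xi>\<in>X p. \<forall>\<eta>\<in>X (p \<otimes>\<^bsub>G\<^esub> q). adj \<xi> o\<^sub>L \<eta> \<in> X q)"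

(* Multiplicativity of the map on the unit fibre is the instance p = q = unit of the first product
   rule. *)
definition ps_reps ::
  "('g, 'm) monoid_scheme \<Rightarrow> 'g set \<Rightarrow> ('g \<Rightarrow> 'x::complex_hilbert op set) \<Rightarrow>
    ('g \<Rightarrow> 'x op \<Rightarrow> 'k::complex_hilbert op) set"
  where "ps_reps G P X = {t \<in> (\<Pi>\<^sub>E p\<in>P. X p \<rightarrow>\<^sub>E bops).
    (\<forall>p\<in>P. \<forall>\<xi>\<in>X p. (\<forall>\<eta>\<in>X p. t p (\<xi> + \<eta>) = t p \<xi> + t p \<eta>) \<and>
      (\<forall>c. t p (c \<cdot>\<^sub>C \<xi>) = c \<cdot>\<^sub>C t p \<xi>)) \<and>
    (\<forall>a\<in>X \<one>\<^bsub>G\<^esub>. t \<one>\<^bsub>G\<^esub> (adj a) = adj (t \<one>\<^bsub>G\<^esub> a)) \<and>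
    (\<forall>p\<in>P. \<forall>q\<in>P. \<forall>\<xi>\<in>X p. \<forall>\<eta>\<in>X q. t p \<xi> o\<^sub>L t q \<eta> = t (p \<otimes>\<^bsub>G\<^esub> q) (\<xi> o\<^sub>L \<eta>)) \<and>
    (\<forall>p\<in>P. \<forall>q\<in>P. \<forall>\<xi>\<in>X p. \<forall>\<eta>\<in>X (p \<otimes>\<^bsub>G\<^esub> q).
      adj (t p \<xi>) o\<^sub>L t (p \<otimes>\<^bsub>G\<^esub> q) \<eta> = t q (adj \<xi> o\<^sub>L \<eta>))}"

definition ps_cstar ::
  "'g set \<Rightarrow> ('g \<Rightarrow> 'x::complex_hilbert op set) \<Rightarrow> ('g \<Rightarrow> 'x op \<Rightarrow> 'k::complex_hilbert op) \<Rightarrow> 'k op set"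
  where "ps_cstar P X t = cstar (\<Union>p\<in>P. t p ` X p)"

definition coaction ::
  "('g, 'm) monoid_scheme \<Rightarrow> 'g set \<Rightarrow> ('g \<Rightarrow> 'x::complex_hilbert op set) \<Rightarrow>
    ('g \<Rightarrow> 'x op \<Rightarrow> 'k::complex_hilbert op) \<Rightarrow>
    ('k op \<Rightarrow> (('g \<Rightarrow> 'g word_space op) \<times> ('g \<times> bool) list, 'k) ell2 op) \<Rightarrow> bool"
  where "coaction G P X t \<delta> \<longleftrightarrow>
    star_hom (ps_cstar P X t) (min_tensor (ps_cstar P X t) (group_cstar G)) \<delta> \<and>
    (\<forall>p\<in>P. \<forall>\<xi>\<in>X p. \<delta> (t p \<xi>) = t p \<xi> \<otimes>\<^sub>C group_unitary G p)"

definition equivariant_ps_rep ::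
  "('g, 'm) monoid_scheme \<Rightarrow> 'g set \<Rightarrow> ('g \<Rightarrow> 'x::complex_hilbert op set) \<Rightarrow>
    ('g \<Rightarrow> 'x op \<Rightarrow> 'k::complex_hilbert op) \<Rightarrow> bool"
  where "equivariant_ps_rep G P X t \<longleftrightarrow> (\<exists>\<delta>. coaction G P X t \<delta>)"


subsection \<open>The universal C*-algebra of a product system\<close>

type_synonym ('g, 'x) toeplitz_space =
  "(('g \<Rightarrow> 'x op \<Rightarrow> ('g \<times> 'x op) word_space op) \<times> (('g \<times> 'x op) \<times> bool) list, complex) ell2"

(* Indices that are not representations contribute a copy of the zero representation. *)
definition univ_ps_rep ::
  "('g, 'm) monoid_scheme \<Rightarrow> 'g set \<Rightarrow> ('g \<Rightarrow> 'x::complex_hilbert op set) \<Rightarrow>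
    'g \<Rightarrow> 'x op \<Rightarrow> ('g, 'x) toeplitz_space op"
  where "univ_ps_rep G P X p \<xi> = dsum (\<lambda>\<rho>. if \<rho> \<in> ps_reps G P X then \<rho> p \<xi> else 0)"

definition toeplitz ::
  "('g, 'm) monoid_scheme \<Rightarrow> 'g set \<Rightarrow> ('g \<Rightarrow> 'x::complex_hilbert op set) \<Rightarrow>
    ('g, 'x) toeplitz_space op set"
  where "toeplitz G P X = ps_cstar P X (univ_ps_rep G P X)"

(* The coaction is unique on the Toeplitz algebra, so that the choice is immaterial; likewise for
   the two homomorphisms chosen below. *)
definition toeplitz_fixed ::
  "('g, 'm) monoid_scheme \<Rightarrow> 'g set \<Rightarrow> ('g \<Rightarrow> 'x::complex_hilbert op set) \<Rightarrow>
    ('g, 'x) toeplitz_space op set"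
  where "toeplitz_fixed G P X = {c \<in> toeplitz G P X.
    (SOME \<delta>. coaction G P X (univ_ps_rep G P X) \<delta>) c = c \<otimes>\<^sub>C group_unitary G \<one>\<^bsub>G\<^esub>}"

definition induced_hom ::
  "('g, 'm) monoid_scheme \<Rightarrow> 'g set \<Rightarrow> ('g \<Rightarrow> 'x::complex_hilbert op set) \<Rightarrow>
    ('g \<Rightarrow> 'x op \<Rightarrow> 'k::complex_hilbert op) \<Rightarrow> ('g, 'x) toeplitz_space op \<Rightarrow> 'k op"
  where "induced_hom G P X t = (SOME \<phi>. star_hom (toeplitz G P X) (ps_cstar P X t) \<phi> \<and>
    (\<forall>p\<in>P. \<forall>\<xi>\<in>X p. \<phi> (univ_ps_rep G P X p \<xi>) = t p \<xi>))"


subsection \<open>The Fock representation and Fock covariance\<close>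

(* Elements of the Fock module are extended by zero outside P. *)
definition fock_module ::
  "'g set \<Rightarrow> ('g \<Rightarrow> 'x::complex_hilbert op set) \<Rightarrow> ('g \<Rightarrow> 'x op) set"
  where "fock_module P X = {f. (\<forall>r\<in>P. f r \<in> X r) \<and> (\<forall>r. r \<notin> P \<longrightarrow> f r = 0) \<and>
    (\<lambda>r. adj (f r) o\<^sub>L f r) summable_on P}"

definition fock_inner ::
  "'g set \<Rightarrow> ('g \<Rightarrow> 'x::complex_hilbert op) \<Rightarrow> ('g \<Rightarrow> 'x op) \<Rightarrow> 'x op"
  where "fock_inner P f g = (\<Sum>\<^sub>\<infinity>r\<in>P. adj (f r) o\<^sub>L g r)"

definition fock_rep ::
  "('g, 'm) monoid_scheme \<Rightarrow> 'g set \<Rightarrow> 'g \<Rightarrow> 'x::complex_hilbert op \<Rightarrow> ('g \<Rightarrow> 'x op) \<Rightarrow> ('g \<Rightarrow> 'x op)"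
  where "fock_rep G P p \<xi> f =
    (\<lambda>s. if s \<in> p <#\<^bsub>G\<^esub> P then \<xi> o\<^sub>L f (inv\<^bsub>G\<^esub> p \<otimes>\<^bsub>G\<^esub> s) else 0)"

(* The *-homomorphisms from the Toeplitz algebra to the adjointable operators on the Fock module
   that extend the Fock representation.  Adjointability of the image of a is part of the *-rule. *)
definition fock_hom ::
  "('g, 'm) monoid_scheme \<Rightarrow> 'g set \<Rightarrow> ('g \<Rightarrow> 'x::complex_hilbert op set) \<Rightarrow>
    (('g, 'x) toeplitz_space op \<Rightarrow> ('g \<Rightarrow> 'x op) \<Rightarrow> ('g \<Rightarrow> 'x op)) \<Rightarrow> bool"
  where "fock_hom G P X \<Phi> \<longleftrightarrow>
    (\<forall>a\<in>toeplitz G P X. \<forall>f\<in>fock_module P X. \<Phi> a f \<in> fock_module P X \<and>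
      (\<forall>b\<in>toeplitz G P X. \<Phi> (a + b) f = (\<lambda>r. \<Phi> a f r + \<Phi> b f r) \<and> \<Phi> (a o\<^sub>L b) f = \<Phi> a (\<Phi> b f)) \<and>
      (\<forall>c. \<Phi> (c \<cdot>\<^sub>C a) f = (\<lambda>r. c \<cdot>\<^sub>C \<Phi> a f r)) \<and>
      (\<forall>g\<in>fock_module P X. fock_inner P (\<Phi> (adj a) f) g = fock_inner P f (\<Phi> a g))) \<and>
    (\<forall>p\<in>P. \<forall>\<xi>\<in>X p. \<forall>f\<in>fock_module P X. \<Phi> (univ_ps_rep G P X p \<xi>) f = fock_rep G P p \<xi> f)"

definition fock_kernel ::
  "('g, 'm) monoid_scheme \<Rightarrow> 'g set \<Rightarrow> ('g \<Rightarrow> 'x::complex_hilbert op set) \<Rightarrow>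
    ('g, 'x) toeplitz_space op set"
  where "fock_kernel G P X = {c \<in> toeplitz G P X.
    \<forall>f\<in>fock_module P X. (SOME \<Phi>. fock_hom G P X \<Phi>) c f = (\<lambda>_. 0)}"

definition fock_ideal ::
  "('g, 'm) monoid_scheme \<Rightarrow> 'g set \<Rightarrow> ('g \<Rightarrow> 'x::complex_hilbert op set) \<Rightarrow>
    ('g, 'x) toeplitz_space op set"
  where "fock_ideal G P X =
    closed_ideal (toeplitz G P X) hull (fock_kernel G P X \<inter> toeplitz_fixed G P X)"

(* Factorisation through the quotient by the Fock ideal, whose elements are the cosets c + J.  The
   quotient map being a surjective *-homomorphism, the factor is automatically one as well. *)
definition fock_covariant ::
  "('g, 'm) monoid_scheme \<Rightarrow> 'g set \<Rightarrow> ('g \<Rightarrow> 'x::complex_hilbert op set) \<Rightarrow>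
    ('g \<Rightarrow> 'x op \<Rightarrow> 'k::complex_hilbert op) \<Rightarrow> bool"
  where "fock_covariant G P X t \<longleftrightarrow>
    (\<exists>\<psi>. \<forall>c\<in>toeplitz G P X. \<psi> ((+) c ` fock_ideal G P X) = induced_hom G P X t c)"


subsection \<open>The product system of a semigroup\<close>

definition semigroup_ps :: "('g, 'm) monoid_scheme \<Rightarrow> 'g set \<Rightarrow> 'g \<Rightarrow> 'g group_space op set"
  where "semigroup_ps G P p = range (\<lambda>c. c \<cdot>\<^sub>C univ_isometry G P p)"

definition unital_ps_rep ::
  "('g, 'm) monoid_scheme \<Rightarrow> 'g set \<Rightarrow> ('g \<Rightarrow> 'g group_space op \<Rightarrow> 'k::complex_hilbert op) \<Rightarrow> bool"
  where "unital_ps_rep G P t \<longleftrightarrow> t \<one>\<^bsub>G\<^esub> (univ_isometry G P \<one>\<^bsub>G\<^esub>) = id_blinfun"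


section \<open>The spaces of multiples of the universal isometries form a product system\<close>

lemma cinner_diff_right: "cinner x (y - z) = cinner x y - cinner x (z :: 'a::complex_hilbert)"
  using cinner_add_right[of x "y - z" z] by (simp add: algebra_simps)

lemma cinner_diff_left: "cinner (x - y) z = cinner x z - cinner y (z :: 'a::complex_hilbert)"
  using cinner_add_left[of "x - y" y z] by (simp add: algebra_simps)

lemma cinner_scaleR_right: "cinner x (r *\<^sub>R y) = of_real r * cinner x (y :: 'a::complex_hilbert)"
  by (simp add: scaleC_of_real[symmetric] cinner_scaleC_right)

lemma cinner_ext:
  fixes x y :: "'a::complex_hilbert"
  assumes "\<And>z. cinner x z = cinner y z"
  shows "x = y"
proof -
  have "cinner (x - y) (x - y) = 0" using assms by (simp add: cinner_diff_left)
  thus ?thesis by (simp add: cinner_self)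
qed

lemma riesz:
  fixes f :: "'a::complex_hilbert \<Rightarrow> complex"
  assumes add: "\<And>x y. f (x + y) = f x + f y" and scale: "\<And>c x. f (c *\<^sub>C x) = c * f x"
    and bdd: "\<And>x. cmod (f x) \<le> M * norm x"
  obtains z where "\<And>y. f y = cinner z y"
proof -
  have scaleR: "f (r *\<^sub>R x) = of_real r * f x" for r x
    by (simp add: scaleC_of_real[symmetric] scale)
  have bl: "bounded_linear f"
    by (rule bounded_linear_intro[of _ M]) (auto simp: add scaleR scaleR_conv_of_real bdd mult.commute)
  define J where "J y = (norm y)\<^sup>2 - 2 * Re (f y)" for y
  have J_lower: "- (M\<^sup>2) \<le> J y" for y
  proof -
    have "Re (f y) \<le> M * norm y" using bdd[of y] complex_Re_le_cmod order_trans by blast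
    moreover have "0 \<le> (norm y - M)\<^sup>2" by simp
    ultimately show ?thesis unfolding J_def by (simp add: power2_eq_square algebra_simps)
  qed
  define m where "m = Inf (range J)"
  have bddJ: "bdd_below (range J)" using J_lower by (auto intro!: bdd_belowI)
  have m_le: "m \<le> J y" for y unfolding m_def by (rule cInf_lower[OF _ bddJ]) simp
  have "\<exists>y. J y < m + inverse (real (Suc n))" for n
  proof -
    have "Inf (range J) < m + inverse (real (Suc n))" unfolding m_def by simp
    thus ?thesis using cInf_lessD[of "range J"] by blast
  qed
  then obtain Y where Y: "\<And>n. J (Y n) < m + inverse (real (Suc n))" by metis
  have par: "(norm (a - b))\<^sup>2 \<le> 2 * J a + 2 * J b - 4 * m" for a b
  proof -
    define h where "h = (1/2) *\<^sub>R (a + b)"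
    have "(norm (a - b))\<^sup>2 = 2 * J a + 2 * J b - 4 * J h"
    proof -
      have "J h = (norm (a + b))\<^sup>2 / 4 - Re (f a) - Re (f b)"
        unfolding J_def h_def by (simp only: scaleR add norm_scaleR) (simp add: power_mult_distrib power2_eq_square field_simps)
      moreover have "(norm (a - b))\<^sup>2 = (norm a)\<^sup>2 - 2 * Re (cinner a b) + (norm b)\<^sup>2"
        using norm_add_sq[of a "-b"] cinner_diff_right[of a 0 b] by simp
      ultimately show ?thesis
        using norm_add_sq[of a b] J_def[of a] J_def[of b] by linarith
    qed
    thus ?thesis using m_le[of h] by linarith
  qed
  have "Cauchy Y"
  proof (rule metric_CauchyI)
    fix e :: real assume e: "e > 0"
    obtain N where N: "inverse (real (Suc N)) < e\<^sup>2 / 4" using e reals_Archimedean[of "e\<^sup>2 / 4"] by auto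
    have "dist (Y k) (Y n) < e" if "k \<ge> N" "n \<ge> N" for k n
    proof -
      have "inverse (real (Suc k)) \<le> inverse (real (Suc N))" "inverse (real (Suc n)) \<le> inverse (real (Suc N))"
        using that by (auto intro!: le_imp_inverse_le)
      hence "(norm (Y k - Y n))\<^sup>2 < e\<^sup>2"
        using par[of "Y k" "Y n"] Y[of k] Y[of n] N by linarith
      thus ?thesis using e by (simp add: dist_norm power_less_imp_less_base)
    qed
    thus "\<exists>N. \<forall>k\<ge>N. \<forall>n\<ge>N. dist (Y k) (Y n) < e" by blast
  qed
  then obtain z where z: "Y \<longlonglongrightarrow> z" using Cauchy_convergent_iff convergent_def by blast
  have "(\<lambda>n. J (Y n)) \<longlonglongrightarrow> J z"
    unfolding J_def by (intro tendsto_intros z bounded_linear.tendsto[OF bl])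
  moreover have "(\<lambda>n. m + inverse (real (Suc n))) \<longlonglongrightarrow> m + 0"
    by (intro tendsto_intros LIMSEQ_inverse_real_of_nat)
  ultimately have "J z \<le> m + 0"
    by (rule LIMSEQ_le) (blast intro: less_imp_le[OF Y])
  hence Jz: "J z \<le> J y" for y using m_le[of y] by simp
  have re: "Re (f y) = Re (cinner z y)" for y
  proof (rule ccontr)
    assume ne: "Re (f y) \<noteq> Re (cinner z y)"
    define d where "d = Re (cinner z y) - Re (f y)"
    have q: "0 \<le> 2 * t * d + t\<^sup>2 * (norm y)\<^sup>2" for t
      using Jz[of "z + t *\<^sub>R y"] unfolding J_def d_def
      by (simp add: norm_add_sq add scaleR cinner_scaleR_right power_mult_distrib algebra_simps)
    have d: "d \<noteq> 0" using ne by (simp add: d_def)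
    show False
    proof (cases "norm y = 0")
      case True
      thus False using q[of "-d"] d by (simp add: not_sum_power2_lt_zero) (metis power2_eq_square zero_less_power2 not_le)
    next
      case False
      define n where "n = (norm y)\<^sup>2"
      have n: "n > 0" using False by (simp add: n_def)
      have "2 * (- d / n) * d + (- d / n)\<^sup>2 * n = - (d\<^sup>2 / n)"
        using n by (simp add: power2_eq_square field_simps)
      moreover have "d\<^sup>2 / n > 0" using d n by simp
      ultimately show False using q[of "- d / n"] unfolding n_def by linarith
    qed
  qed
  have "f y = cinner z y" for y
  proof (rule complex_eqI)
    show "Re (f y) = Re (cinner z y)" by (rule re)
    show "Im (f y) = Im (cinner z y)"
      using re[of "\<i> *\<^sub>C y"] by (simp add: scale cinner_scaleC_right)
  qed
  thus ?thesis by (rule that)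
qed

lemma adj_eqI:
  assumes "\<And>x y. cinner (blinfun_apply S x) y = cinner x (blinfun_apply T y)"
  shows "adj T = S"
  unfolding adj_def
proof (rule the_equality)
  show "\<forall>x y. cinner (blinfun_apply S x) y = cinner x (blinfun_apply T y)" using assms by blast
next
  fix S' assume "\<forall>x y. cinner (blinfun_apply S' x) y = cinner x (blinfun_apply T y)"
  hence S': "cinner (blinfun_apply S' x) y = cinner x (blinfun_apply T y)" for x y by blast
  show "S' = S" by (rule blinfun_eqI, rule cinner_ext) (simp only: assms S')
qed

lemma cinner_adj:
  assumes T: "T \<in> bops"
  shows "cinner (blinfun_apply (adj T) x) y = cinner x (blinfun_apply T y)"
proof -
  have "\<exists>z. \<forall>y. cinner x (blinfun_apply T y) = cinner z y" for x
  proof (rule riesz[of "\<lambda>y. cinner x (blinfun_apply T y)" "norm x * norm T"])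
    show "cinner x (blinfun_apply T (a + b)) = cinner x (blinfun_apply T a) + cinner x (blinfun_apply T b)" for a b
      by (simp add: blinfun.add_right cinner_add_right)
    show "cinner x (blinfun_apply T (c *\<^sub>C a)) = c * cinner x (blinfun_apply T a)" for c a
      using T by (simp add: bops_def cinner_scaleC_right)
    show "cmod (cinner x (blinfun_apply T a)) \<le> norm x * norm T * norm a" for a
    proof -
      have "norm x * norm (blinfun_apply T a) \<le> norm x * (norm T * norm a)"
        by (intro mult_left_mono norm_blinfun) simp
      thus ?thesis using cauchy_schwarz[of x "blinfun_apply T a"] by (simp only: mult.assoc)
    qed
    show "\<exists>z. \<forall>y. cinner x (blinfun_apply T y) = cinner z y"
      if "\<And>y. cinner x (blinfun_apply T y) = cinner z y" for z
      using that by blast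
  qed
  then obtain S where S: "\<And>x y. cinner x (blinfun_apply T y) = cinner (S x) y" by metis
  have "bounded_linear S"
  proof (rule bounded_linear_intro)
    show "S (a + b) = S a + S b" for a b
      by (rule cinner_ext) (simp add: S[symmetric] cinner_add_left)
    show "S (r *\<^sub>R a) = r *\<^sub>R S a" for r a
      by (rule cinner_ext) (simp add: S[symmetric] cinner_scaleC_left flip: scaleC_of_real)
    show "norm (S a) \<le> norm a * norm T" for a
    proof (cases "S a = 0")
      case False
      have "cmod (cinner (S a) (S a)) = cmod (cinner a (blinfun_apply T (S a)))" by (simp add: S)
      also have "\<dots> \<le> norm a * (norm T * norm (S a))"
        by (rule order_trans[OF cauchy_schwarz]) (simp add: mult_left_mono norm_blinfun)
      finally have "norm (S a) * norm (S a) \<le> norm a * norm T * norm (S a)"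
        by (simp add: cinner_self power2_eq_square norm_mult mult.assoc)
      thus ?thesis using False by simp
    qed simp
  qed
  hence "adj T = Blinfun S" by (intro adj_eqI) (simp add: bounded_linear_Blinfun_apply S)
  thus ?thesis using \<open>bounded_linear S\<close> by (simp add: bounded_linear_Blinfun_apply S)
qed

lemma norm_slice:
  shows "(\<lambda>r. (norm (slice f r))\<^sup>2) summable_on UNIV"
    and "(norm f)\<^sup>2 = (\<Sum>\<^sub>\<infinity>r. (norm (slice f r))\<^sup>2)"
proof -
  have f: "(\<lambda>x. (norm (Rep_ell2 f x))\<^sup>2) summable_on (Sigma UNIV (\<lambda>_. UNIV))" using Rep_ell2[of f] by simp
  have n: "(norm (slice f r))\<^sup>2 = (\<Sum>\<^sub>\<infinity>i. (norm (Rep_ell2 f (r, i)))\<^sup>2)" for r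
    by (simp add: norm_ell2.rep_eq slice.rep_eq infsum_nonneg)
  show "(\<lambda>r. (norm (slice f r))\<^sup>2) summable_on UNIV"
    unfolding n using summable_on_Sigma_banach[of "\<lambda>r i. (norm (Rep_ell2 f (r, i)))\<^sup>2" UNIV "\<lambda>_. UNIV"] f
    by (simp add: case_prod_unfold)
  show "(norm f)\<^sup>2 = (\<Sum>\<^sub>\<infinity>r. (norm (slice f r))\<^sup>2)"
    unfolding n using infsum_Sigma_banach[OF f] by (simp add: norm_ell2.rep_eq infsum_nonneg)
qed

lemma slice_add: "slice (f + g) r = slice f r + slice g r" by transfer simp
lemma slice_scaleR: "slice (c *\<^sub>R f) r = c *\<^sub>R slice f r" by transfer simp
lemma slice_scaleC: "slice (c *\<^sub>C f) r = c *\<^sub>C slice f r" by transfer simp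
lemma slice_eqI: "(\<And>r. slice f r = slice g r) \<Longrightarrow> f = g"
  by transfer (auto simp: fun_eq_iff)

lemma slice_dsum:
  assumes M: "\<And>r. norm (T r) \<le> M"
  shows "slice (blinfun_apply (dsum T) f) r = blinfun_apply (T r) (slice f r)"
proof -
  have M0: "0 \<le> M" using M[of undefined] norm_ge_zero order_trans by blast
  define F where "F f = (\<lambda>(r, i). Rep_ell2 (blinfun_apply (T r) (slice f r)) i)" for f
  have le: "(norm (blinfun_apply (T r) (slice f r)))\<^sup>2 \<le> M\<^sup>2 * (norm (slice f r))\<^sup>2" for f r
    unfolding power_mult_distrib[symmetric]
    by (intro power_mono order_trans[OF norm_blinfun] mult_right_mono M) auto
  have s1: "(\<lambda>r. (norm (blinfun_apply (T r) (slice f r)))\<^sup>2) summable_on UNIV" for f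
    by (rule summable_on_comparison_test[OF summable_on_cmult_right[OF norm_slice(1)[of f], of "M\<^sup>2"]]) (use le in auto)
  have s: "(\<lambda>x. (norm (F f x))\<^sup>2) summable_on UNIV" for f
  proof -
    have "(\<lambda>x. norm ((norm (F f x))\<^sup>2)) summable_on (Sigma UNIV (\<lambda>_. UNIV))"
    proof (subst Infinite_Sum.abs_summable_on_Sigma_iff, intro conjI ballI)
      show "(\<lambda>i. norm ((norm (F f (r, i)))\<^sup>2)) summable_on UNIV" for r
        using Rep_ell2[of "blinfun_apply (T r) (slice f r)"] by (simp add: F_def)
      show "(\<lambda>r. norm (\<Sum>\<^sub>\<infinity>i. norm ((norm (F f (r, i)))\<^sup>2))) summable_on UNIV"
        using s1[of f] by (simp add: F_def norm_ell2.rep_eq infsum_nonneg)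
    qed
    thus ?thesis by simp
  qed
  have sl: "slice (Abs_ell2 (F f)) r = blinfun_apply (T r) (slice f r)" for f r
  proof -
    have "Rep_ell2 (Abs_ell2 (F f)) = F f" using s[of f] by (simp add: Abs_ell2_inverse)
    thus ?thesis by (simp add: slice.rep_eq F_def flip: Rep_ell2_inject)
  qed
  have "bounded_linear (\<lambda>f. Abs_ell2 (F f))"
  proof (rule bounded_linear_intro)
    show "Abs_ell2 (F (f + g)) = Abs_ell2 (F f) + Abs_ell2 (F g)" for f g
      by (rule slice_eqI) (simp add: sl slice_add blinfun.add_right)
    show "Abs_ell2 (F (c *\<^sub>R f)) = c *\<^sub>R Abs_ell2 (F f)" for c f
      by (rule slice_eqI) (simp add: sl slice_scaleR blinfun.scaleR_right)
    show "norm (Abs_ell2 (F f)) \<le> norm f * M" for f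
    proof (rule power2_le_imp_le)
      have "(norm (Abs_ell2 (F f)))\<^sup>2 = (\<Sum>\<^sub>\<infinity>r. (norm (blinfun_apply (T r) (slice f r)))\<^sup>2)"
        by (simp add: norm_slice(2) sl)
      also have "\<dots> \<le> (\<Sum>\<^sub>\<infinity>r. M\<^sup>2 * (norm (slice f r))\<^sup>2)"
        by (intro infsum_mono s1 summable_on_cmult_right norm_slice(1) le)
      also have "\<dots> = (norm f * M)\<^sup>2"
        by (simp add: infsum_cmult_right' norm_slice(2)[symmetric] power_mult_distrib mult.commute)
      finally show "(norm (Abs_ell2 (F f)))\<^sup>2 \<le> (norm f * M)\<^sup>2" .
      show "0 \<le> norm f * M" using M0 by simp
    qed
  qed
  hence B: "blinfun_apply (Blinfun (\<lambda>f. Abs_ell2 (F f))) f = Abs_ell2 (F f)" for f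
    by (simp add: bounded_linear_Blinfun_apply)
  have "dsum T = Blinfun (\<lambda>f. Abs_ell2 (F f))"
    unfolding dsum_def
  proof (rule the_equality)
    show "\<forall>f r. slice (blinfun_apply (Blinfun (\<lambda>f. Abs_ell2 (F f))) f) r = blinfun_apply (T r) (slice f r)"
      by (simp add: B sl)
  next
    fix S assume S: "\<forall>f r. slice (blinfun_apply S f) r = blinfun_apply (T r) (slice f r)"
    show "S = Blinfun (\<lambda>f. Abs_ell2 (F f))"
      by (rule blinfun_eqI, rule slice_eqI) (simp add: S B sl)
  qed
  thus ?thesis by (simp add: B sl)
qed

lemma isometry_norm_le: "isometry_op T \<Longrightarrow> norm T \<le> 1"
  by (rule norm_blinfun_bound) (auto simp: isometry_op_def)

lemma isometry_id: "isometry_op id_blinfun"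
  by (simp add: isometry_op_def bops_def)

lemma isometry_dsum:
  assumes T: "\<And>r. isometry_op (T r)"
  shows "isometry_op (dsum T)"
proof -
  have s: "slice (blinfun_apply (dsum T) f) r = blinfun_apply (T r) (slice f r)" for f r
    by (rule slice_dsum[of _ 1]) (intro isometry_norm_le T)
  have "dsum T \<in> bops"
    unfolding bops_def using T by (auto intro!: slice_eqI simp: s slice_scaleC isometry_op_def bops_def)
  moreover have "norm (blinfun_apply (dsum T) f) = norm f" for f
  proof -
    have "(norm (blinfun_apply (dsum T) f))\<^sup>2 = (norm f)\<^sup>2"
      using T by (simp add: norm_slice(2) s isometry_op_def)
    thus ?thesis by simp
  qed
  ultimately show ?thesis by (simp add: isometry_op_def)
qed

lemma adj_isometry:
  assumes T: "isometry_op T"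
  shows "adj T o\<^sub>L T = id_blinfun"
proof (rule blinfun_eqI, rule cinner_ext)
  fix x y
  have Tb: "T \<in> bops" and n: "\<And>x. norm (blinfun_apply T x) = norm x" using T by (auto simp: isometry_op_def)
  have re: "Re (cinner (blinfun_apply T x) (blinfun_apply T y)) = Re (cinner x y)" for x y
    using norm_add_sq[of x y] norm_add_sq[of "blinfun_apply T x" "blinfun_apply T y"] n[of "x + y"]
    by (simp add: n blinfun.add_right)
  have "cinner (blinfun_apply T x) (blinfun_apply T y) = cinner x y"
  proof (rule complex_eqI[OF re])
    show "Im (cinner (blinfun_apply T x) (blinfun_apply T y)) = Im (cinner x y)"
      using re[of x "\<i> *\<^sub>C y"] Tb by (simp add: bops_def cinner_scaleC_right)
  qed
  thus "cinner (blinfun_apply (adj T o\<^sub>L T) x) y = cinner (blinfun_apply id_blinfun x) y"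
    by (simp add: cinner_adj[OF Tb])
qed

lemma compose_assoc: "(R o\<^sub>L S) o\<^sub>L T = R o\<^sub>L (S o\<^sub>L T)"
  by (rule blinfun_eqI) simp

lemma compose_id: "T o\<^sub>L id_blinfun = T"
  by (rule blinfun_eqI) simp

lemma id_compose: "id_blinfun o\<^sub>L T = T"
  by (rule blinfun_eqI) simp

lemma isometry_univ_isometry: "p \<in> P \<Longrightarrow> isometry_op (univ_isometry G P p)"
  unfolding univ_isometry_def by (rule isometry_dsum) (auto simp: isometric_reps_def isometry_id)

lemma slice_univ_isometry:
  assumes "p \<in> P"
  shows "slice (blinfun_apply (univ_isometry G P p) f) \<rho> =
    (if \<rho> \<in> isometric_reps G P then blinfun_apply (\<rho> p) (slice f \<rho>) else slice f \<rho>)"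
  unfolding univ_isometry_def
proof (subst slice_dsum[of _ 1])
  show "norm (if \<rho> \<in> isometric_reps G P then \<rho> p else id_blinfun) \<le> 1" for \<rho> :: "'a \<Rightarrow> 'a word_space op"
    using assms isometry_id[where 'a = "'a word_space"] by (intro isometry_norm_le) (auto simp: isometric_reps_def)
qed simp

lemma univ_isometry_mult:
  assumes "submonoid P G" "p \<in> P" "q \<in> P"
  shows "univ_isometry G P (p \<otimes>\<^bsub>G\<^esub> q) = univ_isometry G P p o\<^sub>L univ_isometry G P q"
proof (rule blinfun_eqI, rule slice_eqI)
  have "p \<otimes>\<^bsub>G\<^esub> q \<in> P" using assms by (simp add: submonoid.m_closed)
  thus "slice (blinfun_apply (univ_isometry G P (p \<otimes>\<^bsub>G\<^esub> q)) f) \<rho> =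
    slice (blinfun_apply (univ_isometry G P p o\<^sub>L univ_isometry G P q) f) \<rho>" for f \<rho>
    using assms by (auto simp: slice_univ_isometry isometric_reps_def semigroup_reps_def)
qed

lemma univ_isometry_one:
  assumes "group G" "submonoid P G"
  shows "univ_isometry G P \<one>\<^bsub>G\<^esub> = id_blinfun"
proof -
  let ?v = "univ_isometry G P \<one>\<^bsub>G\<^esub>"
  have 1: "\<one>\<^bsub>G\<^esub> \<in> P" using assms by (simp add: submonoid.one_closed)
  have "?v o\<^sub>L ?v = ?v"
    using univ_isometry_mult[OF assms(2) 1 1] monoid.l_one[OF group.is_monoid[OF assms(1)] monoid.one_closed[OF group.is_monoid[OF assms(1)]]] by simp
  hence "(adj ?v o\<^sub>L ?v) o\<^sub>L ?v = adj ?v o\<^sub>L ?v" by (simp only: compose_assoc)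
  thus ?thesis by (simp only: adj_isometry[OF isometry_univ_isometry[OF 1]] id_compose)
qed

lemma scale_op_apply [simp]: "blinfun_apply (c \<cdot>\<^sub>C T) x = c *\<^sub>C blinfun_apply T x" by (simp add: scale_op.rep_eq)

lemma adj_scale:
  assumes "T \<in> bops" shows "adj (c \<cdot>\<^sub>C T) = cnj c \<cdot>\<^sub>C adj T"
  by (rule adj_eqI) (simp add: cinner_scaleC_left cinner_scaleC_right cinner_adj[OF assms])

lemma scale_bops: "T \<in> bops \<Longrightarrow> c \<cdot>\<^sub>C T \<in> bops"
  by (simp add: bops_def scaleC_scaleC mult.commute)

lemma scale_comp: "S \<in> bops \<Longrightarrow> (c \<cdot>\<^sub>C S) o\<^sub>L (d \<cdot>\<^sub>C T) = (c * d) \<cdot>\<^sub>C (S o\<^sub>L T)"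
  by (rule blinfun_eqI) (simp add: bops_def scaleC_scaleC)

lemma closed_line:
  fixes v :: "'h::complex_hilbert op"
  assumes v: "isometry_op v"
  shows "closed (range (\<lambda>c. c \<cdot>\<^sub>C v))"
proof (cases "\<exists>x::'h. x \<noteq> 0")
  case False
  hence z: "x = 0" for x :: 'h by blast
  have "c \<cdot>\<^sub>C v = 0" for c
  proof (rule blinfun_eqI)
    show "blinfun_apply (c \<cdot>\<^sub>C v) x = blinfun_apply 0 x" for x
      by (rule trans[OF z z[symmetric]])
  qed
  hence "range (\<lambda>c. c \<cdot>\<^sub>C v) = {0}" by simp
  thus ?thesis by simp
next
  case True
  then obtain y :: 'h where "y \<noteq> 0" by blast
  define x where "x = inverse (norm y) *\<^sub>R y"
  have x: "norm x = 1" using \<open>y \<noteq> 0\<close> by (simp add: x_def)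
  have bc: "bounded_linear (cinner w)" for w :: 'h
  proof (rule bounded_linear_intro)
    show "cmod (cinner w y) \<le> norm y * norm w" for y using cauchy_schwarz[of w y] by (simp add: mult.commute)
  qed (simp_all add: cinner_add_right cinner_scaleR_right scaleR_conv_of_real)
  have bv: "bounded_linear (\<lambda>c. c *\<^sub>C w)" for w :: 'h
  proof (rule bounded_linear_intro)
    show "(r *\<^sub>R c) *\<^sub>C w = r *\<^sub>R c *\<^sub>C w" for r c
      by (simp only: scaleR_conv_of_real scaleC_scaleC[symmetric] scaleC_of_real[of r "c *\<^sub>C w"])
    show "norm (c *\<^sub>C w) \<le> norm c * norm w" for c by (simp only: norm_scaleC)
  qed (rule scaleC_add_left)
  have eq: "range (\<lambda>c. c \<cdot>\<^sub>C v) = {T. \<forall>z. blinfun_apply T z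
      = cinner (blinfun_apply v x) (blinfun_apply T x) *\<^sub>C blinfun_apply v z}" (is "?L = ?R")
  proof
    have "norm (blinfun_apply v x) = 1" using v x unfolding isometry_op_def by metis
    hence 1: "cinner (blinfun_apply v x) (blinfun_apply v x) = 1" by (simp only: cinner_self) simp
    have "c \<cdot>\<^sub>C v \<in> ?R" for c
      unfolding mem_Collect_eq scale_op_apply cinner_scaleC_right 1 by simp
    thus "?L \<subseteq> ?R" by blast
    show "?R \<subseteq> ?L"
    proof
      fix T assume "T \<in> ?R"
      hence T: "blinfun_apply T z = cinner (blinfun_apply v x) (blinfun_apply T x) *\<^sub>C blinfun_apply v z" for z
        by blast
      have "T = cinner (blinfun_apply v x) (blinfun_apply T x) \<cdot>\<^sub>C v"
        by (rule blinfun_eqI) (simp only: scale_op_apply T[symmetric])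
      thus "T \<in> ?L" by (rule range_eqI)
    qed
  qed
  have 1: "continuous_on UNIV (\<lambda>T :: 'h op. blinfun_apply T z)" for z
    by (intro linear_continuous_on blinfun.bounded_linear_left)
  have 2: "continuous_on UNIV (\<lambda>T. cinner (blinfun_apply v x) (blinfun_apply T x) *\<^sub>C blinfun_apply v z)" for z
    by (rule bounded_linear.continuous_on[OF bv], rule bounded_linear.continuous_on[OF bc], rule 1)
  show ?thesis unfolding eq
    by (rule closed_Collect_all, rule closed_Collect_eq, rule 1, rule 2)
qed

lemma product_system_semigroup_ps:
  assumes "group G" "submonoid P G"
  shows "product_system G P (semigroup_ps G P)"
proof -
  let ?v = "univ_isometry G P"
  have iso: "isometry_op (?v p)" if "p \<in> P" for p using isometry_univ_isometry[OF that] .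
  hence b: "?v p \<in> bops" if "p \<in> P" for p using that by (simp add: isometry_op_def)
  have 1: "\<one>\<^bsub>G\<^esub> \<in> P" using assms by (simp add: submonoid.one_closed)
  have zero: "0 = 0 \<cdot>\<^sub>C T" for T :: "'h::complex_hilbert op" by (rule blinfun_eqI) simp
  have add: "c \<cdot>\<^sub>C T + d \<cdot>\<^sub>C T = (c + d) \<cdot>\<^sub>C T" for c d and T :: "'h::complex_hilbert op"
    by (rule blinfun_eqI) (simp add: blinfun.add_left scaleC_add_left)
  have sc: "c \<cdot>\<^sub>C d \<cdot>\<^sub>C T = (c * d) \<cdot>\<^sub>C T" for c d and T :: "'h::complex_hilbert op"
    by (rule blinfun_eqI) (simp add: scaleC_scaleC)
  have mul: "\<xi> o\<^sub>L \<eta> \<in> semigroup_ps G P (p \<otimes>\<^bsub>G\<^esub> q)"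
    if "p \<in> P" "q \<in> P" "\<xi> \<in> semigroup_ps G P p" "\<eta> \<in> semigroup_ps G P q" for p q \<xi> \<eta>
    using that by (auto simp: semigroup_ps_def scale_comp b univ_isometry_mult[OF assms(2)])
  have adj: "adj \<xi> o\<^sub>L \<eta> \<in> semigroup_ps G P q"
    if pq: "p \<in> P" "q \<in> P" "\<xi> \<in> semigroup_ps G P p" "\<eta> \<in> semigroup_ps G P (p \<otimes>\<^bsub>G\<^esub> q)" for p q \<xi> \<eta>
  proof -
    obtain c d where c: "\<xi> = c \<cdot>\<^sub>C ?v p" "\<eta> = d \<cdot>\<^sub>C (?v p o\<^sub>L ?v q)"
      using pq by (auto simp: semigroup_ps_def univ_isometry_mult[OF assms(2)])
    have a: "adj (?v p) \<in> bops"
      unfolding bops_def mem_Collect_eq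
      by (intro allI, rule cinner_ext) (simp add: cinner_adj[OF b[OF pq(1)]] cinner_scaleC_left)
    have "adj \<xi> o\<^sub>L \<eta> = (cnj c * d) \<cdot>\<^sub>C ((adj (?v p) o\<^sub>L ?v p) o\<^sub>L ?v q)"
      unfolding c adj_scale[OF b[OF pq(1)]] scale_comp[OF a] compose_assoc ..
    thus ?thesis by (auto simp: adj_isometry[OF iso[OF pq(1)]] id_compose semigroup_ps_def)
  qed
  have fib: "semigroup_ps G P p \<subseteq> bops" "0 \<in> semigroup_ps G P p" "closed (semigroup_ps G P p)"
    "\<And>\<xi> \<eta>. \<xi> \<in> semigroup_ps G P p \<Longrightarrow> \<eta> \<in> semigroup_ps G P p \<Longrightarrow> \<xi> + \<eta> \<in> semigroup_ps G P p"
    "\<And>\<xi> c. \<xi> \<in> semigroup_ps G P p \<Longrightarrow> c \<cdot>\<^sub>C \<xi> \<in> semigroup_ps G P p" if "p \<in> P" for p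
  proof -
    show "semigroup_ps G P p \<subseteq> bops" using that by (auto simp: semigroup_ps_def intro: scale_bops b)
    show "0 \<in> semigroup_ps G P p" using zero[of "?v p"] by (auto simp: semigroup_ps_def)
    show "closed (semigroup_ps G P p)" unfolding semigroup_ps_def by (rule closed_line[OF iso[OF that]])
  qed (auto simp: semigroup_ps_def add sc)
  have 11: "\<one>\<^bsub>G\<^esub> \<otimes>\<^bsub>G\<^esub> \<one>\<^bsub>G\<^esub> = \<one>\<^bsub>G\<^esub>"
    using assms(1) by (simp add: group.is_monoid)
  have ad1: "adj T \<in> semigroup_ps G P \<one>\<^bsub>G\<^esub>" if "T \<in> semigroup_ps G P \<one>\<^bsub>G\<^esub>" for T
  proof -
    have "id_blinfun \<in> semigroup_ps G P \<one>\<^bsub>G\<^esub>"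
      unfolding semigroup_ps_def univ_isometry_one[OF assms]
      by (rule range_eqI[of _ _ 1], rule blinfun_eqI) simp
    thus ?thesis using adj[OF 1 1 that, of id_blinfun] 11 by (simp add: compose_id)
  qed
  have cs: "cstar_algebra (semigroup_ps G P \<one>\<^bsub>G\<^esub>)"
    unfolding cstar_algebra_def
    by (intro conjI ballI allI fib[OF 1] ad1 mul[OF 1 1, unfolded 11])
  show ?thesis
    unfolding product_system_def by (intro conjI ballI allI cs fib mul adj)
qed

end

theory Submission
  imports Defs
begin

text \<open>The fibre over p being spanned by the universal isometry v p, a representation t of the product
  system amounts to the family of the operators t p (v p), which is an isometric representation of P
  if t is unital.  Under the bijection everything is about the fixed point algebra of the coaction.
  Compressing the coaction to the vacuum vector of the left regular representation of G is a
  conditional expectation that kills all words that are not neutral, so the fixed point algebra is the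
  closed span of the neutral words.  The Fock representation lives on the square summable families
  over P, where a neutral word acts as the projection onto its ideal.  Hence the differences and
  products that occur in (T2)-(T4) lie in the kernel of the Fock representation, and Fock covariance
  makes them vanish.  Conversely, (T3) makes the operators of the neutral words commuting projections,
  and a joint spectral projection of finitely many of them vanishes by (T2) and (T4) unless some point
  of P lies in exactly the corresponding ideals.  So a linear combination of neutral words has at most
  the norm of its Fock image, and every fixed element in the kernel of the Fock representation is
  annihilated.

  The universal algebras are direct sums over representations on one fixed space.  To compare an
  arbitrary representation with them, the cyclic subspace of a vector is embedded into that space
  by a transfinite Gram-Schmidt process.\<close>

section \<open>Closed subspaces and orthogonal projections\<close>

text \<open>The coaction, the induced homomorphism and the Fock homomorphism of the definitions are
  picked by indefinite choice, and \<open>star_hom\<close> contains no boundedness. All that is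
  known of them is algebra on generators, so each is computed on words and carried to limits by a
  bound with factor 2. The factor is crude but harmless, because it only serves to pass to closures.
  The bound by the Fock image must be sharper. An element of the fixed point algebra that is killed
  by the Fock representation is only a limit of combinations of neutral words, and these need not be
  killed themselves. So an argument about exact relations among words does not reach it; what does
  is the estimate of \<open>\<phi> T\<close> by \<open>reg_hom T\<close> with constant 1, uniformly
  over all lengths of \<open>T\<close>. The universal representation contains representations in
  which the unit of P acts as a proper projection, and so does the regular representation on
  families over the whole type of G. The relations are therefore collected in
  \<open>corner_rep\<close>, and words are kept non-empty so that the identity of the ambient space
  never enters the algebras.\<close>

lemma subspace_closure:
  fixes S :: "'a::real_normed_vector set"
  assumes S: "subspace S"
  shows "subspace (closure S)"
proof (unfold subspace_def, intro conjI ballI allI)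
  show "0 \<in> closure S" using S closure_subset subspace_0 by blast
  fix x assume "x \<in> closure S"
  then obtain X where X: "\<And>n. X n \<in> S" "X \<longlonglongrightarrow> x" unfolding closure_sequential by blast
  show "c *\<^sub>R x \<in> closure S" for c
    unfolding closure_sequential
    by (intro exI[of _ "\<lambda>n. c *\<^sub>R X n"]) (auto intro!: tendsto_intros X subspace_scale[OF S])
  fix y assume "y \<in> closure S"
  then obtain Y where Y: "\<And>n. Y n \<in> S" "Y \<longlonglongrightarrow> y" unfolding closure_sequential by blast
  show "x + y \<in> closure S"
    unfolding closure_sequential
    by (intro exI[of _ "\<lambda>n. X n + Y n"]) (auto intro!: tendsto_intros X Y subspace_add[OF S])
qed

section \<open>Operators obtained by closing a bounded linear graph\<close>

lemma graph_closure_bound: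
  fixes \<Gamma> :: "('a::real_normed_vector \<times> 'b::real_normed_vector) set"
  assumes "\<And>a b. (a, b) \<in> \<Gamma> \<Longrightarrow> norm b \<le> M * norm a" "(a, b) \<in> closure \<Gamma>"
  shows "norm b \<le> M * norm a"
proof -
  have "closed {z :: 'a \<times> 'b. norm (snd z) \<le> M * norm (fst z)}"
    by (intro closed_Collect_le continuous_intros)
  hence "closure \<Gamma> \<subseteq> {z. norm (snd z) \<le> M * norm (fst z)}"
    by (rule closure_minimal[rotated]) (use assms(1) in auto)
  thus ?thesis using assms(2) by auto
qed

text \<open>At first component 0 the bound forces the second component to be 0. This is what makes
  the relation single valued, so well-definedness never has to be shown on generators.\<close>

lemma graph_closure_unique:
  fixes \<Gamma> :: "('a::real_normed_vector \<times> 'b::real_normed_vector) set"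
  assumes "subspace \<Gamma>" "\<And>a b. (a, b) \<in> \<Gamma> \<Longrightarrow> norm b \<le> M * norm a"
    and "(a, b) \<in> closure \<Gamma>" "(a, c) \<in> closure \<Gamma>"
  shows "b = c"
proof -
  have "(a, b) - (a, c) \<in> closure \<Gamma>"
    using assms by (intro subspace_diff subspace_closure)
  hence "norm (b - c) \<le> M * norm (0 :: 'a)"
    by (intro graph_closure_bound[OF assms(2)]) auto
  thus ?thesis by simp
qed

lemma graph_closure_exists:
  fixes \<Gamma> :: "('a::real_normed_vector \<times> 'b::banach) set"
  assumes \<Gamma>: "subspace \<Gamma>" and M: "\<And>a b. (a, b) \<in> \<Gamma> \<Longrightarrow> norm b \<le> M * norm a"
    and a: "a \<in> closure (fst ` \<Gamma>)"
  shows "\<exists>b. (a, b) \<in> closure \<Gamma>"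
proof -
  \<comment> \<open>\<open>M\<close> may be 0 or negative if the relation is degenerate, while the
    Cauchy estimate divides by the constant.\<close>
  define N where "N = max M 1"
  have N: "N > 0" "\<And>a b. (a, b) \<in> \<Gamma> \<Longrightarrow> norm b \<le> N * norm a"
    unfolding N_def by (auto intro!: order_trans[OF M] mult_right_mono)
  obtain X where X: "\<And>n. X n \<in> fst ` \<Gamma>" "X \<longlonglongrightarrow> a" using a unfolding closure_sequential by blast
  have "\<forall>n. \<exists>b. (X n, b) \<in> \<Gamma>" using X(1) by force
  then obtain Y where Y: "\<And>n. (X n, Y n) \<in> \<Gamma>" by metis
  have d: "dist (Y m) (Y n) \<le> N * dist (X m) (X n)" for m n
    using N(2)[of "X m - X n" "Y m - Y n"] subspace_diff[OF \<Gamma> Y[of m] Y[of n]]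
      by (simp add: dist_norm)
  have "Cauchy Y"
  proof (rule metric_CauchyI)
    fix e :: real assume e: "e > 0"
    have "Cauchy X" using X(2) convergent_Cauchy convergent_def by blast
    then obtain K where K: "\<And>m n. m \<ge> K \<Longrightarrow> n \<ge> K \<Longrightarrow> dist (X m) (X n) < e / N"
      using e N(1) unfolding Cauchy_def by (meson divide_pos_pos)
    have "dist (Y m) (Y n) < e" if "m \<ge> K" "n \<ge> K" for m n
      using K[OF that] d[of m n] N(1) by (simp add: field_simps)
    thus "\<exists>K. \<forall>m\<ge>K. \<forall>n\<ge>K. dist (Y m) (Y n) < e" by blast
  qed
  then obtain b where "Y \<longlonglongrightarrow> b" using Cauchy_convergent convergent_def by blast
  hence "(\<lambda>n. (X n, Y n)) \<longlonglongrightarrow> (a, b)" using X(2) by (intro tendsto_Pair)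
  with Y have "(a, b) \<in> closure \<Gamma>"
    unfolding closure_sequential by (intro exI[of _ "\<lambda>n. (X n, Y n)"]) simp
  thus ?thesis ..
qed

lemma blinfun_of_graph:
  fixes \<Gamma> :: "('a::real_normed_vector \<times> 'b::banach) set"
  assumes \<Gamma>: "subspace \<Gamma>" and M: "\<And>a b. (a, b) \<in> \<Gamma> \<Longrightarrow> norm b \<le> M * norm a"
    and d: "closure (fst ` \<Gamma>) = UNIV"
  shows "\<exists>T :: 'a \<Rightarrow>\<^sub>L 'b. \<forall>a b. (a, b) \<in> \<Gamma> \<longrightarrow> blinfun_apply T a = b"
proof -
  have "\<forall>a. \<exists>b. (a, b) \<in> closure \<Gamma>" using graph_closure_exists[OF \<Gamma> M] d by blast
  then obtain T where T: "\<And>a. (a, T a) \<in> closure \<Gamma>" by metis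
  have u: "T a = b" if "(a, b) \<in> closure \<Gamma>" for a b
    using graph_closure_unique[OF \<Gamma> M T that] by blast
  have n: "norm (T a) \<le> M * norm a" for a
    by (rule graph_closure_bound[OF M T])
  have "bounded_linear T"
  proof (rule bounded_linear_intro)
    show "T (x + y) = T x + T y" for x y
      using subspace_add[OF subspace_closure[OF \<Gamma>] T[of x] T[of y]] by (intro u) simp
    show "T (r *\<^sub>R x) = r *\<^sub>R T x" for r x
      using subspace_scale[OF subspace_closure[OF \<Gamma>] T[of x]] by (intro u) simp
    show "norm (T x) \<le> norm x * M" for x using n[of x] by (simp add: mult.commute)
  qed
  thus ?thesis using u closure_subset[of \<Gamma>]
    by (intro exI[of _ "Blinfun T"]) (auto simp: bounded_linear_Blinfun_apply)
qed

section \<open>Orthogonality in Hilbert spaces\<close>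

lemma cinner_zero_commute: "cinner x y = 0 \<Longrightarrow> cinner y x = 0"
  for x y :: "'a::complex_hilbert"
  by (metis cinner_commute complex_cnj_zero)

lemma bounded_linear_cinner: "bounded_linear (cinner (w :: 'a::complex_hilbert))"
  by (rule bounded_linear_intro[of _ "norm w"])
    (use cauchy_schwarz[of w] in \<open>auto simp: cinner_add_right cinner_scaleR_right
      scaleR_conv_of_real mult.commute\<close>)

lemma bounded_linear_scaleC: "bounded_linear (\<lambda>x :: 'a::complex_hilbert. c *\<^sub>C x)"
proof (rule bounded_linear_intro[of _ "cmod c"])
  show "c *\<^sub>C (r *\<^sub>R x) = r *\<^sub>R c *\<^sub>C x" for r and x :: 'a
    by (simp add: scaleC_of_real[symmetric] scaleC_scaleC mult.commute)
qed (auto simp: scaleC_add_right norm_scaleC mult.commute)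

lemma scaleC_zero_right [simp]: "c *\<^sub>C (0 :: 'a::complex_hilbert) = 0"
  using bounded_linear.linear[OF bounded_linear_scaleC] linear_0 by blast

lemma norm_sum_orthogonal:
  fixes x :: "'i \<Rightarrow> 'a::complex_hilbert"
  assumes "finite F" "\<And>i j. i \<in> F \<Longrightarrow> j \<in> F \<Longrightarrow> i \<noteq> j \<Longrightarrow> cinner (x i) (x j) = 0"
  shows "(norm (\<Sum>i\<in>F. x i))\<^sup>2 = (\<Sum>i\<in>F. (norm (x i))\<^sup>2)"
  using assms
proof (induction F rule: finite_induct)
  case (insert i F)
  have "cinner (x i) (\<Sum>j\<in>F. x j) = (\<Sum>j\<in>F. cinner (x i) (x j))"
    by (rule linear_sum[OF bounded_linear.linear[OF bounded_linear_cinner]])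
  also have "\<dots> = 0" using insert by (intro sum.neutral) auto
  finally show ?case using insert by (simp add: norm_add_sq)
qed simp

lemma norm_add_orthogonal:
  fixes x y :: "'a::complex_hilbert"
  shows "cinner x y = 0 \<Longrightarrow> (norm (x + y))\<^sup>2 = (norm x)\<^sup>2 + (norm y)\<^sup>2"
  by (simp add: norm_add_sq)

text \<open>The point p minimises the distance from x to S. The parallelogram law at the midpoint of
  two points of S makes a minimising sequence Cauchy, and minimality against perturbations of p
  along y gives orthogonality.\<close>

lemma orthogonal_decomposition:
  fixes S :: "'a::complex_hilbert set"
  assumes S: "subspace S" "\<And>c y. y \<in> S \<Longrightarrow> c *\<^sub>C y \<in> S" "closed S"
  shows "\<exists>p\<in>S. \<forall>y\<in>S. cinner y (x - p) = 0"
proof -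
  define J where "J y = (norm (x - y))\<^sup>2" for y
  define m where "m = Inf (J ` S)"
  have bdd: "bdd_below (J ` S)" unfolding J_def by (intro bdd_belowI[of _ 0]) auto
  have m_le: "m \<le> J y" if "y \<in> S" for y
    unfolding m_def using that by (intro cInf_lower bdd) auto
  have ne: "J ` S \<noteq> {}" using subspace_0[OF S(1)] by blast
  have "\<exists>y\<in>S. J y < m + inverse (real (Suc n))" for n
    using cInf_lessD[OF ne, of "m + inverse (real (Suc n))"] unfolding m_def by auto
  then obtain Y where Y: "\<And>n. Y n \<in> S" "\<And>n. J (Y n) < m + inverse (real (Suc n))" by metis
  have par: "(norm (a - b))\<^sup>2 \<le> 2 * J a + 2 * J b - 4 * m" if ab: "a \<in> S" "b \<in> S" for a b
  proof -
    define h where "h = (1/2) *\<^sub>R (a + b)"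
    have "h \<in> S" unfolding h_def using S(1) ab by (intro subspace_scale subspace_add)
    hence "m \<le> J h" by (rule m_le)
    moreover have "(norm ((x - b) - (x - a)))\<^sup>2 + (norm ((x - b) + (x - a)))\<^sup>2 = 2 * J a + 2 * J b"
      using norm_add_sq[of "x - b" "x - a"] norm_add_sq[of "x - b" "- (x - a)"]
        cinner_diff_right[of "x - b" 0 "x - a"] by (simp add: J_def norm_minus_commute[of a x])
    moreover have "(x - b) + (x - a) = 2 *\<^sub>R (x - h)"
      unfolding h_def by (simp add: algebra_simps scaleR_2)
    hence "(norm ((x - b) + (x - a)))\<^sup>2 = 4 * J h"
      by (simp add: J_def power_mult_distrib)
    ultimately show ?thesis by (simp add: algebra_simps)
  qed
  have "Cauchy Y"
  proof (rule metric_CauchyI)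
    fix e :: real assume e: "e > 0"
    \<comment> \<open>In \<open>par\<close> each of the two excesses over m is counted twice, whence
      the 4.\<close>
    obtain N where N: "inverse (real (Suc N)) < e\<^sup>2 / 4" using e reals_Archimedean[of "e\<^sup>2 / 4"]
      by auto
    have "dist (Y k) (Y n) < e" if "k \<ge> N" "n \<ge> N" for k n
    proof -
      have "inverse (real (Suc k)) \<le> inverse (real (Suc N))"
        "inverse (real (Suc n)) \<le> inverse (real (Suc N))"
        using that by (auto intro!: le_imp_inverse_le)
      hence "(norm (Y k - Y n))\<^sup>2 < e\<^sup>2"
        using par[OF Y(1)[of k] Y(1)[of n]] Y(2)[of k] Y(2)[of n] N by linarith
      thus ?thesis using e by (simp add: dist_norm power_less_imp_less_base)
    qed
    thus "\<exists>N. \<forall>k\<ge>N. \<forall>n\<ge>N. dist (Y k) (Y n) < e" by blast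
  qed
  then obtain p where p: "Y \<longlonglongrightarrow> p" using Cauchy_convergent_iff convergent_def by blast
  have pS: "p \<in> S" using closed_sequentially[OF S(3)] Y(1) p by blast
  have "(\<lambda>n. J (Y n)) \<longlonglongrightarrow> J p" unfolding J_def by (intro tendsto_intros p)
  moreover have "(\<lambda>n. m + inverse (real (Suc n))) \<longlonglongrightarrow> m + 0"
    by (intro tendsto_intros LIMSEQ_inverse_real_of_nat)
  ultimately have "J p \<le> m + 0" by (rule LIMSEQ_le) (blast intro: less_imp_le[OF Y(2)])
  hence Jp: "J p \<le> J y" if "y \<in> S" for y using m_le[OF that] by simp
  have "cinner y (x - p) = 0" if y: "y \<in> S" for y
  proof (cases "y = 0")
    case False
    define n where "n = (norm y)\<^sup>2"
    have n: "n > 0" using False by (simp add: n_def)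
    define a where "a = cinner y (x - p)"
    \<comment> \<open>This coefficient makes \<open>(x - p) + c y\<close> orthogonal to y. It lowers
      the squared distance by \<open>(cmod a)^2 / n\<close>, so minimality of p forces a to
      vanish.\<close>
    define c where "c = - (a / complex_of_real n)"
    have "p - c *\<^sub>C y \<in> S" using S(1) S(2)[OF y] pS by (intro subspace_diff)
    hence "J p \<le> J (p - c *\<^sub>C y)" by (rule Jp)
    hence "(norm (x - p))\<^sup>2 \<le> (norm ((x - p) + c *\<^sub>C y))\<^sup>2"
      by (simp only: J_def diff_diff_eq2 diff_add_eq)
    also have "\<dots> = (norm (x - p))\<^sup>2 + 2 * Re (c * cnj a) + (cmod c * norm y)\<^sup>2"
      by (simp only: norm_add_sq cinner_scaleC_right norm_scaleC a_def cinner_commute[of "x - p" y])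
    also have "c * cnj a = - complex_of_real ((cmod a)\<^sup>2 / n)"
      unfolding c_def by (simp only: of_real_divide complex_norm_square) simp
    also have "(cmod c * norm y)\<^sup>2 = (cmod a)\<^sup>2 / n"
      using n unfolding c_def n_def
      by (simp add: norm_divide norm_mult power_mult_distrib power_divide norm_power
        power2_eq_square field_simps)
    finally have "(cmod a)\<^sup>2 / n \<le> 0" by simp
    hence "(cmod a)\<^sup>2 \<le> 0" using n by (simp add: field_simps)
    thus ?thesis by (simp add: a_def)
  qed simp
  thus ?thesis using pS by blast
qed

section \<open>Closed complex spans and orthonormal families\<close>

definition cspan :: "'a::complex_hilbert set \<Rightarrow> 'a set"
  where "cspan A = closure (span {c *\<^sub>C a | c a. a \<in> A})"

lemma subspace_cspan: "subspace (cspan A)"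
  unfolding cspan_def by (intro subspace_closure subspace_span)

lemma closed_cspan: "closed (cspan A)"
  unfolding cspan_def by simp

lemma cspan_superset: "a \<in> A \<Longrightarrow> a \<in> cspan A"
proof -
  assume "a \<in> A"
  hence "1 *\<^sub>C a \<in> {c *\<^sub>C a | c a. a \<in> A}" by blast
  hence "1 *\<^sub>C a \<in> span {c *\<^sub>C a | c a. a \<in> A}" by (rule span_base)
  hence "1 *\<^sub>C a \<in> cspan A" unfolding cspan_def by (rule subsetD[OF closure_subset])
  thus ?thesis by simp
qed

lemma cspan_minimal:
  assumes "subspace S" "closed S" "\<And>c a. a \<in> A \<Longrightarrow> c *\<^sub>C a \<in> S"
  shows "cspan A \<subseteq> S"
  unfolding cspan_def using assms by (intro closure_minimal span_minimal) auto

lemma subspace_vimage_blinfun: "subspace S \<Longrightarrow> subspace {x. blinfun_apply T x \<in> S}"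
  by (auto simp: subspace_def blinfun.add_right blinfun.scaleR_right)

lemma closed_vimage_blinfun: "closed S \<Longrightarrow> closed {x. blinfun_apply T x \<in> S}"
  using closed_vimage[of S "blinfun_apply T"] by (simp add: vimage_def blinfun.continuous_on)

text \<open>\<open>span\<close> is taken over the reals. Complex scalars enter only through the
  generating set, so their action on the closure has to be recovered from the generators by
  continuity.\<close>

lemma cspan_scaleC:
  assumes "x \<in> cspan A" shows "c *\<^sub>C x \<in> cspan A"
proof -
  let ?T = "Blinfun (\<lambda>x. c *\<^sub>C x)"
  have T: "blinfun_apply ?T x = c *\<^sub>C x" for x
    by (simp add: bounded_linear_Blinfun_apply bounded_linear_scaleC)
  have "cspan A \<subseteq> {x. blinfun_apply ?T x \<in> cspan A}"
  proof (intro cspan_minimal subspace_vimage_blinfun closed_vimage_blinfun subspace_cspan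
    closed_cspan)
    fix d a assume "a \<in> A"
    hence "(c * d) *\<^sub>C a \<in> span {c *\<^sub>C a | c a. a \<in> A}" by (intro span_base) blast
    hence "(c * d) *\<^sub>C a \<in> cspan A" unfolding cspan_def by (rule subsetD[OF closure_subset])
    thus "d *\<^sub>C a \<in> {x. blinfun_apply ?T x \<in> cspan A}"
      by (simp only: T scaleC_scaleC mem_Collect_eq)
  qed
  hence "x \<in> {x. blinfun_apply ?T x \<in> cspan A}" using assms by (rule subsetD)
  thus ?thesis by (simp only: T mem_Collect_eq)
qed

lemma cspan_mono_closed: "A \<subseteq> cspan B \<Longrightarrow> cspan A \<subseteq> cspan B"
  by (intro cspan_minimal subspace_cspan closed_cspan) (auto intro: cspan_scaleC)

text \<open>The component of a vector orthogonal to the closed span is in particular orthogonal to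
  A, so the hypothesis removes it.\<close>

lemma cspan_eq_UNIV:
  fixes A :: "'a::complex_hilbert set"
  assumes "\<And>x. (\<And>a. a \<in> A \<Longrightarrow> cinner a x = 0) \<Longrightarrow> x = 0"
  shows "cspan A = UNIV"
proof -
  have "x \<in> cspan A" for x
  proof -
    have "\<exists>p\<in>cspan A. \<forall>y\<in>cspan A. cinner y (x - p) = 0"
      by (intro orthogonal_decomposition subspace_cspan cspan_scaleC closed_cspan)
    then obtain p where p: "p \<in> cspan A" "\<forall>y\<in>cspan A. cinner y (x - p) = 0" ..
    have "x - p = 0"
    proof (rule assms)
      show "cinner a (x - p) = 0" if "a \<in> A" for a using p(2) cspan_superset[OF that]
        by (rule bspec)
    qed
    hence "x = p" by simp
    thus "x \<in> cspan A" using p(1) by (rule ssubst)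
  qed
  hence "UNIV \<subseteq> cspan A" by (intro subsetI)
  thus ?thesis by (rule top.extremum_uniqueI)
qed

text \<open>Transfinite Gram-Schmidt along a well-order; vectors that depend on their predecessors
  become zero, so that no bijection between index sets is needed.\<close>

lemma gram_schmidt:
  fixes m :: "'w \<Rightarrow> 'a::complex_hilbert"
  obtains e :: "'w \<Rightarrow> 'a" where "\<And>v w. v \<noteq> w \<Longrightarrow> cinner (e v) (e w) = 0" "\<And>w. e w = 0 \<or> norm (e w) = 1"
    "cspan (range e) = cspan (range m)"
proof -
  obtain r :: "'w rel" where r: "Well_order r \<and> Field r = UNIV"
    using well_ordering[where 'a = 'w] ..
  define lt where "lt = r - Id"
  have wf: "wf lt" and lin: "total r" "trans r" "antisym r"
    using r unfolding lt_def well_order_on_def linear_order_on_def partial_order_on_def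
      preorder_on_def by auto
  have tot: "(v, w) \<in> lt \<or> (w, v) \<in> lt" if "v \<noteq> w" for v w
    using lin(1) that unfolding lt_def total_on_def by auto
  have tr: "(u, w) \<in> lt" if "(u, v) \<in> lt" "(v, w) \<in> lt" for u v w
    using transD[OF lin(2)] antisymD[OF lin(3)] that unfolding lt_def by blast
  define B where "B w = cspan (m ` {v. (v, w) \<in> lt})" for w
  have "\<forall>w. \<exists>p\<in>B w. \<forall>y\<in>B w. cinner y (m w - p) = 0"
    unfolding B_def by (intro allI orthogonal_decomposition subspace_cspan cspan_scaleC
      closed_cspan)
  then obtain p where p: "\<And>w. p w \<in> B w" "\<And>w y. y \<in> B w \<Longrightarrow> cinner y (m w - p w) = 0"
    by metis
  define q where "q w = m w - p w" for w
  \<comment> \<open>Since \<open>inverse 0 = 0\<close>, the vector \<open>e w\<close> is 0 exactly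
    when \<open>m w\<close> already lies in the closed span of its predecessors.\<close>
  define e where "e w = inverse (norm (q w)) *\<^sub>R q w" for w
  have mB: "m v \<in> B w" if "(v, w) \<in> lt" for v w
    unfolding B_def using that by (intro cspan_superset) auto
  have BB: "B v \<subseteq> B w" if "(v, w) \<in> lt" for v w
    unfolding B_def using that tr by (intro cspan_mono_closed) (auto intro: cspan_superset)
  have eB: "e v \<in> B w" if "(v, w) \<in> lt" for v w
  proof -
    have "m v - p v \<in> B w"
      using mB[OF that] BB[OF that] p(1)[of v] subspace_diff[OF subspace_cspan] unfolding B_def
        by blast
    thus ?thesis unfolding e_def q_def B_def by (rule subspace_scale[OF subspace_cspan])
  qed
  have o1: "cinner (e v) (e w) = 0" if "(v, w) \<in> lt" for v w
  proof -
    have "cinner (e v) (q w) = 0" unfolding q_def by (rule p(2)[OF eB[OF that]])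
    thus ?thesis by (simp add: e_def[of w] cinner_scaleR_right)
  qed
  have 1: "cinner (e v) (e w) = 0" if "v \<noteq> w" for v w
    using tot[OF that] o1 cinner_zero_commute by blast
  have 2: "e w = 0 \<or> norm (e w) = 1" for w unfolding e_def by (cases "q w = 0") simp_all
  have qe: "q w = norm (q w) *\<^sub>R e w" for w unfolding e_def by (cases "q w = 0") simp_all
  have m: "m w \<in> cspan (range e)" for w
  proof (induction w rule: wf_induct[OF wf])
    case (1 w)
    have "B w \<subseteq> cspan (range e)" unfolding B_def using 1 by (intro cspan_mono_closed) auto
    hence "p w \<in> cspan (range e)" using p(1) by blast
    moreover have "q w \<in> cspan (range e)"
      by (subst qe) (intro subspace_scale[OF subspace_cspan] cspan_superset rangeI)
    ultimately have "p w + q w \<in> cspan (range e)" by (intro subspace_add[OF subspace_cspan])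
    thus ?case by (simp add: q_def)
  qed
  have "e w \<in> cspan (range m)" for w
  proof -
    have "B w \<subseteq> cspan (range m)" unfolding B_def
      by (intro cspan_mono_closed) (auto intro: cspan_superset)
    hence "m w - p w \<in> cspan (range m)"
      by (intro subspace_diff[OF subspace_cspan] cspan_superset rangeI subsetD[OF _ p(1)])
    thus ?thesis unfolding e_def q_def by (rule subspace_scale[OF subspace_cspan])
  qed
  hence "cspan (range e) = cspan (range m)"
    using m by (intro equalityI cspan_mono_closed) auto
  with 1 2 show ?thesis by (rule that)
qed

section \<open>Bounded operators and adjoints\<close>

lemma bopsD: "T \<in> bops \<Longrightarrow> blinfun_apply T (c *\<^sub>C x) = c *\<^sub>C blinfun_apply T x"
  by (simp add: bops_def)

lemma bopsI: "(\<And>c x. blinfun_apply T (c *\<^sub>C x) = c *\<^sub>C blinfun_apply T x) \<Longrightarrow> T \<in> bops"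
  by (simp add: bops_def)

lemma subspace_bops: "subspace (bops :: 'h::complex_hilbert op set)"
proof -
  have "c *\<^sub>C r *\<^sub>R x = r *\<^sub>R c *\<^sub>C x" for c r and x :: 'h
    by (simp add: scaleC_of_real[symmetric] scaleC_scaleC mult.commute)
  thus ?thesis
    by (auto simp: subspace_def bops_def blinfun.add_left blinfun.scaleR_left scaleC_add_right)
qed

lemma closed_bops: "closed (bops :: 'h::complex_hilbert op set)"
  unfolding bops_def
proof (intro closed_Collect_all closed_Collect_eq)
  fix c and x :: 'h
  have 1: "continuous_on UNIV (\<lambda>T :: 'h op. blinfun_apply T z)" for z
    by (intro linear_continuous_on blinfun.bounded_linear_left)
  show "continuous_on UNIV (\<lambda>T :: 'h op. blinfun_apply T (c *\<^sub>C x))" by (rule 1)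
  show "continuous_on UNIV (\<lambda>T :: 'h op. c *\<^sub>C blinfun_apply T x)"
    by (rule bounded_linear.continuous_on[OF bounded_linear_scaleC 1])
qed

lemma comp_bops: "S \<in> bops \<Longrightarrow> T \<in> bops \<Longrightarrow> S o\<^sub>L T \<in> bops"
  by (simp add: bops_def)

lemma id_bops: "id_blinfun \<in> bops"
  by (simp add: bops_def)

lemma cinner_adj_right: "T \<in> bops \<Longrightarrow> cinner x (blinfun_apply (adj T) y) =
  cinner (blinfun_apply T x) y"
  by (subst (1 2) cinner_commute) (simp only: cinner_adj)

lemma adj_bops:
  fixes T :: "'h::complex_hilbert op"
  assumes "T \<in> bops" shows "adj T \<in> bops"
  by (rule bopsI, rule cinner_ext) (simp add: cinner_adj[OF assms] cinner_scaleC_left)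

lemma adj_adj: "T \<in> bops \<Longrightarrow> adj (adj T) = T"
  by (intro adj_eqI) (simp add: cinner_adj_right)

lemma adj_comp: "S \<in> bops \<Longrightarrow> T \<in> bops \<Longrightarrow> adj (S o\<^sub>L T) = adj T o\<^sub>L adj S"
  by (intro adj_eqI) (simp add: cinner_adj)

lemma adj_add: "S \<in> bops \<Longrightarrow> T \<in> bops \<Longrightarrow> adj (S + T) = adj S + adj T"
  by (intro adj_eqI) (simp add: cinner_adj blinfun.add_left cinner_add_left cinner_add_right)

lemma adj_diff: "S \<in> bops \<Longrightarrow> T \<in> bops \<Longrightarrow> adj (S - T) = adj S - adj T"
  by (intro adj_eqI) (simp add: cinner_adj blinfun.diff_left cinner_diff_left cinner_diff_right)

lemma adj_id: "adj id_blinfun = id_blinfun"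
  by (intro adj_eqI) simp

lemma adj_zero: "adj 0 = 0"
  by (intro adj_eqI) simp

lemma scale_op_zero [simp]: "0 \<cdot>\<^sub>C T = 0"
  by (rule blinfun_eqI) simp

lemma scale_op_one [simp]: "1 \<cdot>\<^sub>C T = T"
  by (rule blinfun_eqI) simp

lemma scale_op_scale_op: "c \<cdot>\<^sub>C d \<cdot>\<^sub>C T = (c * d) \<cdot>\<^sub>C T"
  by (rule blinfun_eqI) (simp add: scaleC_scaleC)

lemma scale_op_zero_right [simp]: "c \<cdot>\<^sub>C 0 = 0"
  by (rule blinfun_eqI) simp

lemma scale_op_of_real: "complex_of_real r \<cdot>\<^sub>C T = r *\<^sub>R T"
  by (rule blinfun_eqI) (simp add: scaleC_of_real blinfun.scaleR_left)

lemma scale_op_minus_one: "(- 1) \<cdot>\<^sub>C T = - T"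
  using scale_op_of_real[of "-1" T] by simp

lemma scale_op_add_right: "c \<cdot>\<^sub>C (S + T) = c \<cdot>\<^sub>C S + c \<cdot>\<^sub>C T"
  by (rule blinfun_eqI) (simp add: blinfun.add_left scaleC_add_right)

lemma scale_op_add_left: "(c + d) \<cdot>\<^sub>C T = c \<cdot>\<^sub>C T + d \<cdot>\<^sub>C T"
  by (rule blinfun_eqI) (simp add: blinfun.add_left scaleC_add_left)

lemma scale_op_comp_right: "S \<in> bops \<Longrightarrow> S o\<^sub>L (c \<cdot>\<^sub>C T) = c \<cdot>\<^sub>C (S o\<^sub>L T)"
  by (rule blinfun_eqI) (simp add: bopsD)

lemma norm_scale_op: "norm (c \<cdot>\<^sub>C T) \<le> cmod c * norm T"
proof (rule norm_blinfun_bound)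
  show "norm (blinfun_apply (c \<cdot>\<^sub>C T) x) \<le> cmod c * norm T * norm x" for x
    using mult_left_mono[OF norm_blinfun[of T x], of "cmod c"] by (simp add: norm_scaleC mult.assoc)
qed simp

lemma bounded_linear_scale_op: "bounded_linear (\<lambda>T :: 'h::complex_hilbert op. c \<cdot>\<^sub>C T)"
proof (rule bounded_linear_intro[of _ "cmod c"])
  show "c \<cdot>\<^sub>C r *\<^sub>R T = r *\<^sub>R c \<cdot>\<^sub>C T" for r and T :: "'h op"
    by (simp add: scale_op_of_real[symmetric] scale_op_scale_op mult.commute)
qed (simp_all add: scale_op_add_right norm_scale_op mult.commute)

lemma norm_adj_le:
  assumes T: "T \<in> bops"
  shows "norm (adj T) \<le> norm T"
proof (rule norm_blinfun_bound)
  fix x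
  let ?y = "blinfun_apply (adj T) x"
  show "norm ?y \<le> norm T * norm x"
  proof (cases "?y = 0")
    case False
    have "norm ?y * norm ?y = cmod (cinner ?y ?y)"
      by (simp add: cinner_self power2_eq_square norm_mult)
    also have "\<dots> = cmod (cinner x (blinfun_apply T ?y))" by (simp add: cinner_adj[OF T])
    also have "\<dots> \<le> norm x * (norm T * norm ?y)"
      by (rule order_trans[OF cauchy_schwarz]) (simp add: mult_left_mono norm_blinfun)
    finally have "norm ?y * norm ?y \<le> (norm T * norm x) * norm ?y"
      by (simp add: mult.commute mult.assoc)
    thus ?thesis using False by simp
  qed simp
qed simp

lemma tendsto_adj:
  fixes X :: "nat \<Rightarrow> 'h::complex_hilbert op"
  assumes "\<And>n. X n \<in> bops" "X \<longlonglongrightarrow> T"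
  shows "(\<lambda>n. adj (X n)) \<longlonglongrightarrow> adj T"
proof -
  have T: "T \<in> bops" using closed_sequentially[OF closed_bops] assms by blast
  have le: "norm (adj (X n) - adj T) \<le> norm (X n - T)" for n
    using norm_adj_le[OF subspace_diff[OF subspace_bops assms(1)[of n] T]]
      by (simp add: adj_diff assms(1) T)
  have "(\<lambda>n. norm (X n - T)) \<longlonglongrightarrow> 0" using assms(2) by (simp add: LIM_zero tendsto_norm_zero)
  hence "(\<lambda>n. adj (X n) - adj T) \<longlonglongrightarrow> 0"
    by (rule Lim_null_comparison[rotated]) (simp add: le)
  thus ?thesis by (simp add: LIM_zero_cancel)
qed

lemma norm_square_adj:
  assumes T: "T \<in> bops"
  shows "(norm (blinfun_apply T x))\<^sup>2 = Re (cinner x (blinfun_apply (adj T o\<^sub>L T) x))"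
  by (simp add: cinner_adj_right[OF T] cinner_self)

lemma unitary_isometry:
  assumes "unitary_op U" shows "isometry_op U"
proof -
  have U: "U \<in> bops" "adj U o\<^sub>L U = id_blinfun" using assms by (auto simp: unitary_op_def)
  have "norm (blinfun_apply U x) = norm x" for x
  proof -
    have "(norm (blinfun_apply U x))\<^sup>2 = (norm x)\<^sup>2"
      unfolding norm_square_adj[OF U(1)] U(2) by (simp add: cinner_self)
    thus ?thesis by simp
  qed
  thus ?thesis using U by (simp add: isometry_op_def)
qed

text \<open>\<open>adj\<close> concerns operators on one space; the embeddings constructed below
  relate two different Hilbert spaces and need their adjoints as well.\<close>

lemma adjoint_exists:
  fixes T :: "'a::complex_hilbert \<Rightarrow>\<^sub>L 'b::complex_hilbert"
  assumes T: "\<And>c x. blinfun_apply T (c *\<^sub>C x) = c *\<^sub>C blinfun_apply T x"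
  obtains U :: "'b \<Rightarrow>\<^sub>L 'a" where "\<And>x y. cinner (blinfun_apply U x) y = cinner x (blinfun_apply T y)"
    "\<And>c x. blinfun_apply U (c *\<^sub>C x) = c *\<^sub>C blinfun_apply U x"
proof -
  have le: "cmod (cinner x (blinfun_apply T a)) \<le> norm x * norm T * norm a" for x a
    using order_trans[OF cauchy_schwarz mult_left_mono[OF norm_blinfun[of T a] norm_ge_zero[of x]]]
    by (simp only: mult.assoc)
  have "\<exists>z. \<forall>y. cinner x (blinfun_apply T y) = cinner z y" for x
    by (rule riesz[of "\<lambda>y. cinner x (blinfun_apply T y)" "norm x * norm T"])
      (auto simp: blinfun.add_right cinner_add_right T cinner_scaleC_right le)
  then obtain S where S: "\<And>x y. cinner x (blinfun_apply T y) = cinner (S x) y" by metis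
  have C: "S (c *\<^sub>C a) = c *\<^sub>C S a" for c a
    by (rule cinner_ext) (simp add: S[symmetric] cinner_scaleC_left)
  have "bounded_linear S"
  proof (rule bounded_linear_intro)
    show "S (a + b) = S a + S b" for a b
      by (rule cinner_ext) (simp add: S[symmetric] cinner_add_left)
    show "S (r *\<^sub>R a) = r *\<^sub>R S a" for r a
      using C[of "complex_of_real r" a] by (simp add: scaleC_of_real)
    show "norm (S a) \<le> norm a * norm T" for a
    proof (cases "S a = 0")
      case False
      have "norm (S a) * norm (S a) = cmod (cinner (S a) (S a))"
        by (simp add: cinner_self power2_eq_square norm_mult)
      also have "\<dots> \<le> norm a * norm T * norm (S a)" using le[of a "S a"] by (simp add: S)
      finally show ?thesis using False by simp
    qed simp
  qed
  thus ?thesis using C S by (intro that[of "Blinfun S"]) (simp_all add: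
    bounded_linear_Blinfun_apply)
qed

section \<open>Operators on spaces of square summable families\<close>

lift_definition single :: "'i \<Rightarrow> 'h \<Rightarrow> ('i, 'h::complex_hilbert) ell2"
  is "\<lambda>i x j. if j = i then x else 0"
proof -
  fix i :: 'i and x :: 'h
  have "(\<lambda>j. (norm (if j = i then x else 0))\<^sup>2) summable_on {i}" by simp
  thus "(\<lambda>j. (norm (if j = i then x else 0))\<^sup>2) summable_on UNIV"
    by (subst summable_on_cong_neutral[where T = "{i}"]) auto
qed

lemma Rep_single [simp]: "Rep_ell2 (single i x) j = (if j = i then x else 0)"
  by (simp add: single.rep_eq)

lemma single_add: "single i (x + y) = single i x + single i y"
  by transfer auto

lemma single_scaleC: "single i (c *\<^sub>C x) = c *\<^sub>C single i x"
  by transfer auto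

lemma single_scaleR: "single i (c *\<^sub>R x) = c *\<^sub>R single i x"
  by (simp add: scaleC_of_real[symmetric] single_scaleC)

lemma single_zero [simp]: "single i 0 = 0"
  by transfer auto

lemma cinner_single: "cinner (single i x) f = cinner x (Rep_ell2 f i)"
proof -
  have "cinner (single i x) f = (\<Sum>\<^sub>\<infinity>j\<in>{i}. cinner (Rep_ell2 (single i x) j) (Rep_ell2 f j))"
    unfolding cinner_ell2.rep_eq by (rule infsum_cong_neutral) auto
  thus ?thesis by simp
qed

lemma cinner_single_right: "cinner f (single i x) = cinner (Rep_ell2 f i) x"
  by (metis cinner_commute cinner_single)

lemma norm_eqI_cinner: "cinner x x = cinner y y \<Longrightarrow> norm x = norm y"
  by (metis cinner_self norm_ge_zero of_real_eq_iff power2_eq_iff_nonneg)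

lemma norm_single [simp]: "norm (single i x) = norm x"
  by (rule norm_eqI_cinner) (simp add: cinner_single)

lemma ell2_eqI: "(\<And>i. Rep_ell2 f i = Rep_ell2 g i) \<Longrightarrow> f = g"
  by (metis Rep_ell2_inject ext)

lemma cspan_single: "cspan {single i x | i x. True} = (UNIV :: ('i, 'h::complex_hilbert) ell2 set)"
proof (rule cspan_eq_UNIV)
  fix f :: "('i, 'h) ell2"
  assume "\<And>a. a \<in> {single i x | i x. True} \<Longrightarrow> cinner a f = 0"
  hence "cinner (single i (Rep_ell2 f i)) f = 0" for i by blast
  hence "Rep_ell2 f i = 0" for i by (simp add: cinner_single cinner_self)
  thus "f = 0" by (intro ell2_eqI) (simp add: zero_ell2.rep_eq)
qed

lemma ell2_blinfun_eqI:
  fixes A B :: "('i, 'h::complex_hilbert) ell2 \<Rightarrow>\<^sub>L 'b::real_normed_vector"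
  assumes "\<And>i x. blinfun_apply A (single i x) = blinfun_apply B (single i x)"
  shows "A = B"
proof (rule blinfun_eqI)
  fix f
  have "cspan {single i x | i x. True} \<subseteq> {f. blinfun_apply (A - B) f \<in> {0}}"
    by (intro cspan_minimal subspace_vimage_blinfun closed_vimage_blinfun)
      (auto simp: blinfun.diff_left assms single_scaleC[symmetric])
  hence "blinfun_apply (A - B) f \<in> {0}" unfolding cspan_single by blast
  thus "blinfun_apply A f = blinfun_apply B f" by (simp add: blinfun.diff_left)
qed

lemma ell2_blinfun_scaleC:
  fixes T :: "('i, 'h::complex_hilbert) ell2 \<Rightarrow>\<^sub>L 'k::complex_hilbert"
  assumes "\<And>i x c. blinfun_apply T (single i (c *\<^sub>C x)) = c *\<^sub>C blinfun_apply T (single i x)"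
  shows "blinfun_apply T (c *\<^sub>C f) = c *\<^sub>C blinfun_apply T f"
proof -
  have "T o\<^sub>L (c \<cdot>\<^sub>C id_blinfun) = (c \<cdot>\<^sub>C id_blinfun) o\<^sub>L T"
    by (rule ell2_blinfun_eqI) (simp add: assms single_scaleC[symmetric])
  from arg_cong[OF this, of "\<lambda>R. blinfun_apply R f"] show ?thesis by simp
qed

text \<open>Orthogonality of the images of different indices makes the norm of a finite sum
  Pythagorean on both sides, so a bound on the single maps \<open>B i\<close> bounds the whole
  operator. The shifts, embeddings and amplifications used below are all obtained in this
  way.\<close>

lemma ell2_blinfun_exists:
  fixes B :: "'i \<Rightarrow> 'h::complex_hilbert \<Rightarrow> 'k::complex_hilbert"
  assumes add: "\<And>i x y. B i (x + y) = B i x + B i y" and sc: "\<And>i c x. B i (c *\<^sub>C x) = c *\<^sub>C B i x"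
    and orth: "\<And>i j x y. i \<noteq> j \<Longrightarrow> cinner (B i x) (B j y) = 0"
    and M: "\<And>i x. norm (B i x) \<le> M * norm x"
  obtains T :: "('i, 'h) ell2 \<Rightarrow>\<^sub>L 'k" where "\<And>i x. blinfun_apply T (single i x) = B i x"
    "\<And>c f. blinfun_apply T (c *\<^sub>C f) = c *\<^sub>C blinfun_apply T f"
proof -
  have zero: "B i 0 = 0" for i using sc[of i 0 0] by simp
  have scR: "B i (c *\<^sub>R x) = c *\<^sub>R B i x" for i c x using sc[of i "complex_of_real c" x]
    by (simp add: scaleC_of_real)
  define \<Gamma> where "\<Gamma> = {(\<Sum>i\<in>F. single i (x i), \<Sum>i\<in>F. B i (x i)) | F x. finite F}"
  \<comment> \<open>Padding with zeros brings two finite families to a common index set, which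
    addition in the graph requires.\<close>
  have ext: "\<exists>x'. (\<Sum>i\<in>F. single i (x i)) = (\<Sum>i\<in>F'. single i (x' i)) \<and> (\<Sum>i\<in>F. B i (x i)) =
    (\<Sum>i\<in>F'. B i (x' i))"
    if "finite F'" "F \<subseteq> F'" for F F' x
    by (rule exI[of _ "\<lambda>i. if i \<in> F then x i else 0"])
      (intro conjI sum.mono_neutral_cong_left, auto simp: that zero)
  have \<Gamma>I: "(\<Sum>i\<in>F. single i (x i), \<Sum>i\<in>F. B i (x i)) \<in> \<Gamma>" if "finite F" for F x
    unfolding \<Gamma>_def mem_Collect_eq using that by (intro exI conjI) (rule refl)
  have sub: "subspace \<Gamma>"
  proof (unfold subspace_def, intro conjI ballI allI)
    show "0 \<in> \<Gamma>" using \<Gamma>I[of "{}"] by (simp add: zero_prod_def)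
    fix a assume "a \<in> \<Gamma>"
    then obtain F x where a: "finite F" "a = (\<Sum>i\<in>F. single i (x i), \<Sum>i\<in>F. B i (x i))"
      unfolding \<Gamma>_def by blast
    have "c *\<^sub>R a = (\<Sum>i\<in>F. single i (c *\<^sub>R x i), \<Sum>i\<in>F. B i (c *\<^sub>R x i))" for c
      by (simp add: a(2) scaleR_sum_right single_scaleR scR)
    thus "c *\<^sub>R a \<in> \<Gamma>" for c by (simp only: \<Gamma>I[OF a(1)])
    fix b assume "b \<in> \<Gamma>"
    then obtain F' y where b: "finite F'" "b = (\<Sum>i\<in>F'. single i (y i), \<Sum>i\<in>F'. B i (y i))"
      unfolding \<Gamma>_def by blast
    obtain x' where x': "a = (\<Sum>i\<in>F\<union>F'. single i (x' i), \<Sum>i\<in>F\<union>F'. B i (x' i))"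
      using ext[of "F \<union> F'" F x] a b(1) by auto
    obtain y' where y': "b = (\<Sum>i\<in>F\<union>F'. single i (y' i), \<Sum>i\<in>F\<union>F'. B i (y' i))"
      using ext[of "F \<union> F'" F' y] b a(1) by auto
    have "a + b = (\<Sum>i\<in>F\<union>F'. single i (x' i + y' i), \<Sum>i\<in>F\<union>F'. B i (x' i + y' i))"
      by (simp add: x' y' sum.distrib single_add add)
    thus "a + b \<in> \<Gamma>" by (simp only: \<Gamma>I finite_UnI a(1) b(1))
  qed
  have bound: "norm b \<le> \<bar>M\<bar> * norm a" if "(a, b) \<in> \<Gamma>" for a b
  proof -
    obtain F x where ab: "finite F" "a = (\<Sum>i\<in>F. single i (x i))" "b = (\<Sum>i\<in>F. B i (x i))"
      using \<open>(a, b) \<in> \<Gamma>\<close> unfolding \<Gamma>_def by blast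
    have "(norm b)\<^sup>2 = (\<Sum>i\<in>F. (norm (B i (x i)))\<^sup>2)"
      unfolding ab(3) using ab(1) orth by (rule norm_sum_orthogonal)
    also have "\<dots> \<le> (\<Sum>i\<in>F. (\<bar>M\<bar> * norm (x i))\<^sup>2)"
      by (intro sum_mono power_mono norm_ge_zero order_trans[OF M] mult_right_mono) auto
    also have "\<dots> = \<bar>M\<bar>\<^sup>2 * (\<Sum>i\<in>F. (norm (single i (x i)))\<^sup>2)"
      by (simp add: power_mult_distrib sum_distrib_left)
    also have "(\<Sum>i\<in>F. (norm (single i (x i)))\<^sup>2) = (norm a)\<^sup>2"
      unfolding ab(2) using ab(1) by (intro norm_sum_orthogonal[symmetric]) (auto simp:
        cinner_single)
    finally have "(norm b)\<^sup>2 \<le> (\<bar>M\<bar> * norm a)\<^sup>2" by (simp only: power_mult_distrib)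
    thus ?thesis by (rule power2_le_imp_le) simp
  qed
  have sg: "(single i x, B i x) \<in> \<Gamma>" for i x
    using \<Gamma>I[of "{i}" "\<lambda>_. x"] by simp
  have "subspace (fst ` \<Gamma>)" by (intro linear_subspace_image sub bounded_linear.linear[OF
    bounded_linear_fst])
  hence "cspan {single i x | i x. True} \<subseteq> closure (fst ` \<Gamma>)"
  proof (intro cspan_minimal subspace_closure closed_closure subsetD[OF closure_subset])
    fix c and a :: "('i, 'h) ell2" assume "a \<in> {single i x | i x. True}"
    then obtain i x where "a = single i x" by blast
    hence "c *\<^sub>C a = fst (single i (c *\<^sub>C x), B i (c *\<^sub>C x))" by (simp add: single_scaleC)
    thus "c *\<^sub>C a \<in> fst ` \<Gamma>" using sg by (rule image_eqI)
  qed
  hence dense: "closure (fst ` \<Gamma>) = UNIV" unfolding cspan_single by (rule top.extremum_uniqueI)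
  obtain T :: "('i, 'h) ell2 \<Rightarrow>\<^sub>L 'k" where T: "\<forall>a b. (a, b) \<in> \<Gamma> \<longrightarrow> blinfun_apply T a = b"
    using blinfun_of_graph[OF sub bound dense] ..
  have "blinfun_apply T (single i x) = B i x" for i x using T sg by blast
  thus ?thesis by (intro that[of T] ell2_blinfun_scaleC) (simp_all add: sc)
qed

text \<open>V sends the basis vector at w to \<open>e w\<close> and U is its adjoint. The family m
  serves as its own index set, so no dimension is compared. As some \<open>e w\<close> may be 0, V
  is only a partial isometry; its inverse on the closed span of m is U.\<close>

lemma cyclic_embedding:
  fixes m :: "'w \<Rightarrow> 'k::complex_hilbert"
  obtains V :: "('w, complex) ell2 \<Rightarrow>\<^sub>L 'k" and U :: "'k \<Rightarrow>\<^sub>L ('w, complex) ell2"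
  where "\<And>c f. blinfun_apply V (c *\<^sub>C f) = c *\<^sub>C blinfun_apply V f"
    "\<And>c x. blinfun_apply U (c *\<^sub>C x) = c *\<^sub>C blinfun_apply U x"
    "\<And>x f. cinner (blinfun_apply U x) f = cinner x (blinfun_apply V f)"
    "\<And>f. blinfun_apply V f \<in> cspan (range m)"
    "\<And>x. x \<in> cspan (range m) \<Longrightarrow> blinfun_apply V (blinfun_apply U x) = x"
proof -
  obtain e :: "'w \<Rightarrow> 'k" where e: "\<And>v w. v \<noteq> w \<Longrightarrow> cinner (e v) (e w) = 0"
    "\<And>w. e w = 0 \<or> norm (e w) = 1" "cspan (range e) = cspan (range m)"
    by (rule gram_schmidt[of m]) blast
  obtain V :: "('w, complex) ell2 \<Rightarrow>\<^sub>L 'k" where V: "\<And>i x. blinfun_apply V (single i x) = x *\<^sub>C e i"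
    "\<And>c f. blinfun_apply V (c *\<^sub>C f) = c *\<^sub>C blinfun_apply V f"
  proof (rule ell2_blinfun_exists[of "\<lambda>i x. x *\<^sub>C e i" 1])
    show "norm (x *\<^sub>C e i) \<le> 1 * norm x" for i and x :: complex
      using e(2)[of i] by (auto simp: norm_scaleC)
  qed (auto simp: scaleC_add_left scaleC_scaleC scaleC_complex_def cinner_scaleC_left
    cinner_scaleC_right e(1))
  obtain U :: "'k \<Rightarrow>\<^sub>L ('w, complex) ell2" where
    U: "\<And>x y. cinner (blinfun_apply U x) y = cinner x (blinfun_apply V y)"
      "\<And>c x. blinfun_apply U (c *\<^sub>C x) = c *\<^sub>C blinfun_apply U x"
    by (rule adjoint_exists[of V, OF V(2)]) blast
  have "cspan {single i x | i x. True} \<subseteq> {f. blinfun_apply V f \<in> cspan (range m)}"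
    by (intro cspan_minimal subspace_vimage_blinfun closed_vimage_blinfun subspace_cspan
      closed_cspan)
      (use V e(3) cspan_scaleC[OF cspan_scaleC[OF cspan_superset[OF rangeI[of e]]]] in auto)
  hence 1: "blinfun_apply V f \<in> cspan (range m)" for f unfolding cspan_single by blast
  have Ue: "blinfun_apply U (e w) = single w (if e w = 0 then 0 else 1)" for w
  proof (rule cinner_ext, unfold U)
    fix f
    have "cinner (e w) (blinfun_apply V f) = cinner (if e w = 0 then 0 else 1) (Rep_ell2 f w)"
    proof -
      let ?L = "Blinfun (cinner (e w)) o\<^sub>L V"
      let ?R = "Blinfun (cinner (single w (if e w = 0 then 0 else 1)))"
      have "?L = ?R"
      proof (rule ell2_blinfun_eqI)
        fix i x
        show "blinfun_apply ?L (single i x) = blinfun_apply ?R (single i x)"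
          using e(1)[of w i] e(2)[of w]
          by (cases "i = w") (auto simp: bounded_linear_Blinfun_apply bounded_linear_cinner V
            cinner_single
              cinner_scaleC_right cinner_self cinner_complex_def)
      qed
      from arg_cong[OF this, of "\<lambda>T. blinfun_apply T f"] show ?thesis
        by (simp add: bounded_linear_Blinfun_apply bounded_linear_cinner cinner_single)
    qed
    thus "cinner (e w) (blinfun_apply V f) = cinner (single w (if e w = 0 then 0 else 1)) f"
      by (simp add: cinner_single)
  qed
  have "cspan (range e) \<subseteq> {x. blinfun_apply ((V o\<^sub>L U) - id_blinfun) x \<in> {0}}"
    by (intro cspan_minimal subspace_vimage_blinfun closed_vimage_blinfun)
      (auto simp: blinfun.diff_left U V Ue)
  hence "blinfun_apply V (blinfun_apply U x) = x" if "x \<in> cspan (range m)" for x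
    using that unfolding e(3) by (auto simp: blinfun.diff_left)
  with V(2) U(2) U(1) 1 show ?thesis by (rule that)
qed

lemma Rep_ell2_zero [simp]: "Rep_ell2 0 i = 0"
  by (simp add: zero_ell2.rep_eq)

lemma ell2_ext_cinner:
  fixes f g :: "('i, 'h::complex_hilbert) ell2"
  assumes "\<And>i x. cinner f (single i x) = cinner g (single i x)"
  shows "f = g"
proof (rule ell2_eqI, rule cinner_ext)
  show "cinner (Rep_ell2 f i) x = cinner (Rep_ell2 g i) x" for i x
    using assms[of i x] by (simp add: cinner_single_right)
qed

text \<open>A partial isometry permuting basis vectors, provided that s is injective on A; with s
  the identity it is the projection onto the coordinates in A. The values on the vectors
  \<open>single i x\<close> determine the operator, so the choice is immaterial.\<close>

definition partial_shift :: "'i set \<Rightarrow> ('i \<Rightarrow> 'i) \<Rightarrow> ('i, 'h::complex_hilbert) ell2 op"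
  where "partial_shift A s = (SOME R. R \<in> bops \<and>
    (\<forall>i x. blinfun_apply R (single i x) = (if i \<in> A then single (s i) x else 0)))"

lemma
  assumes s: "inj_on s A"
  shows partial_shift_bops: "(partial_shift A s :: ('i, 'h::complex_hilbert) ell2 op) \<in> bops"
    and partial_shift_single: "blinfun_apply (partial_shift A s) (single i (x :: 'h)) =
      (if i \<in> A then single (s i) x else 0)"
proof -
  obtain R :: "('i, 'h) ell2 op" where "\<And>i x. blinfun_apply R (single i x) =
    (if i \<in> A then single (s i) x else 0)"
    "\<And>c f. blinfun_apply R (c *\<^sub>C f) = c *\<^sub>C blinfun_apply R f"
    by (rule ell2_blinfun_exists[of "\<lambda>i x. if i \<in> A then single (s i) x else 0" 1])
      (use s in \<open>auto simp: single_add single_scaleC cinner_single inj_on_def\<close>)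
  hence "\<exists>R :: ('i, 'h) ell2 op. R \<in> bops \<and>
    (\<forall>i x. blinfun_apply R (single i x) = (if i \<in> A then single (s i) x else 0))"
    by (intro exI[of _ R] conjI bopsI) auto
  from someI_ex[OF this]
  show "(partial_shift A s :: ('i, 'h) ell2 op) \<in> bops"
    and "blinfun_apply (partial_shift A s) (single i (x :: 'h)) =
      (if i \<in> A then single (s i) x else 0)"
    unfolding partial_shift_def by blast+
qed

lemma adj_partial_shift:
  assumes s: "inj_on s A"
  shows "blinfun_apply (adj (partial_shift A s)) (single j x) =
    (if j \<in> s ` A then single (the_inv_into A s j) x else 0)"
proof (rule ell2_ext_cinner)
  fix i y
  show "cinner (blinfun_apply (adj (partial_shift A s)) (single j x)) (single i y) =
    cinner (if j \<in> s ` A then single (the_inv_into A s j) x else 0) (single i y)"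
    unfolding cinner_adj[OF partial_shift_bops[OF s]] partial_shift_single[OF s]
  proof (cases "j \<in> s ` A")
    case True
    then obtain k where k: "k \<in> A" "j = s k" by blast
    thus "cinner (single j x) (if i \<in> A then single (s i) y else 0) =
      cinner (if j \<in> s ` A then single (the_inv_into A s j) x else 0) (single i y)"
      using inj_on_eq_iff[OF s k(1), of i] by (auto simp: cinner_single the_inv_into_f_f[OF s])
  qed (auto simp: cinner_single)
qed

lemma adj_partial_shift_comp:
  assumes s: "inj_on s A"
  shows "adj (partial_shift A s) o\<^sub>L partial_shift A s = partial_shift A (\<lambda>i. i)"
  by (rule ell2_blinfun_eqI)
    (auto simp: partial_shift_single s adj_partial_shift the_inv_into_f_f)

lemma partial_shift_id: "partial_shift UNIV (\<lambda>i. i) = id_blinfun"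
  by (rule ell2_blinfun_eqI) (simp add: partial_shift_single)

lemma partial_shift_comp:
  assumes "inj_on s A" "inj_on t B"
  shows "partial_shift A s o\<^sub>L partial_shift B t = partial_shift {i \<in> B. t i \<in> A} (\<lambda>i. s (t i))"
proof (rule ell2_blinfun_eqI)
  have "inj_on (\<lambda>i. s (t i)) {i \<in> B. t i \<in> A}" using assms by (auto simp: inj_on_def)
  thus "blinfun_apply (partial_shift A s o\<^sub>L partial_shift B t) (single i x) =
    blinfun_apply (partial_shift {i \<in> B. t i \<in> A} (\<lambda>i. s (t i))) (single i x)" for i x
    using assms by (simp add: partial_shift_single)
qed

lemma partial_shift_cong:
  "(\<And>i. i \<in> A \<Longrightarrow> s i = t i) \<Longrightarrow> inj_on s A \<Longrightarrow> partial_shift A s = partial_shift A t"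
  by (rule ell2_blinfun_eqI) (simp add: partial_shift_single cong: inj_on_cong)

subsection \<open>Direct sums\<close>

lemma cinner_slice: "cinner f g = (\<Sum>\<^sub>\<infinity>r. cinner (slice f r) (slice g r))"
proof -
  have "(\<lambda>x. cinner (Rep_ell2 f x) (Rep_ell2 g x)) summable_on (Sigma UNIV (\<lambda>_. UNIV))"
    using cinner_summable[of "Rep_ell2 f" UNIV "Rep_ell2 g"] Rep_ell2[of f] Rep_ell2[of g] by simp
  from infsum_Sigma_banach[OF this] show ?thesis
    by (simp add: cinner_ell2.rep_eq slice.rep_eq)
qed

lemma adj_dsum:
  assumes M: "\<And>r. norm (T r) \<le> M" and T: "\<And>r. T r \<in> bops"
  shows "adj (dsum T) = dsum (\<lambda>r. adj (T r))"
proof (rule adj_eqI)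
  have M': "norm (adj (T r)) \<le> M" for r using norm_adj_le[OF T] M order_trans by blast
  show "cinner (blinfun_apply (dsum (\<lambda>r. adj (T r))) x) y = cinner x (blinfun_apply (dsum T) y)"
    for x y
    by (simp add: cinner_slice slice_dsum[OF M] slice_dsum[OF M'] cinner_adj[OF T])
qed

lemma slice_single: "slice (single (r, i) x) r' = (if r = r' then single i x else 0)"
  by (rule ell2_eqI) (simp add: slice.rep_eq zero_ell2.rep_eq)

subsection \<open>Tensor products\<close>

lemma tensor_vec_single: "tensor_vec x (single i c) = single i (c *\<^sub>C x)"
  by (rule ell2_eqI) (simp add: tensor_vec.rep_eq)

lemma single_tensor_vec: "single i x = tensor_vec x (single i 1)"
  by (simp add: tensor_vec_single)

lemma cinner_tensor_vec: "cinner (tensor_vec x f) (tensor_vec y g) = cinner x y * cinner f g"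
proof -
  have "cinner (tensor_vec x f) (tensor_vec y g)
    = (\<Sum>\<^sub>\<infinity>i. cinner x y * cinner (Rep_ell2 f i) (Rep_ell2 g i))"
    by (simp add: cinner_ell2.rep_eq tensor_vec.rep_eq cinner_scaleC_left cinner_scaleC_right
        cinner_complex_def mult_ac)
  thus ?thesis by (simp add: cinner_ell2.rep_eq infsum_cmult_right')
qed

lemma norm_tensor_vec: "norm (tensor_vec x f) = norm x * norm f"
proof -
  have "complex_of_real ((norm (tensor_vec x f))\<^sup>2) = complex_of_real ((norm x * norm f)\<^sup>2)"
    unfolding cinner_self[symmetric] cinner_tensor_vec by (simp add: cinner_self power_mult_distrib)
  thus ?thesis by (metis mult_nonneg_nonneg norm_ge_zero of_real_eq_iff power2_eq_iff_nonneg)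
qed

lemma tensor_vec_add_left: "tensor_vec (x + y) f = tensor_vec x f + tensor_vec y f"
  by (rule ell2_eqI) (simp add: tensor_vec.rep_eq plus_ell2.rep_eq scaleC_add_right)

lemma tensor_vec_scale_left: "tensor_vec (c *\<^sub>C x) f = c *\<^sub>C tensor_vec x f"
  by (rule ell2_eqI) (simp add: tensor_vec.rep_eq scaleC_ell2.rep_eq scaleC_scaleC mult.commute)

lemma tensor_vec_add_right: "tensor_vec x (f + g) = tensor_vec x f + tensor_vec x g"
  by (rule ell2_eqI) (simp add: tensor_vec.rep_eq plus_ell2.rep_eq scaleC_add_left)

lemma tensor_vec_scale_right: "tensor_vec x (c *\<^sub>C f) = c *\<^sub>C tensor_vec x f"
  by (rule ell2_eqI) (simp add: tensor_vec.rep_eq scaleC_ell2.rep_eq scaleC_scaleC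
    scaleC_complex_def)

lemma tensor_vec_zero [simp]: "tensor_vec x 0 = 0" "tensor_vec 0 f = 0"
  using tensor_vec_scale_right[of x 0 0] tensor_vec_scale_left[of 0 0 f] by simp_all

lemma bounded_linear_tensor_vec: "bounded_linear (tensor_vec x)"
proof (rule bounded_linear_intro[of _ "norm x"])
  show "tensor_vec x (r *\<^sub>R f) = r *\<^sub>R tensor_vec x f" for r f
    using tensor_vec_scale_right[of x "complex_of_real r" f] by (simp add: scaleC_of_real)
qed (simp_all add: tensor_vec_add_right norm_tensor_vec mult.commute)

text \<open>The vectors \<open>single i x\<close> are elementary tensors and determine a bounded
  operator. This justifies the definite description behind the tensor product of operators.\<close>

lemma tensor_op_eqI:
  assumes "R \<in> bops" "\<And>x f. blinfun_apply R (tensor_vec x f) =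
    tensor_vec (blinfun_apply S x) (blinfun_apply T f)"
  shows "S \<otimes>\<^sub>C T = R"
  unfolding tensor_op_def
proof (rule the_equality)
  show "R \<in> bops \<and> (\<forall>x f. blinfun_apply R (tensor_vec x f) =
    tensor_vec (blinfun_apply S x) (blinfun_apply T f))"
    using assms by blast
next
  fix R' assume R': "R' \<in> bops \<and> (\<forall>x f. blinfun_apply R' (tensor_vec x f) =
    tensor_vec (blinfun_apply S x) (blinfun_apply T f))"
  show "R' = R"
  proof (rule ell2_blinfun_eqI)
    show "blinfun_apply R' (single i x) = blinfun_apply R (single i x)" for i x
      unfolding single_tensor_vec[of i x] by (simp add: R' assms(2))
  qed
qed

text \<open>An orthonormal basis of the first factor turns the amplification of T into a direct sum of
  copies of T, so that boundedness need not be proved by hand.\<close>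

lemma amplification_exists:
  fixes T :: "('i, complex) ell2 op"
  assumes T: "T \<in> bops"
  shows "\<exists>R :: ('i, 'h::complex_hilbert) ell2 op. R \<in> bops \<and>
    (\<forall>x f. blinfun_apply R (tensor_vec x f) = tensor_vec x (blinfun_apply T f))"
proof -
  obtain e :: "'h \<Rightarrow> 'h" where e: "\<And>v w. v \<noteq> w \<Longrightarrow> cinner (e v) (e w) = 0"
    "\<And>w. e w = 0 \<or> norm (e w) = 1" "cspan (range e) = cspan (range (\<lambda>x. x))"
    by (rule gram_schmidt[of "\<lambda>x. x"]) blast
  have spanE: "cspan (range e) = UNIV" unfolding e(3) using cspan_superset by auto
  obtain J :: "('h, ('i, complex) ell2) ell2 \<Rightarrow>\<^sub>L ('i, 'h) ell2"
    where J: "\<And>w g. blinfun_apply J (single w g) = tensor_vec (e w) g"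
      "\<And>c f. blinfun_apply J (c *\<^sub>C f) = c *\<^sub>C blinfun_apply J f"
  proof (rule ell2_blinfun_exists[of "\<lambda>w. tensor_vec (e w)" 1])
    show "norm (tensor_vec (e w) g) \<le> 1 * norm g" for w and g :: "('i, complex) ell2"
      using e(2)[of w] by (auto simp: norm_tensor_vec)
  qed (auto simp: tensor_vec_add_right tensor_vec_scale_right cinner_tensor_vec e(1))
  obtain K :: "('i, 'h) ell2 \<Rightarrow>\<^sub>L ('h, ('i, complex) ell2) ell2"
    where K: "\<And>x y. cinner (blinfun_apply K x) y = cinner x (blinfun_apply J y)"
      "\<And>c x. blinfun_apply K (c *\<^sub>C x) = c *\<^sub>C blinfun_apply K x"
    by (rule adjoint_exists[of J, OF J(2)]) blast
  obtain D :: "('h, ('i, complex) ell2) ell2 op"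
    where D: "\<And>w g. blinfun_apply D (single w g) = single w (blinfun_apply T g)"
      "\<And>c f. blinfun_apply D (c *\<^sub>C f) = c *\<^sub>C blinfun_apply D f"
    by (rule ell2_blinfun_exists[of "\<lambda>w g. single w (blinfun_apply T g)" "norm T"])
      (auto simp: blinfun.add_right single_add bopsD[OF T] single_scaleC cinner_single norm_blinfun)
  have KJ: "blinfun_apply K (tensor_vec (e w) g) = (if e w = 0 then 0 else single w g)" for w g
  proof (rule ell2_ext_cinner)
    have "cinner (e w) (e w) = 1" if "e w \<noteq> 0" using e(2)[of w] that by (simp add: cinner_self)
    thus "cinner (blinfun_apply K (tensor_vec (e w) g)) (single u h) = cinner (if e w =
      0 then 0 else single w g) (single u h)"
      for u h using e(1)[of w u] by (auto simp: K(1) J(1) cinner_tensor_vec cinner_single)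
  qed
  define R where "R = J o\<^sub>L D o\<^sub>L K"
  have "blinfun_apply R (tensor_vec x f) = tensor_vec x (blinfun_apply T f)" for x f
  proof -
    have bl: "bounded_linear (\<lambda>x :: 'h. tensor_vec x f)" for f :: "('i, complex) ell2"
    proof (rule bounded_linear_intro[of _ "norm f"])
      show "tensor_vec (r *\<^sub>R x) f = r *\<^sub>R tensor_vec x f" for r and x :: 'h
        using tensor_vec_scale_left[of "complex_of_real r" x f] by (simp add: scaleC_of_real)
    qed (simp_all add: tensor_vec_add_left norm_tensor_vec)
    \<comment> \<open>For fixed f both sides are bounded and linear in x, so the comparison on the
      vectors \<open>e w\<close> extends to their closed span, which is everything.\<close>
    let ?E = "(R o\<^sub>L Blinfun (\<lambda>x. tensor_vec x f)) - Blinfun (\<lambda>x. tensor_vec x (blinfun_apply T f))"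
    have Re: "blinfun_apply R (tensor_vec (e w) f) = tensor_vec (e w) (blinfun_apply T f)" for w
      by (simp add: R_def KJ D(1) J(1))
    have Rc: "blinfun_apply R (c *\<^sub>C y) = c *\<^sub>C blinfun_apply R y" for c y
      by (simp add: R_def J(2) D(2) K(2))
    have "cspan (range e) \<subseteq> {x. blinfun_apply ?E x \<in> {0}}"
      by (intro cspan_minimal subspace_vimage_blinfun closed_vimage_blinfun)
        (auto simp: blinfun.diff_left bounded_linear_Blinfun_apply bl tensor_vec_scale_left Re Rc)
    hence "blinfun_apply ?E x \<in> {0}" unfolding spanE by blast
    thus ?thesis by (simp add: blinfun.diff_left bounded_linear_Blinfun_apply bl)
  qed
  moreover have "R \<in> bops" by (rule bopsI) (simp add: R_def J(2) D(2) K(2))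
  ultimately show ?thesis by blast
qed

text \<open>The operator factors as S tensor 1 after 1 tensor T. The first factor acts in each
  coordinate separately, the second is the amplification of T.\<close>

lemma tensor_op_exists:
  fixes S :: "'h::complex_hilbert op" and T :: "('i, complex) ell2 op"
  assumes S: "S \<in> bops" and T: "T \<in> bops"
  shows "\<exists>R. R \<in> bops \<and> (\<forall>x f. blinfun_apply R (tensor_vec x f) =
    tensor_vec (blinfun_apply S x) (blinfun_apply T f))"
proof -
  obtain A :: "('i, 'h) ell2 op" where A: "\<And>i x. blinfun_apply A (single i x) =
    single i (blinfun_apply S x)"
    "\<And>c f. blinfun_apply A (c *\<^sub>C f) = c *\<^sub>C blinfun_apply A f"
    by (rule ell2_blinfun_exists[of "\<lambda>i x. single i (blinfun_apply S x)" "norm S"])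
      (auto simp: blinfun.add_right single_add bopsD[OF S] single_scaleC cinner_single norm_blinfun)
  obtain R :: "('i, 'h) ell2 op" where R: "R \<in> bops \<and>
    (\<forall>x f. blinfun_apply R (tensor_vec x f) = tensor_vec x (blinfun_apply T f))"
    using amplification_exists[OF T] ..
  have "blinfun_apply A (tensor_vec x f) = tensor_vec (blinfun_apply S x) f" for x f
  proof -
    have "A o\<^sub>L Blinfun (tensor_vec x) = Blinfun (tensor_vec (blinfun_apply S x))"
      by (rule ell2_blinfun_eqI)
        (simp add: bounded_linear_Blinfun_apply bounded_linear_tensor_vec tensor_vec_single A(1)
          bopsD[OF S])
    from arg_cong[OF this, of "\<lambda>B. blinfun_apply B f"] show ?thesis
      by (simp add: bounded_linear_Blinfun_apply bounded_linear_tensor_vec)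
  qed
  hence "blinfun_apply (A o\<^sub>L R) (tensor_vec x f) =
    tensor_vec (blinfun_apply S x) (blinfun_apply T f)" for x f
    using R by simp
  moreover have "A o\<^sub>L R \<in> bops" using R A(2) by (intro comp_bops) (auto intro: bopsI)
  ultimately show ?thesis by blast
qed

lemma
  assumes "S \<in> bops" "T \<in> bops"
  shows tensor_op_bops: "S \<otimes>\<^sub>C T \<in> bops"
    and tensor_op_apply: "blinfun_apply (S \<otimes>\<^sub>C T) (tensor_vec x f) =
      tensor_vec (blinfun_apply S x) (blinfun_apply T f)"
proof -
  obtain R where R: "R \<in> bops \<and> (\<forall>x f. blinfun_apply R (tensor_vec x f) =
    tensor_vec (blinfun_apply S x) (blinfun_apply T f))"
    using tensor_op_exists[OF assms] ..
  have "S \<otimes>\<^sub>C T = R" by (rule tensor_op_eqI) (simp_all add: R)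
  thus "S \<otimes>\<^sub>C T \<in> bops"
    "blinfun_apply (S \<otimes>\<^sub>C T) (tensor_vec x f) = tensor_vec (blinfun_apply S x) (blinfun_apply T f)"
    using R by auto
qed

lemma tensor_op_comp:
  assumes "S \<in> bops" "T \<in> bops" "S' \<in> bops" "T' \<in> bops"
  shows "(S \<otimes>\<^sub>C T) o\<^sub>L (S' \<otimes>\<^sub>C T') = (S o\<^sub>L S') \<otimes>\<^sub>C (T o\<^sub>L T')"
  by (rule tensor_op_eqI[symmetric]) (simp_all add: comp_bops tensor_op_bops tensor_op_apply assms)

lemma tensor_op_add:
  assumes "S \<in> bops" "S' \<in> bops" "T \<in> bops"
  shows "(S + S') \<otimes>\<^sub>C T = S \<otimes>\<^sub>C T + S' \<otimes>\<^sub>C T"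
  by (rule tensor_op_eqI)
    (auto intro!: subspace_add[OF subspace_bops] tensor_op_bops assms
      simp: blinfun.add_left tensor_op_apply assms tensor_vec_add_left)

lemma tensor_op_scale:
  assumes "S \<in> bops" "T \<in> bops"
  shows "(c \<cdot>\<^sub>C S) \<otimes>\<^sub>C T = c \<cdot>\<^sub>C (S \<otimes>\<^sub>C T)"
  by (rule tensor_op_eqI) (auto intro!: scale_bops tensor_op_bops assms simp: tensor_op_apply assms
    tensor_vec_scale_left)

lemma adj_tensor_op:
  assumes S: "S \<in> bops" and Tb: "T \<in> bops"
  shows "adj (S \<otimes>\<^sub>C T) = adj S \<otimes>\<^sub>C adj T"
proof (rule tensor_op_eqI[symmetric])
  have b: "S \<otimes>\<^sub>C T \<in> bops" by (rule tensor_op_bops) fact+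
  show "adj (S \<otimes>\<^sub>C T) \<in> bops" by (rule adj_bops[OF b])
  fix x f
  show "blinfun_apply (adj (S \<otimes>\<^sub>C T)) (tensor_vec x f) =
    tensor_vec (blinfun_apply (adj S) x) (blinfun_apply (adj T) f)"
  proof (rule ell2_ext_cinner)
    show "cinner (blinfun_apply (adj (S \<otimes>\<^sub>C T)) (tensor_vec x f)) (single i y) =
      cinner (tensor_vec (blinfun_apply (adj S) x) (blinfun_apply (adj T) f)) (single i y)" for i y
      unfolding single_tensor_vec[of i y]
      by (simp add: cinner_adj[OF b] cinner_adj[OF S] cinner_adj[OF Tb] tensor_op_apply S Tb
        cinner_tensor_vec)
  qed
qed

text \<open>A diagonal matrix entry. On elementary tensors it is the slice map of the vector state
  at the i-th basis vector of the second factor.\<close>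

definition entry :: "'i \<Rightarrow> ('i, 'h::complex_hilbert) ell2 op \<Rightarrow> 'h op"
  where "entry i F = Blinfun (\<lambda>f. Rep_ell2 f i) o\<^sub>L F o\<^sub>L Blinfun (single i)"

lemma bounded_linear_coordinate: "bounded_linear (\<lambda>f :: ('i, 'h::complex_hilbert) ell2. Rep_ell2 f
  i)"
  by (rule bounded_linear_intro[of _ 1]) (simp_all add: plus_ell2.rep_eq scaleR_ell2.rep_eq
    norm_le_ell2)

lemma bounded_linear_single: "bounded_linear (single i)"
  by (rule bounded_linear_intro[of _ 1]) (simp_all add: single_add single_scaleR)

lemma bounded_linear_entry: "bounded_linear (entry i)"
proof -
  have "bounded_linear (\<lambda>F. (Blinfun (\<lambda>f. Rep_ell2 f i) o\<^sub>L F) o\<^sub>L Blinfun (single i))"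
    by (rule bounded_linear_compose[OF bounded_bilinear.bounded_linear_left[OF
      bounded_bilinear_blinfun_compose]
          bounded_bilinear.bounded_linear_right[OF bounded_bilinear_blinfun_compose]])
  thus ?thesis by (simp add: entry_def[abs_def])
qed

lemma entry_tensor_op:
  assumes "S \<in> bops" "T \<in> bops"
  shows "entry i (S \<otimes>\<^sub>C T) = Rep_ell2 (blinfun_apply T (single i 1)) i \<cdot>\<^sub>C S"
proof (rule blinfun_eqI)
  fix x
  have "blinfun_apply (entry i (S \<otimes>\<^sub>C T)) x = Rep_ell2 (blinfun_apply (S \<otimes>\<^sub>C T) (single i x)) i"
    by (simp add: entry_def bounded_linear_Blinfun_apply bounded_linear_coordinate
      bounded_linear_single)
  thus "blinfun_apply (entry i (S \<otimes>\<^sub>C T)) x =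
    blinfun_apply (Rep_ell2 (blinfun_apply T (single i 1)) i \<cdot>\<^sub>C S) x"
    unfolding single_tensor_vec[of i x] by (simp add: tensor_op_apply assms tensor_vec.rep_eq)
qed

section \<open>The group C*-algebra\<close>

text \<open>All words of any other shape stay fixed, so for g in the group the map is a bijection of
  the set of all words and the resulting operator is unitary on the whole space.\<close>

definition shift_letter :: "('g, 'm) monoid_scheme \<Rightarrow> 'g \<Rightarrow> ('g \<times> bool) list \<Rightarrow> ('g \<times> bool) list"
  where "shift_letter G g w = (case w of [(h, b)] \<Rightarrow> if h \<in> carrier G then [(g \<otimes>\<^bsub>G\<^esub> h, b)] else w | _
    \<Rightarrow> w)"

text \<open>The left regular representation, transported to the space of words along the inclusion of the
  group as words of length one.\<close>

definition regular_rep :: "('g, 'm) monoid_scheme \<Rightarrow> 'g \<Rightarrow> 'g word_space op"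
  where "regular_rep G = (\<lambda>g\<in>carrier G. partial_shift UNIV (shift_letter G g))"

lemma unitary_opI:
  assumes "T \<in> bops" "adj T o\<^sub>L T = id_blinfun" "T o\<^sub>L S = id_blinfun"
  shows "unitary_op T"
proof -
  have "adj T = (adj T o\<^sub>L T) o\<^sub>L S" by (simp only: compose_assoc assms(3) compose_id)
  hence "adj T = S" by (simp only: assms(2) id_compose)
  thus ?thesis using assms by (simp add: unitary_op_def)
qed

context group
begin

lemma shift_letter_mult:
  assumes "g \<in> carrier G" "h \<in> carrier G"
  shows "shift_letter G g (shift_letter G h w) = shift_letter G (g \<otimes> h) w"
  unfolding shift_letter_def using assms by (auto split: list.splits simp: m_assoc)

lemma shift_letter_one: "shift_letter G \<one> w = w"
  unfolding shift_letter_def by (auto split: list.splits)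

lemma inj_shift_letter: "g \<in> carrier G \<Longrightarrow> inj (shift_letter G g)"
  by (rule inj_on_inverseI[of _ "shift_letter G (inv g)"]) (simp add: shift_letter_mult
    shift_letter_one)

lemma regular_rep_mult:
  assumes "g \<in> carrier G" "h \<in> carrier G"
  shows "regular_rep G (g \<otimes> h) = regular_rep G g o\<^sub>L regular_rep G h"
  using assms by (simp add: regular_rep_def partial_shift_comp inj_shift_letter shift_letter_mult)

lemma regular_rep_unitary: "regular_rep G \<in> unitary_reps G"
proof -
  have one: "regular_rep G \<one> = id_blinfun"
    by (simp add: regular_rep_def shift_letter_one[abs_def] partial_shift_id)
  have "unitary_op (regular_rep G g)" if g: "g \<in> carrier G" for g
  proof (rule unitary_opI)
    show "regular_rep G g \<in> bops"
      using g by (simp add: regular_rep_def partial_shift_bops inj_shift_letter)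
    show "adj (regular_rep G g) o\<^sub>L regular_rep G g = id_blinfun"
      using g by (simp add: regular_rep_def adj_partial_shift_comp inj_shift_letter
        partial_shift_id)
    show "regular_rep G g o\<^sub>L regular_rep G (inv g) = id_blinfun"
      using g by (simp add: regular_rep_mult[symmetric] one)
  qed
  thus ?thesis by (auto simp: unitary_reps_def regular_rep_mult) (simp add: regular_rep_def)
qed

lemma group_unitary_isometry:
  assumes g: "g \<in> carrier G" shows "isometry_op (group_unitary G g)"
  unfolding group_unitary_def using g
  by (intro isometry_dsum) (auto simp: unitary_reps_def isometry_id intro!: unitary_isometry)

lemma group_unitary_bops: "g \<in> carrier G \<Longrightarrow> group_unitary G g \<in> bops"
  using group_unitary_isometry by (simp add: isometry_op_def)

lemma slice_group_unitary:
  assumes g: "g \<in> carrier G"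
  shows "slice (blinfun_apply (group_unitary G g) f) \<rho> =
    (if \<rho> \<in> unitary_reps G then blinfun_apply (\<rho> g) (slice f \<rho>) else slice f \<rho>)"
  unfolding group_unitary_def
proof (subst slice_dsum[of _ 1])
  show "norm (if \<rho> \<in> unitary_reps G then \<rho> g else id_blinfun) \<le> 1" for \<rho> :: "'a \<Rightarrow> 'a word_space op"
    using g isometry_id[where 'a = "'a word_space"]
    by (intro isometry_norm_le) (auto simp: unitary_reps_def intro!: unitary_isometry)
qed simp

lemma group_unitary_mult:
  assumes "g \<in> carrier G" "h \<in> carrier G"
  shows "group_unitary G (g \<otimes> h) = group_unitary G g o\<^sub>L group_unitary G h"
  by (rule blinfun_eqI, rule slice_eqI) (use assms in \<open>auto simp: slice_group_unitary
    unitary_reps_def\<close>)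

text \<open>The operator is an idempotent isometry; cancelling it by its adjoint leaves the
  identity.\<close>

lemma group_unitary_one: "group_unitary G \<one> = id_blinfun"
proof -
  have "group_unitary G \<one> o\<^sub>L group_unitary G \<one> = group_unitary G \<one>"
    using group_unitary_mult[of \<one> \<one>] by simp
  hence "(adj (group_unitary G \<one>) o\<^sub>L group_unitary G \<one>) o\<^sub>L group_unitary G \<one>
      = adj (group_unitary G \<one>) o\<^sub>L group_unitary G \<one>" by (simp only: compose_assoc)
  thus ?thesis by (simp only: adj_isometry[OF group_unitary_isometry[OF one_closed]] id_compose)
qed

lemma adj_group_unitary:
  assumes g: "g \<in> carrier G"
  shows "adj (group_unitary G g) = group_unitary G (inv g)"
proof -
  let ?u = "group_unitary G"
  have "adj (?u g) = adj (?u g) o\<^sub>L (?u g o\<^sub>L ?u (inv g))"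
    using g by (simp add: group_unitary_mult[symmetric] group_unitary_one compose_id)
  thus ?thesis by (simp only: compose_assoc[symmetric] adj_isometry[OF group_unitary_isometry[OF g]]
    id_compose)
qed

text \<open>The basis vector of the unit of G inside the summand of the left regular representation.
  The flag is arbitrary, since translations do not change it.\<close>

definition vacuum :: "('a \<Rightarrow> 'a word_space op) \<times> ('a \<times> bool) list"
  where "vacuum = (regular_rep G, [(\<one>, True)])"

text \<open>This is the canonical trace of the group. Only the unit fixes a point under left
  translation, and every other element moves the vacuum to an orthogonal basis vector.\<close>

lemma vacuum_state:
  assumes g: "g \<in> carrier G"
  shows "Rep_ell2 (blinfun_apply (group_unitary G g) (single vacuum 1)) vacuum = (if g =
    \<one> then 1 else 0)"
proof -
  have "Rep_ell2 (blinfun_apply (group_unitary G g) (single vacuum 1)) vacuum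
    = Rep_ell2 (slice (blinfun_apply (group_unitary G g) (single vacuum 1)) (regular_rep G)) [(\<one>,
      True)]"
    by (simp add: vacuum_def slice.rep_eq)
  also have "\<dots> = Rep_ell2 (single (shift_letter G g [(\<one>, True)]) (1::complex)) [(\<one>, True)]"
    using g by (simp add: slice_group_unitary regular_rep_unitary vacuum_def slice_single)
      (simp add: regular_rep_def partial_shift_single inj_shift_letter)
  also have "\<dots> = (if g = \<one> then 1 else 0)" using g by (auto simp: shift_letter_def)
  finally show ?thesis .
qed

end

section \<open>Closed spans and C*-algebras of words\<close>

lemma closure_span_minimal:
  fixes B :: "'a::real_normed_vector set"
  shows "subspace C \<Longrightarrow> closed C \<Longrightarrow> B \<subseteq> C \<Longrightarrow> closure (span B) \<subseteq> C"
  by (intro closure_minimal span_minimal)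

lemma closure_span_superset: "B \<subseteq> closure (span B)"
  using span_superset closure_subset by blast

lemma closure_span_linear:
  assumes f: "bounded_linear f" and C: "subspace C" "closed C" and B: "\<And>x. x \<in> B \<Longrightarrow> f x \<in> C"
    and x: "x \<in> closure (span B)"
  shows "f x \<in> C"
proof -
  have f': "blinfun_apply (Blinfun f) y = f y" for y using f
    by (simp add: bounded_linear_Blinfun_apply)
  have "closure (span B) \<subseteq> {x. blinfun_apply (Blinfun f) x \<in> C}"
    by (intro closure_span_minimal subspace_vimage_blinfun closed_vimage_blinfun C) (auto simp: f'
      B)
  thus ?thesis using x by (auto simp: f')
qed

lemma closure_span_bilinear:
  assumes f: "\<And>y. bounded_linear (\<lambda>x. f x y)" "\<And>x. bounded_linear (f x)"
    and C: "subspace C" "closed C" and B: "\<And>x y. x \<in> B \<Longrightarrow> y \<in> B' \<Longrightarrow> f x y \<in> C"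
    and x: "x \<in> closure (span B)" and y: "y \<in> closure (span B')"
  shows "f x y \<in> C"
proof -
  have "f x z \<in> C" if "z \<in> B'" for z
    by (rule closure_span_linear[OF f(1) C _ x]) (rule B[OF _ that])
  thus ?thesis by (rule closure_span_linear[OF f(2) C _ y])
qed

lemma bounded_linear_comp_left: "bounded_linear (\<lambda>S. S o\<^sub>L T)"
  by (rule bounded_bilinear.bounded_linear_left[OF bounded_bilinear_blinfun_compose])

lemma bounded_linear_comp_right: "bounded_linear (\<lambda>T. S o\<^sub>L T)"
  by (rule bounded_bilinear.bounded_linear_right[OF bounded_bilinear_blinfun_compose])

text \<open>\<open>adj\<close> has its meaning only on \<open>bops\<close>, where it is conjugate
  linear and continuous. Closures are therefore treated through preimages inside
  \<open>bops\<close>, and not by viewing \<open>adj\<close> as a bounded linear map on the full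
  operator type.\<close>

lemma closed_adj_vimage:
  fixes C :: "'h::complex_hilbert op set"
  assumes "closed C"
  shows "closed {T \<in> bops. adj T \<in> C}"
  unfolding closed_sequential_limits
proof (intro allI impI, elim conjE)
  fix X :: "nat \<Rightarrow> 'h op" and T
  assume X: "\<forall>n. X n \<in> {T \<in> bops. adj T \<in> C}" "X \<longlonglongrightarrow> T"
  have "T \<in> bops" using closed_sequentially[OF closed_bops] X by blast
  moreover have "adj T \<in> C"
    by (rule closed_sequentially[OF assms _ tendsto_adj[OF _ X(2)]]) (use X(1) in auto)
  ultimately show "T \<in> {T \<in> bops. adj T \<in> C}" by simp
qed

lemma subspace_adj_vimage:
  fixes C :: "'h::complex_hilbert op set"
  assumes "subspace C"
  shows "subspace {T \<in> bops. adj T \<in> C}"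
proof -
  have "adj (c *\<^sub>R T) = c *\<^sub>R adj T" if "T \<in> bops" for c and T :: "'h op"
    using adj_scale[OF that, of "complex_of_real c"] by (simp add: scale_op_of_real)
  thus ?thesis
    using assms subspace_bops by (auto simp: subspace_def adj_zero adj_add)
qed

lemma closure_span_adj:
  fixes B C :: "'h::complex_hilbert op set"
  assumes "subspace C" "closed C" "\<And>T. T \<in> B \<Longrightarrow> T \<in> bops \<and> adj T \<in> C" "T \<in> closure (span B)"
  shows "adj T \<in> C"
proof -
  have "closure (span B) \<subseteq> {T \<in> bops. adj T \<in> C}"
    by (intro closure_span_minimal subspace_adj_vimage closed_adj_vimage) (use assms in auto)
  thus ?thesis using assms(4) by blast
qed

lemma cstar_algebra_closure_span:
  fixes B :: "'h::complex_hilbert op set"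
  assumes bops: "B \<subseteq> bops" and comp: "\<And>S T. S \<in> B \<Longrightarrow> T \<in> B \<Longrightarrow> S o\<^sub>L T \<in> B"
    and adj: "\<And>T. T \<in> B \<Longrightarrow> adj T \<in> B" and sc: "\<And>c T. T \<in> B \<Longrightarrow> c \<cdot>\<^sub>C T \<in> B"
  shows "cstar_algebra (closure (span B))"
  unfolding cstar_algebra_def
proof (intro conjI ballI allI)
  let ?C = "closure (span B)"
  have sub: "subspace ?C" by (intro subspace_closure subspace_span)
  have cl: "closed ?C" by simp
  have B: "T \<in> ?C" if "T \<in> B" for T using that closure_span_superset by blast
  show "?C \<subseteq> bops" by (rule closure_span_minimal[OF subspace_bops closed_bops bops])
  show "0 \<in> ?C" by (rule subspace_0[OF sub])
  show "closed ?C" by simp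
  fix S assume S: "S \<in> ?C"
  show "adj S \<in> ?C" by (rule closure_span_adj[OF sub cl _ S]) (use B bops adj in blast)
  show "c \<cdot>\<^sub>C S \<in> ?C" for c by (rule closure_span_linear[OF bounded_linear_scale_op sub cl _ S])
    (intro B sc)
  fix T assume T: "T \<in> ?C"
  show "S + T \<in> ?C" by (rule subspace_add[OF sub S T])
  show "S o\<^sub>L T \<in> ?C"
    by (rule closure_span_bilinear[OF bounded_linear_comp_left bounded_linear_comp_right sub cl _ S
      T])
      (intro B comp)
qed

lemma cstar_algebraD:
  assumes "cstar_algebra A"
  shows "A \<subseteq> bops" "0 \<in> A" "closed A" "\<And>S T. S \<in> A \<Longrightarrow> T \<in> A \<Longrightarrow> S + T \<in> A"
    "\<And>S T. S \<in> A \<Longrightarrow> T \<in> A \<Longrightarrow> S o\<^sub>L T \<in> A" "\<And>T. T \<in> A \<Longrightarrow> adj T \<in> A"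
    "\<And>c T. T \<in> A \<Longrightarrow> c \<cdot>\<^sub>C T \<in> A"
  using assms unfolding cstar_algebra_def by blast+

lemma subspace_cstar_algebra:
  assumes "cstar_algebra A" shows "subspace A"
proof -
  have "c *\<^sub>R T \<in> A" if "T \<in> A" for c T
    using cstar_algebraD(7)[OF assms that, of "complex_of_real c"] by (simp add: scale_op_of_real)
  thus ?thesis using cstar_algebraD[OF assms] unfolding subspace_def by blast
qed

lemma cstar_algebra_bops: "cstar_algebra (bops :: 'h::complex_hilbert op set)"
  unfolding cstar_algebra_def using subspace_bops
  by (auto simp: subspace_def closed_bops comp_bops adj_bops scale_bops)

lemma cstar_algebra_cstar:
  fixes S :: "'h::complex_hilbert op set"
  assumes "S \<subseteq> bops" shows "cstar_algebra (cstar S)"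
proof -
  \<comment> \<open>\<open>bops\<close> is itself one of the algebras in the intersection, which
    keeps the hull inside the complex linear operators.\<close>
  have "cstar S \<subseteq> bops" unfolding cstar_def
    by (rule hull_minimal[of S bops cstar_algebra]) (use assms cstar_algebra_bops in auto)
  thus ?thesis unfolding cstar_algebra_def
  proof (intro conjI ballI allI)
    show "closed (cstar S)" unfolding cstar_def hull_def
      by (intro closed_Inter) (auto simp: cstar_algebra_def)
  qed (auto simp: cstar_def hull_def dest: cstar_algebraD)
qed

lemma cstar_superset: "S \<subseteq> cstar S"
  unfolding cstar_def by (rule hull_subset)

lemma cstar_minimal: "S \<subseteq> A \<Longrightarrow> cstar_algebra A \<Longrightarrow> cstar S \<subseteq> A"
  unfolding cstar_def by (rule hull_minimal)

section \<open>Words in the generators and their adjoints\<close>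

lemma word_op_Nil [simp]: "word_op w [] = id_blinfun"
  by (simp add: word_op_def)

lemma word_op_Cons [simp]: "word_op w ((p, q) # \<alpha>) = adj (w p) o\<^sub>L w q o\<^sub>L word_op w \<alpha>"
  by (simp add: word_op_def)

lemma word_op_append: "word_op w (\<alpha> @ \<beta>) = word_op w \<alpha> o\<^sub>L word_op w \<beta>"
  by (induction \<alpha>) (auto simp: id_compose compose_assoc)

text \<open>The adjoint of a product reverses the order of the letters, and the adjoint of the
  letter (p, q) is the letter (q, p).\<close>

definition reverse_word :: "('g \<times> 'g) list \<Rightarrow> ('g \<times> 'g) list"
  where "reverse_word \<alpha> = rev (map prod.swap \<alpha>)"

lemma reverse_word_Cons: "reverse_word ((p, q) # \<alpha>) = reverse_word \<alpha> @ [(q, p)]"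
  by (simp add: reverse_word_def)

text \<open>The empty word stands for the identity of the ambient space, which need not lie in the
  generated algebra when the unit of P acts as a proper projection.\<close>

definition words :: "'g set \<Rightarrow> ('g \<times> 'g) list set"
  where "words P = {\<alpha>. \<alpha> \<noteq> [] \<and> set \<alpha> \<subseteq> P \<times> P}"

lemma words_append: "\<alpha> \<in> words P \<Longrightarrow> \<beta> \<in> words P \<Longrightarrow> \<alpha> @ \<beta> \<in> words P"
  by (auto simp: words_def)

lemma words_reverse: "\<alpha> \<in> words P \<Longrightarrow> reverse_word \<alpha> \<in> words P"
  by (auto simp: words_def reverse_word_def)

lemma word_op_bops:
  assumes "w \<in> P \<rightarrow> bops" "set \<alpha> \<subseteq> P \<times> P"
  shows "word_op w \<alpha> \<in> bops"
  using assms(2)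
proof (induction \<alpha>)
  case (Cons a \<alpha>)
  thus ?case using assms(1) by (cases a) (auto intro!: comp_bops adj_bops)
qed (simp add: id_bops)

lemma adj_word_op:
  assumes w: "w \<in> P \<rightarrow> bops" and "set \<alpha> \<subseteq> P \<times> P"
  shows "adj (word_op w \<alpha>) = word_op w (reverse_word \<alpha>)"
  using assms(2)
proof (induction \<alpha>)
  case Nil
  show ?case by (simp add: reverse_word_def adj_id)
next
  case (Cons a \<alpha>)
  obtain p q where a: "a = (p, q)" by (cases a)
  have b: "w p \<in> bops" "w q \<in> bops" "word_op w \<alpha> \<in> bops"
    using w Cons.prems by (auto simp: a intro: word_op_bops)
  have IH: "adj (word_op w \<alpha>) = word_op w (reverse_word \<alpha>)" using Cons by simp
  show ?case unfolding a reverse_word_Cons word_op_append word_op_Cons word_op_Nil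
    using b by (simp add: adj_comp adj_adj comp_bops adj_bops compose_assoc compose_id IH)
qed

text \<open>The families of the operators t p (v p) of representations t of the product system; the
  image of the unit is only a projection, since t need not be unital.\<close>

definition corner_rep ::
  "('g, 'm) monoid_scheme \<Rightarrow> 'g set \<Rightarrow> ('g \<Rightarrow> 'h::complex_hilbert op) \<Rightarrow> bool"
  where "corner_rep G P w \<longleftrightarrow> w \<in> P \<rightarrow> bops \<and> (\<forall>p\<in>P. \<forall>q\<in>P. w (p \<otimes>\<^bsub>G\<^esub> q) = w p o\<^sub>L w q) \<and>
    (\<forall>p\<in>P. adj (w p) o\<^sub>L w p = w \<one>\<^bsub>G\<^esub>)"

lemma corner_repD:
  assumes "corner_rep G P w"
  shows "w \<in> P \<rightarrow> bops" "\<And>p q. p \<in> P \<Longrightarrow> q \<in> P \<Longrightarrow> w (p \<otimes>\<^bsub>G\<^esub> q) = w p o\<^sub>L w q"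
    "\<And>p. p \<in> P \<Longrightarrow> adj (w p) o\<^sub>L w p = w \<one>\<^bsub>G\<^esub>"
  using assms unfolding corner_rep_def by blast+

locale semigroup_in_group = group G + sub: submonoid P G
  for P and G (structure)
begin

lemma P_carrier: "p \<in> P \<Longrightarrow> p \<in> carrier G"
  using sub.subset by blast

text \<open>\<open>w \<one>\<close> has the form \<open>adj T\<close> times T and is therefore
  self-adjoint. The norm of \<open>w p x\<close> depends on x only through \<open>w \<one>\<close>,
  so it is the same for all p and is estimated at p = \<open>\<one>\<close> by the Cauchy-Schwarz
  inequality.\<close>

lemma corner_rep_one:
  fixes w :: "'a \<Rightarrow> 'h::complex_hilbert op"
  assumes w: "corner_rep G P w"
  shows "adj (w \<one>) = w \<one>" "p \<in> P \<Longrightarrow> w \<one> o\<^sub>L w p = w p" "p \<in> P \<Longrightarrow> w p o\<^sub>L w \<one> = w p"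
    "p \<in> P \<Longrightarrow> norm (w p) \<le> 1"
proof -
  note wD = corner_repD[OF w]
  have b: "w p \<in> bops" if "p \<in> P" for p using wD(1) that by blast
  have 1: "adj (w \<one>) o\<^sub>L w \<one> = w \<one>" by (rule wD(3)) simp
  have "adj (adj (w \<one>) o\<^sub>L w \<one>) = adj (w \<one>) o\<^sub>L w \<one>"
    using b[of \<one>] by (simp add: adj_comp adj_bops adj_adj)
  thus s: "adj (w \<one>) = w \<one>" by (simp only: 1)
  show "p \<in> P \<Longrightarrow> w \<one> o\<^sub>L w p = w p" using wD(2)[of \<one> p] by (simp add: P_carrier)
  show "p \<in> P \<Longrightarrow> w p o\<^sub>L w \<one> = w p" using wD(2)[of p \<one>] by (simp add: P_carrier)
  have n: "(norm (blinfun_apply (w p) x))\<^sup>2 = Re (cinner x (blinfun_apply (w \<one>) x))" if "p \<in> P"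
    for p x
    using norm_square_adj[OF b[OF that]] by (simp only: wD(3)[OF that])
  have n1: "norm (blinfun_apply (w \<one>) x) \<le> norm x" for x
  proof -
    have "(norm (blinfun_apply (w \<one>) x))\<^sup>2 \<le> cmod (cinner x (blinfun_apply (w \<one>) x))"
      using n[of \<one> x] complex_Re_le_cmod by simp
    also have "\<dots> \<le> norm x * norm (blinfun_apply (w \<one>) x)" by (rule cauchy_schwarz)
    finally show ?thesis by (cases "blinfun_apply (w \<one>) x = 0") (simp_all add: power2_eq_square)
  qed
  assume p: "p \<in> P"
  show "norm (w p) \<le> 1"
  proof (rule norm_blinfun_bound)
    fix x
    have "(norm (blinfun_apply (w p) x))\<^sup>2 = (norm (blinfun_apply (w \<one>) x))\<^sup>2"
      using n[OF p] n[of \<one>] by simp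
    thus "norm (blinfun_apply (w p) x) \<le> 1 * norm x" using n1[of x] by simp
  qed simp
qed

text \<open>Every generator is a word: the unit fills the starred slot and is absorbed.\<close>

lemma word_op_single:
  assumes "corner_rep G P w" "p \<in> P"
  shows "word_op w [(\<one>, p)] = w p"
  by (simp add: corner_rep_one(1)[OF assms(1)] corner_rep_one(2)[OF assms] compose_id)

definition word_span :: "('a \<Rightarrow> 'h::complex_hilbert op) \<Rightarrow> 'h op set"
  where "word_span w = {c \<cdot>\<^sub>C word_op w \<alpha> | c \<alpha>. \<alpha> \<in> words P}"

lemma word_spanI: "\<alpha> \<in> words P \<Longrightarrow> c \<cdot>\<^sub>C word_op w \<alpha> \<in> word_span w"
  by (auto simp: word_span_def)

lemma words_bops: "w \<in> P \<rightarrow> bops \<Longrightarrow> \<alpha> \<in> words P \<Longrightarrow> word_op w \<alpha> \<in> bops"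
  by (rule word_op_bops) (auto simp: words_def)

lemma words_adj: "w \<in> P \<rightarrow> bops \<Longrightarrow> \<alpha> \<in> words P \<Longrightarrow> adj (word_op w \<alpha>) = word_op w (reverse_word \<alpha>)"
  by (rule adj_word_op) (auto simp: words_def)

lemma word_op_cstar:
  assumes w: "w \<in> P \<rightarrow> bops" and A: "cstar_algebra A" "w ` P \<subseteq> A" and "\<alpha> \<in> words P"
  shows "word_op w \<alpha> \<in> A"
  using assms(4)
proof (induction \<alpha>)
  case (Cons a \<alpha>)
  obtain p q where a: "a = (p, q)" by (cases a)
  have pq: "p \<in> P" "q \<in> P" using Cons.prems by (auto simp: a words_def)
  hence *: "adj (w p) o\<^sub>L w q \<in> A" using A by (intro cstar_algebraD) auto
  \<comment> \<open>The word with one letter is a base case of its own, since the empty word gives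
    the identity, which may lie outside A.\<close>
  show ?case
  proof (cases "\<alpha> = []")
    case True
    thus ?thesis using * by (simp add: a compose_id)
  next
    case False
    hence "word_op w \<alpha> \<in> A" using Cons by (auto simp: words_def)
    thus ?thesis using cstar_algebraD(5)[OF A(1) *] by (simp add: a)
  qed
qed (simp add: words_def)

text \<open>Concatenation and reversal turn products and adjoints of words into words again, so the
  closed linear span is already the C*-algebra and no polynomial expressions are needed.\<close>

lemma cstar_word_span:
  assumes w: "corner_rep G P w"
  shows "cstar (w ` P) = closure (span (word_span w))"
proof
  have wb: "w \<in> P \<rightarrow> bops" by (rule corner_repD[OF w])
  have 1: "cstar_algebra (closure (span (word_span w)))"
  proof (rule cstar_algebra_closure_span)
    show "word_span w \<subseteq> bops" using words_bops[OF wb]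
      by (auto simp: word_span_def intro: scale_bops)
    fix T assume "T \<in> word_span w"
    then obtain c \<alpha> where T: "T = c \<cdot>\<^sub>C word_op w \<alpha>" "\<alpha> \<in> words P" unfolding word_span_def by blast
    show "adj T \<in> word_span w"
      using T by (simp add: adj_scale words_bops[OF wb] words_adj[OF wb] words_reverse word_spanI)
    show "d \<cdot>\<^sub>C T \<in> word_span w" for d
      using T by (simp add: scale_op_scale_op word_spanI)
    fix S assume "S \<in> word_span w"
    then obtain d \<beta> where S: "S = d \<cdot>\<^sub>C word_op w \<beta>" "\<beta> \<in> words P" unfolding word_span_def by blast
    show "S o\<^sub>L T \<in> word_span w"
      using S T by (simp add: scale_comp words_bops[OF wb] word_op_append[symmetric] words_append
        word_spanI)
  qed
  have "w p \<in> word_span w" if "p \<in> P" for p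
    using word_spanI[of "[(\<one>, p)]" 1 w] that
      by (simp only: word_op_single[OF w that] scale_op_one) (simp add: words_def)
  thus "cstar (w ` P) \<subseteq> closure (span (word_span w))"
    using closure_span_superset by (intro cstar_minimal 1) blast
  have 2: "cstar_algebra (cstar (w ` P))" using wb by (intro cstar_algebra_cstar) auto
  show "closure (span (word_span w)) \<subseteq> cstar (w ` P)"
    using word_op_cstar[OF wb 2 cstar_superset] cstar_algebraD[OF 2]
    by (intro closure_span_minimal subspace_cstar_algebra[OF 2]) (auto simp: word_span_def)
qed

end

section \<open>Representations of the product system and the universal property\<close>

type_synonym 'g index_rep =
  "'g \<Rightarrow> 'g group_space op \<Rightarrow> ('g \<times> 'g group_space op) word_space op"

context semigroup_in_group
begin

abbreviation X where "X \<equiv> semigroup_ps G P"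
abbreviation v where "v \<equiv> univ_isometry G P"
abbreviation S where "S \<equiv> \<lambda>p. univ_ps_rep G P X p (v p)"

lemma v_scale_inj: "p \<in> P \<Longrightarrow> c \<cdot>\<^sub>C v p = d \<cdot>\<^sub>C v p \<Longrightarrow> c = d"
proof -
  assume p: "p \<in> P" and eq: "c \<cdot>\<^sub>C v p = d \<cdot>\<^sub>C v p"
  \<comment> \<open>Any index serves here; the vector only has to have norm 1.\<close>
  let ?x = "single undefined 1 :: 'a group_space"
  have "norm (blinfun_apply (v p) ?x) = 1"
    using isometry_univ_isometry[OF p, of G] by (simp add: isometry_op_def)
  hence "blinfun_apply (v p) ?x \<noteq> 0" by auto
  moreover have "c *\<^sub>C blinfun_apply (v p) ?x = d *\<^sub>C blinfun_apply (v p) ?x"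
    using arg_cong[OF eq, of "\<lambda>T. blinfun_apply T ?x"] by simp
  hence "(c - d) *\<^sub>C blinfun_apply (v p) ?x = 0"
    using scaleC_add_left[of "c - d" d "blinfun_apply (v p) ?x"] by simp
  hence "cmod (c - d) * norm (blinfun_apply (v p) ?x) = 0"
    by (simp only: norm_scaleC[symmetric] norm_zero)
  ultimately show "c = d" by simp
qed

lemma X_iff: "\<xi> \<in> X p \<longleftrightarrow> (\<exists>c. \<xi> = c \<cdot>\<^sub>C v p)"
  by (auto simp: semigroup_ps_def)

lemma v_X: "c \<cdot>\<^sub>C v p \<in> X p" "v p \<in> X p"
  unfolding X_iff by (rule exI, rule refl) (rule exI[of _ 1], simp)

lemma v_bops: "p \<in> P \<Longrightarrow> v p \<in> bops"
  using isometry_univ_isometry[of p P G] by (simp add: isometry_op_def)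

lemma v_mult: "p \<in> P \<Longrightarrow> q \<in> P \<Longrightarrow> v (p \<otimes> q) = v p o\<^sub>L v q"
  by (rule univ_isometry_mult[OF sub.submonoid_axioms])

lemma v_one: "v \<one> = id_blinfun"
  by (rule univ_isometry_one[OF group_axioms sub.submonoid_axioms])

lemma v_adj: "p \<in> P \<Longrightarrow> adj (v p) o\<^sub>L v p = id_blinfun"
  by (rule adj_isometry[OF isometry_univ_isometry])

definition coef :: "'a \<Rightarrow> 'a group_space op \<Rightarrow> complex"
  where "coef p \<xi> = (THE c. \<xi> = c \<cdot>\<^sub>C v p)"

lemma coef_scale [simp]: "p \<in> P \<Longrightarrow> coef p (c \<cdot>\<^sub>C v p) = c"
  unfolding coef_def by (rule the_equality) (auto dest: v_scale_inj)

lemma coef_X: "p \<in> P \<Longrightarrow> \<xi> \<in> X p \<Longrightarrow> coef p \<xi> \<cdot>\<^sub>C v p = \<xi>"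
  by (auto simp: X_iff)

text \<open>The inverse of the bijection. Both restrictions are there because \<open>ps_reps\<close>
  consists of extensional functions, so that a representation is recovered as a function on the
  whole type.\<close>

definition ps_rep_of :: "('a \<Rightarrow> 'h::complex_hilbert op) \<Rightarrow> 'a \<Rightarrow> 'a group_space op \<Rightarrow> 'h op"
  where "ps_rep_of w = (\<lambda>p\<in>P. \<lambda>\<xi>\<in>X p. coef p \<xi> \<cdot>\<^sub>C w p)"

lemma ps_rep_of_scale: "p \<in> P \<Longrightarrow> ps_rep_of w p (c \<cdot>\<^sub>C v p) = c \<cdot>\<^sub>C w p"
  by (simp add: ps_rep_of_def v_X)

lemma ps_rep_of_v: "p \<in> P \<Longrightarrow> ps_rep_of w p (v p) = w p"
  using ps_rep_of_scale[of p w 1] by simp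

lemma ps_rep_of_ps_reps:
  assumes w: "corner_rep G P w"
  shows "ps_rep_of w \<in> ps_reps G P X"
proof -
  let ?t = "ps_rep_of w"
  have b: "w p \<in> bops" if "p \<in> P" for p using corner_repD(1)[OF w] that by blast
  have 1: "\<one> \<in> P" by simp
  have PiE: "?t \<in> (\<Pi>\<^sub>E p\<in>P. X p \<rightarrow>\<^sub>E bops)"
    unfolding ps_rep_of_def by (auto intro!: scale_bops b)
  have lin: "?t p (\<xi> + \<eta>) = ?t p \<xi> + ?t p \<eta> \<and> ?t p (c \<cdot>\<^sub>C \<xi>) = c \<cdot>\<^sub>C ?t p \<xi>"
    if p: "p \<in> P" and X: "\<xi> \<in> X p" "\<eta> \<in> X p" for p \<xi> \<eta> c
  proof -
    obtain a d where "\<xi> = a \<cdot>\<^sub>C v p" "\<eta> = d \<cdot>\<^sub>C v p" using X unfolding X_iff by blast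
    thus ?thesis using p
      by (simp add: scale_op_add_left[symmetric] scale_op_scale_op ps_rep_of_scale)
  qed
  have adj: "?t \<one> (adj a) = adj (?t \<one> a)" if X: "a \<in> X \<one>" for a
  proof -
    obtain c where a: "a = c \<cdot>\<^sub>C v \<one>" using X unfolding X_iff by blast
    have "adj a = cnj c \<cdot>\<^sub>C v \<one>" by (simp add: a adj_scale v_one id_bops adj_id)
    hence "?t \<one> (adj a) = cnj c \<cdot>\<^sub>C w \<one>" by (simp add: ps_rep_of_scale)
    thus ?thesis by (simp add: a ps_rep_of_scale adj_scale b corner_rep_one(1)[OF w])
  qed
  have mul: "?t p \<xi> o\<^sub>L ?t q \<eta> = ?t (p \<otimes> q) (\<xi> o\<^sub>L \<eta>)"
    if pq: "p \<in> P" "q \<in> P" and X: "\<xi> \<in> X p" "\<eta> \<in> X q" for p q \<xi> \<eta>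
  proof -
    obtain a d where "\<xi> = a \<cdot>\<^sub>C v p" "\<eta> = d \<cdot>\<^sub>C v q" using X unfolding X_iff by blast
    thus ?thesis using pq
      by (simp add: scale_comp v_bops b v_mult[symmetric] ps_rep_of_scale corner_repD(2)[OF w])
  qed
  have adjmul: "adj (?t p \<xi>) o\<^sub>L ?t (p \<otimes> q) \<eta> = ?t q (adj \<xi> o\<^sub>L \<eta>)"
    if pq: "p \<in> P" "q \<in> P" and X: "\<xi> \<in> X p" "\<eta> \<in> X (p \<otimes> q)" for p q \<xi> \<eta>
  proof -
    obtain a d where ad: "\<xi> = a \<cdot>\<^sub>C v p" "\<eta> = d \<cdot>\<^sub>C v (p \<otimes> q)" using X unfolding X_iff by blast
    have "adj \<xi> o\<^sub>L \<eta> = (cnj a * d) \<cdot>\<^sub>C ((adj (v p) o\<^sub>L v p) o\<^sub>L v q)"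
      using pq unfolding ad by (simp add: adj_scale v_bops scale_comp adj_bops v_mult compose_assoc)
    hence "?t q (adj \<xi> o\<^sub>L \<eta>) = (cnj a * d) \<cdot>\<^sub>C w q"
      using pq by (simp add: v_adj id_compose ps_rep_of_scale)
    moreover have "adj (?t p \<xi>) o\<^sub>L ?t (p \<otimes> q) \<eta> = (cnj a * d) \<cdot>\<^sub>C ((adj (w p) o\<^sub>L w p) o\<^sub>L w q)"
      using pq unfolding ad
      by (simp add: ps_rep_of_scale adj_scale b scale_comp adj_bops corner_repD(2)[OF w]
        compose_assoc)
    ultimately show ?thesis using pq by (simp add: corner_repD(3)[OF w] corner_rep_one(2)[OF w])
  qed
  show ?thesis unfolding ps_reps_def mem_Collect_eq
    by (intro conjI ballI allI PiE adj mul adjmul) (simp_all add: lin)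
qed

lemma
  assumes t: "t \<in> ps_reps G P X"
  shows ps_reps_scale: "p \<in> P \<Longrightarrow> t p (c \<cdot>\<^sub>C v p) = c \<cdot>\<^sub>C t p (v p)"
    and ps_reps_corner: "corner_rep G P (\<lambda>p. t p (v p))"
proof -
  note t' = t[unfolded ps_reps_def mem_Collect_eq]
  show "p \<in> P \<Longrightarrow> t p (c \<cdot>\<^sub>C v p) = c \<cdot>\<^sub>C t p (v p)"
    using conjunct1[OF conjunct2[OF t']] v_X(2)[of p] by simp
  have bops: "t p (v p) \<in> bops" if "p \<in> P" for p
    using conjunct1[OF t'] v_X(2)[of p] that by (auto simp: PiE_def Pi_def)
  have mult: "t (p \<otimes> q) (v (p \<otimes> q)) = t p (v p) o\<^sub>L t q (v q)" if "p \<in> P" "q \<in> P" for p q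
    unfolding v_mult[OF that]
    by (rule conjunct1[OF conjunct2[OF conjunct2[OF conjunct2[OF t']]], rule_format, OF that v_X(2)
      v_X(2), symmetric])
  have "adj (t p (v p)) o\<^sub>L t p (v p) = t \<one> (v \<one>)" if p: "p \<in> P" for p
  proof -
    have "v p \<in> X (p \<otimes> \<one>)" using p v_X(2)[of p] by (simp add: P_carrier)
    hence "adj (t p (v p)) o\<^sub>L t (p \<otimes> \<one>) (v p) = t \<one> (adj (v p) o\<^sub>L v p)"
      by (rule conjunct2[OF conjunct2[OF conjunct2[OF conjunct2[OF t']]], rule_format, OF p
        sub.one_closed v_X(2)])
    thus ?thesis using p by (simp add: P_carrier v_adj v_one)
  qed
  thus "corner_rep G P (\<lambda>p. t p (v p))" unfolding corner_rep_def using bops mult by simp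
qed

lemma ps_cstar_eq:
  assumes "\<And>p c. p \<in> P \<Longrightarrow> t p (c \<cdot>\<^sub>C v p) = c \<cdot>\<^sub>C t p (v p)" "\<And>p. p \<in> P \<Longrightarrow> t p (v p) \<in> bops"
  shows "ps_cstar P X t = cstar ((\<lambda>p. t p (v p)) ` P)"
proof
  have 1: "cstar_algebra (cstar ((\<lambda>p. t p (v p)) ` P))"
    by (rule cstar_algebra_cstar) (use assms(2) in auto)
  have 2: "t p (v p) \<in> cstar ((\<lambda>p. t p (v p)) ` P)" if "p \<in> P" for p
    by (rule subsetD[OF cstar_superset]) (use that in blast)
  have "(\<Union>p\<in>P. t p ` X p) \<subseteq> cstar ((\<lambda>p. t p (v p)) ` P)"
    by (auto simp: X_iff assms(1) intro!: cstar_algebraD(7)[OF 1] 2)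
  thus "ps_cstar P X t \<subseteq> cstar ((\<lambda>p. t p (v p)) ` P)" unfolding ps_cstar_def
    using 1 by (rule cstar_minimal)
  show "cstar ((\<lambda>p. t p (v p)) ` P) \<subseteq> ps_cstar P X t" unfolding ps_cstar_def
  proof (rule cstar_minimal)
    show "cstar_algebra (cstar (\<Union>p\<in>P. t p ` X p))"
      by (rule cstar_algebra_cstar) (auto simp: X_iff assms intro!: scale_bops)
    show "(\<lambda>p. t p (v p)) ` P \<subseteq> cstar (\<Union>p\<in>P. t p ` X p)"
      by (rule order_trans[OF _ cstar_superset]) (use v_X(2) in blast)
  qed
qed

text \<open>A bound uniform in the index is what makes the direct sum defining the universal
  representation exist as a bounded operator. It comes from contractivity of every
  \<open>corner_rep\<close>.\<close>

lemma norm_ps_reps: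
  assumes "p \<in> P"
  shows "norm (if \<rho> \<in> ps_reps G P X then \<rho> p (c \<cdot>\<^sub>C v p) else 0) \<le> cmod c"
proof (cases "\<rho> \<in> ps_reps G P X")
  case True
  have "norm (c \<cdot>\<^sub>C \<rho> p (v p)) \<le> cmod c * norm (\<rho> p (v p))" by (rule norm_scale_op)
  also have "\<dots> \<le> cmod c * 1"
    by (intro mult_left_mono corner_rep_one(4)[OF ps_reps_corner[OF True] assms]) simp
  finally show ?thesis using True assms by (simp add: ps_reps_scale)
qed simp

lemma slice_univ_ps_rep:
  "p \<in> P \<Longrightarrow> slice (blinfun_apply (univ_ps_rep G P X p (c \<cdot>\<^sub>C v p)) f) \<rho> =
    blinfun_apply (if \<rho> \<in> ps_reps G P X then \<rho> p (c \<cdot>\<^sub>C v p) else 0) (slice f \<rho>)"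
  unfolding univ_ps_rep_def by (rule slice_dsum[OF norm_ps_reps])

lemma slice_S: "p \<in> P \<Longrightarrow> slice (blinfun_apply (S p) f) \<rho> =
    blinfun_apply (if \<rho> \<in> ps_reps G P X then \<rho> p (v p) else 0) (slice f \<rho>)"
  using slice_univ_ps_rep[of p 1] by simp

lemma univ_ps_rep_scale: "p \<in> P \<Longrightarrow> univ_ps_rep G P X p (c \<cdot>\<^sub>C v p) = c \<cdot>\<^sub>C S p"
  by (rule blinfun_eqI, rule slice_eqI) (simp add: slice_univ_ps_rep slice_S slice_scaleC
    ps_reps_scale)

lemma slice_adj_S: "p \<in> P \<Longrightarrow> slice (blinfun_apply (adj (S p)) f) \<rho> =
    blinfun_apply (if \<rho> \<in> ps_reps G P X then adj (\<rho> p (v p)) else 0) (slice f \<rho>)"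
proof -
  assume p: "p \<in> P"
  let ?T = "\<lambda>\<rho>. if \<rho> \<in> ps_reps G P X then \<rho> p (v p) else 0"
  have n: "norm (?T \<rho>) \<le> 1" for \<rho> :: "'a index_rep"
    using norm_ps_reps[OF p, of \<rho> 1] by (simp only: scale_op_one norm_one)
  have b: "?T \<rho> \<in> bops" for \<rho> :: "'a index_rep"
    using corner_repD(1)[OF ps_reps_corner, of \<rho>] p subspace_0[OF subspace_bops] by auto
  have n': "norm (adj (?T \<rho>)) \<le> 1" for \<rho> :: "'a index_rep"
    using norm_adj_le[OF b] n order_trans by blast
  have "adj (S p) = dsum (\<lambda>\<rho>. adj (?T \<rho>))"
    unfolding univ_ps_rep_def by (rule adj_dsum[OF n b])
  thus ?thesis using slice_dsum[of "\<lambda>\<rho>. adj (?T \<rho>)", OF n'] by (simp add: adj_zero)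
qed

lemma S_corner: "corner_rep G P S"
  unfolding corner_rep_def
proof (intro conjI ballI)
  show "S \<in> P \<rightarrow> bops"
  proof (rule Pi_I, rule bopsI, rule slice_eqI)
    fix p c and \<rho> :: "'a index_rep" and f :: "('a, 'a group_space) toeplitz_space" assume p: "p \<in> P"
    have "\<rho> p (v p) \<in> bops" if "\<rho> \<in> ps_reps G P X"
      using corner_repD(1)[OF ps_reps_corner[OF that]] p by blast
    thus "slice (blinfun_apply (S p) (c *\<^sub>C f)) \<rho> = slice (c *\<^sub>C blinfun_apply (S p) f) \<rho>"
      using p by (simp add: slice_S slice_scaleC bopsD)
  qed
  fix p assume p: "p \<in> P"
  show "adj (S p) o\<^sub>L S p = S \<one>"
  proof (rule blinfun_eqI, rule slice_eqI)
    fix f :: "('a, 'a group_space) toeplitz_space" and \<rho> :: "'a index_rep"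
    have "blinfun_apply (adj (\<rho> p (v p))) (blinfun_apply (\<rho> p (v p)) x) =
      blinfun_apply (\<rho> \<one> (v \<one>)) x"
      if "\<rho> \<in> ps_reps G P X" for x
      using arg_cong[OF corner_repD(3)[OF ps_reps_corner[OF that] p], of "\<lambda>T. blinfun_apply T x"]
        by simp
    thus "slice (blinfun_apply (adj (S p) o\<^sub>L S p) f) \<rho> = slice (blinfun_apply (S \<one>) f) \<rho>"
      using p by (simp add: slice_S slice_adj_S)
  qed
  fix q assume q: "q \<in> P"
  show "S (p \<otimes> q) = S p o\<^sub>L S q"
    by (rule blinfun_eqI, rule slice_eqI)
      (use p q in \<open>simp add: slice_S corner_repD(2)[OF ps_reps_corner]\<close>)
qed

lemma toeplitz_eq: "toeplitz G P X = cstar (S ` P)"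
  unfolding toeplitz_def using corner_repD(1)[OF S_corner]
    by (intro ps_cstar_eq univ_ps_rep_scale) auto

lemma toeplitz_span: "toeplitz G P X = closure (span (word_span S))"
  unfolding toeplitz_eq by (rule cstar_word_span[OF S_corner])

lemma cstar_algebra_toeplitz: "cstar_algebra (toeplitz G P X)"
  unfolding toeplitz_eq using corner_repD(1)[OF S_corner] by (intro cstar_algebra_cstar) auto

lemma S_bops: "p \<in> P \<Longrightarrow> S p \<in> bops"
  using corner_repD(1)[OF S_corner] by blast

lemma S_toeplitz: "p \<in> P \<Longrightarrow> S p \<in> toeplitz G P X"
  unfolding toeplitz_eq by (rule subsetD[OF cstar_superset]) blast

end

section \<open>The universal property of the Toeplitz algebra\<close>

lemma norm_slice_le: "norm (slice f s) \<le> norm f"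
proof -
  have "(\<Sum>s\<in>{s}. (norm (slice f s))\<^sup>2) \<le> (norm f)\<^sup>2"
    unfolding norm_slice(2) by (intro finite_sum_le_infsum norm_slice(1)) auto
  thus ?thesis by (simp add: power2_le_iff_abs_le)
qed

text \<open>Putting g into one summand and 0 into the others allows an operator on the direct sum to
  be tested on that summand without loss of norm.\<close>

lemma slice_extension:
  fixes r :: 'r and g :: "('i, 'h::complex_hilbert) ell2"
  obtains f :: "('r \<times> 'i, 'h) ell2" where "slice f r = g" "norm f = norm g"
proof -
  obtain J :: "('i, 'h) ell2 \<Rightarrow>\<^sub>L ('r \<times> 'i, 'h) ell2"
    where J: "\<And>i x. blinfun_apply J (single i x) = single (r, i) x"
    "\<And>c f. blinfun_apply J (c *\<^sub>C f) = c *\<^sub>C blinfun_apply J f"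
    by (rule ell2_blinfun_exists[of "\<lambda>i x. single (r, i) x" 1])
      (auto simp: single_add single_scaleC cinner_single)
  have bl: "bounded_linear (\<lambda>f :: ('r \<times> 'i, 'h) ell2. slice f s)" for s
  proof (rule bounded_linear_intro[of _ 1])
    show "norm (slice f s) \<le> norm f * 1" for f :: "('r \<times> 'i, 'h) ell2"
      using norm_slice_le[of f s] by simp
  qed (simp_all add: slice_add slice_scaleR)
  have sl: "slice (blinfun_apply J g) s = (if r = s then g else 0)" for s g
  proof -
    have "Blinfun (\<lambda>f. slice f s) o\<^sub>L J = (if r = s then id_blinfun else 0)"
      by (rule ell2_blinfun_eqI) (simp add: bounded_linear_Blinfun_apply bl J slice_single)
    from arg_cong[OF this, of "\<lambda>T. blinfun_apply T g"] show ?thesis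
      by (simp add: bounded_linear_Blinfun_apply bl)
  qed
  have "(norm (blinfun_apply J g))\<^sup>2 = (\<Sum>\<^sub>\<infinity>s\<in>{r}. (norm (slice (blinfun_apply J g) s))\<^sup>2)"
    unfolding norm_slice(2) by (rule infsum_cong_neutral) (auto simp: sl)
  hence "norm (blinfun_apply J g) = norm g" by (simp add: sl)
  thus ?thesis using sl[of g r] by (intro that[of "blinfun_apply J g"]) simp_all
qed

context semigroup_in_group
begin

text \<open>The prospective homomorphism as a relation. That linear dependencies among the words of
  the universal representation persist for w is not presupposed; it results from the norm
  bound.\<close>

definition hom_graph ::
  "('a \<Rightarrow> 'h::complex_hilbert op) \<Rightarrow> (('a, 'a group_space) toeplitz_space op \<times> 'h op) set"
  where "hom_graph w = span {(c \<cdot>\<^sub>C word_op S \<alpha>, c \<cdot>\<^sub>C word_op w \<alpha>) | c \<alpha>. \<alpha> \<in> words P}"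

text \<open>The cyclic subspace generated by a vector x embeds into the word space, whence w restricted
  to it is, up to a unitary, one of the summands of the universal representation.\<close>

lemma hom_graph_bound:
  fixes w :: "'a \<Rightarrow> 'h::complex_hilbert op"
  assumes w: "corner_rep G P w" and AB: "(A, B) \<in> hom_graph w"
  shows "norm B \<le> 1 * norm A"
proof (rule norm_blinfun_bound)
  fix x
  have wb: "w p \<in> bops" if "p \<in> P" for p using corner_repD(1)[OF w] that by blast
  \<comment> \<open>The flag selects the generator or its adjoint. The operator component of a
    letter is a dummy imposed by the index type of the universal representation, and letters outside
    P act as the identity to make m total.\<close>
  define m where "m l = foldr (\<lambda>((p, \<xi> :: 'a group_space op), b) y. if p \<in> P then
    (if b then blinfun_apply (w p) y else blinfun_apply (adj (w p)) y) else y) l x" for l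
  define C where "C = cspan (range m)"
  have C_inv: "blinfun_apply T y \<in> C" if T: "T \<in> bops" "\<And>l. \<exists>k. blinfun_apply T (m l) = m k"
    and y: "y \<in> C" for T y
  proof -
    have "C \<subseteq> {y. blinfun_apply T y \<in> C}" unfolding C_def
    proof (intro cspan_minimal subspace_vimage_blinfun closed_vimage_blinfun subspace_cspan
      closed_cspan)
      fix c a assume "a \<in> range m"
      then obtain l where a: "a = m l" by blast
      obtain k where "blinfun_apply T (m l) = m k" using T(2) by blast
      hence "blinfun_apply T (c *\<^sub>C a) = c *\<^sub>C m k" by (simp add: a bopsD[OF T(1)])
      thus "c *\<^sub>C a \<in> {y. blinfun_apply T y \<in> cspan (range m)}"
        by (simp add: cspan_scaleC cspan_superset)
    qed
    thus ?thesis using y by blast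
  qed
  have C1: "blinfun_apply (w p) y \<in> C" if "p \<in> P" "y \<in> C" for p y
  proof (rule C_inv[OF wb[OF that(1)] _ that(2)])
    show "\<exists>k. blinfun_apply (w p) (m l) = m k" for l
      using that(1) by (intro exI[of _ "((p, undefined), True) # l"]) (simp add: m_def)
  qed
  have C2: "blinfun_apply (adj (w p)) y \<in> C" if "p \<in> P" "y \<in> C" for p y
  proof (rule C_inv[OF adj_bops[OF wb[OF that(1)]] _ that(2)])
    show "\<exists>k. blinfun_apply (adj (w p)) (m l) = m k" for l
      using that(1) by (intro exI[of _ "((p, undefined), False) # l"]) (simp add: m_def)
  qed
  have xC: "x \<in> C"
    unfolding C_def by (rule cspan_superset) (rule range_eqI[of _ _ "[]"], simp add: m_def)
  obtain V :: "('a \<times> 'a group_space op) word_space \<Rightarrow>\<^sub>L 'h"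
    and U :: "'h \<Rightarrow>\<^sub>L ('a \<times> 'a group_space op) word_space"
    where V: "\<And>c f. blinfun_apply V (c *\<^sub>C f) = c *\<^sub>C blinfun_apply V f"
      and U: "\<And>c x. blinfun_apply U (c *\<^sub>C x) = c *\<^sub>C blinfun_apply U x"
      and UV: "\<And>x f. cinner (blinfun_apply U x) f = cinner x (blinfun_apply V f)"
      and VC: "\<And>f. blinfun_apply V f \<in> C"
      and VU: "\<And>x. x \<in> C \<Longrightarrow> blinfun_apply V (blinfun_apply U x) = x"
    unfolding C_def by (rule cyclic_embedding[of m]) blast
  have VU': "cinner (blinfun_apply V f) y = cinner f (blinfun_apply U y)" for f y
    using UV[of y f] cinner_commute[of "blinfun_apply V f" y] cinner_commute[of f
      "blinfun_apply U y"] by simp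
  have nU: "norm (blinfun_apply U y) = norm y" if "y \<in> C" for y
    by (rule norm_eqI_cinner) (simp only: UV VU[OF that])
  have nV: "norm (blinfun_apply V f) \<le> norm f" for f
  proof -
    have "(norm (blinfun_apply V f))\<^sup>2 = cmod (cinner (blinfun_apply V f) (blinfun_apply V f))"
      by (simp add: cinner_self norm_power)
    also have "\<dots> = cmod (cinner f (blinfun_apply U (blinfun_apply V f)))" by (simp only: VU')
    also have "\<dots> \<le> norm f * norm (blinfun_apply V f)"
      using cauchy_schwarz[of f "blinfun_apply U (blinfun_apply V f)"] by (simp only: nU[OF VC])
    finally show ?thesis by (cases "blinfun_apply V f = 0") (simp_all add: power2_eq_square)
  qed
  \<comment> \<open>The compression of w to C. As C is invariant under all \<open>w p\<close> and
    their adjoints and V inverts U there, the compression is again multiplicative and compatible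
    with adjoints.\<close>
  define r where "r p = U o\<^sub>L w p o\<^sub>L V" for p
  have rb: "r p \<in> bops" if "p \<in> P" for p
    using wb[OF that] by (intro bopsI) (simp add: r_def V U bopsD)
  have adj_r: "adj (r p) = U o\<^sub>L adj (w p) o\<^sub>L V" if "p \<in> P" for p
    by (rule adj_eqI) (simp add: r_def UV VU'[symmetric] cinner_adj[OF wb[OF that]])
  have r: "corner_rep G P r"
    unfolding corner_rep_def
  proof (intro conjI ballI)
    show "r \<in> P \<rightarrow> bops" using rb by blast
    fix p assume p: "p \<in> P"
    show "adj (r p) o\<^sub>L r p = r \<one>"
      unfolding adj_r[OF p]
      by (rule blinfun_eqI) (simp add: r_def VU C1[OF p VC] corner_repD(3)[OF w p, symmetric])
    fix q assume q: "q \<in> P"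
    show "r (p \<otimes> q) = r p o\<^sub>L r q"
      by (rule blinfun_eqI) (simp add: r_def VU C1[OF q VC] corner_repD(2)[OF w p q])
  qed
  \<comment> \<open>Since r acts on the word space itself, it yields an index of the direct sum, and
    the universal representation has it as a summand.\<close>
  define \<rho> where "\<rho> = ps_rep_of r"
  have \<rho>: "\<rho> \<in> ps_reps G P X" unfolding \<rho>_def by (rule ps_rep_of_ps_reps[OF r])
  have \<rho>v: "\<rho> p (v p) = r p" if "p \<in> P" for p unfolding \<rho>_def by (rule ps_rep_of_v[OF that])
  have s1: "blinfun_apply V (slice (blinfun_apply (S p) f) \<rho>) =
    blinfun_apply (w p) (blinfun_apply V (slice f \<rho>))"
    if "p \<in> P" for p f
    using that by (simp add: slice_S \<rho> \<rho>v r_def VU C1 VC)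
  have s2: "blinfun_apply V (slice (blinfun_apply (adj (S p)) f) \<rho>) =
    blinfun_apply (adj (w p)) (blinfun_apply V (slice f \<rho>))"
    if "p \<in> P" for p f
    using that by (simp add: slice_adj_S \<rho> \<rho>v adj_r VU C2 VC)
  have s3: "blinfun_apply V (slice (blinfun_apply (word_op S \<alpha>) f) \<rho>) =
    blinfun_apply (word_op w \<alpha>) (blinfun_apply V (slice f \<rho>))"
    if "set \<alpha> \<subseteq> P \<times> P" for \<alpha> f
    using that
  proof (induction \<alpha>)
    case (Cons a \<alpha>)
    obtain p q where a: "a = (p, q)" by (cases a)
    show ?case using Cons by (simp add: a s1 s2)
  qed simp
  \<comment> \<open>The intertwining relation between the two components of a pair is linear in the
    pair, so it passes from words to their span.\<close>
  let ?R = "{AB. \<forall>f. blinfun_apply V (slice (blinfun_apply (fst AB) f) \<rho>) =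
    blinfun_apply (snd AB) (blinfun_apply V (slice f \<rho>))}"
  have "hom_graph w \<subseteq> ?R" unfolding hom_graph_def
  proof (rule span_minimal)
    show "{(c \<cdot>\<^sub>C word_op S \<alpha>, c \<cdot>\<^sub>C word_op w \<alpha>) | c \<alpha>. \<alpha> \<in> words P} \<subseteq> ?R"
      by (auto simp: slice_scaleC V s3 words_def)
    have sl0: "slice 0 \<rho> = 0" using slice_scaleR[of 0 0 \<rho>] by simp
    show "subspace ?R" unfolding subspace_def
      by (intro conjI ballI allI)
        (simp_all add: blinfun.add_left blinfun.scaleR_left slice_add slice_scaleR
          blinfun.add_right blinfun.scaleR_right sl0)
  qed
  hence key: "blinfun_apply V (slice (blinfun_apply A f) \<rho>) =
    blinfun_apply B (blinfun_apply V (slice f \<rho>))" for f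
    using AB by auto
  \<comment> \<open>f lifts x to the universal space with the same norm; applying A to it then
    controls B at x.\<close>
  obtain f :: "('a, 'a group_space) toeplitz_space"
    where f: "slice f \<rho> = blinfun_apply U x" "norm f = norm (blinfun_apply U x)"
    by (rule slice_extension)
  have "blinfun_apply B x = blinfun_apply V (slice (blinfun_apply A f) \<rho>)"
    by (simp add: key f(1) VU[OF xC])
  hence "norm (blinfun_apply B x) \<le> norm (slice (blinfun_apply A f) \<rho>)" using nV by simp
  also have "\<dots> \<le> norm (blinfun_apply A f)" by (rule norm_slice_le)
  also have "\<dots> \<le> norm A * norm f" by (rule norm_blinfun)
  finally show "norm (blinfun_apply B x) \<le> 1 * norm A * norm x" by (simp add: f(2) nU[OF xC])
qed simp

text \<open>The closure of \<open>hom_graph w\<close> is the graph of a map on the whole Toeplitz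
  algebra. Each rule for a *-homomorphism says that this closure is stable under an operation on
  pairs, which has to be verified only for pairs of words.\<close>

lemma universal_hom:
  fixes w :: "'a \<Rightarrow> 'h::complex_hilbert op"
  assumes w: "corner_rep G P w"
  shows "\<exists>\<phi>. star_hom (toeplitz G P X) (cstar (w ` P)) \<phi> \<and> (\<forall>p\<in>P. \<phi> (S p) = w p)"
proof -
  let ?B = "{(c \<cdot>\<^sub>C word_op S \<alpha>, c \<cdot>\<^sub>C word_op w \<alpha>) | c \<alpha>. \<alpha> \<in> words P}"
  let ?\<Gamma> = "hom_graph w" and ?C = "closure (hom_graph w)"
  have wb: "w \<in> P \<rightarrow> bops" and Sb: "S \<in> P \<rightarrow> bops"
    by (rule corner_repD(1)[OF w], rule corner_repD(1)[OF S_corner])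
  have sub: "subspace ?\<Gamma>" unfolding hom_graph_def by (rule subspace_span)
  have subC: "subspace ?C" and clC: "closed ?C" by (intro subspace_closure sub) simp
  have C: "?C = closure (span ?B)" by (simp add: hom_graph_def)
  have BC: "(c \<cdot>\<^sub>C word_op S \<alpha>, c \<cdot>\<^sub>C word_op w \<alpha>) \<in> ?C" if "\<alpha> \<in> words P" for c \<alpha>
    unfolding C by (rule subsetD[OF closure_span_superset]) (use that in blast)
  have "fst ` ?\<Gamma> = span (fst ` ?B)"
    unfolding hom_graph_def by (rule linear_span_image[symmetric]) (rule bounded_linear.linear[OF
      bounded_linear_fst])
  also have "fst ` ?B = word_span S" unfolding word_span_def by force
  finally have dom: "closure (fst ` ?\<Gamma>) = toeplitz G P X" by (simp only: toeplitz_span)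
  define \<phi> where "\<phi> A = (THE B. (A, B) \<in> ?C)" for A
  have eqI: "\<phi> A = B" if "(A, B) \<in> ?C" for A B unfolding \<phi>_def
    using that graph_closure_unique[OF sub hom_graph_bound[OF w]] by (intro the_equality) auto
  have \<phi>C: "(A, \<phi> A) \<in> ?C" if "A \<in> toeplitz G P X" for A
  proof -
    have "\<exists>B. (A, B) \<in> ?C"
      by (rule graph_closure_exists[OF sub hom_graph_bound[OF w]]) (use that dom in simp_all)
    then obtain B where "(A, B) \<in> ?C" ..
    thus ?thesis using eqI by simp
  qed
  have cw: "cstar_algebra (cstar (w ` P))" using wb by (intro cstar_algebra_cstar) auto
  have "?C \<subseteq> {AB. snd AB \<in> cstar (w ` P)}" unfolding C
  proof (rule closure_span_minimal)
    show "subspace {AB :: ('a, 'a group_space) toeplitz_space op \<times> 'h op. snd AB \<in> cstar (w ` P)}"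
      using subspace_cstar_algebra[OF cw] by (auto simp: subspace_def)
    show "closed {AB :: ('a, 'a group_space) toeplitz_space op \<times> 'h op. snd AB \<in> cstar (w ` P)}"
      using closed_vimage[OF cstar_algebraD(3)[OF cw], of snd]
        by (simp add: vimage_def continuous_on_snd continuous_on_id)
    show "?B \<subseteq> {AB. snd AB \<in> cstar (w ` P)}"
      using cstar_algebraD(7)[OF cw word_op_cstar[OF wb cw cstar_superset]] by auto
  qed
  hence 1: "\<phi> \<in> toeplitz G P X \<rightarrow> cstar (w ` P)" using \<phi>C by fastforce
  have 2: "\<phi> (A + A') = \<phi> A + \<phi> A'" if "A \<in> toeplitz G P X" "A' \<in> toeplitz G P X" for A A'
    using subspace_add[OF subC \<phi>C[OF that(1)] \<phi>C[OF that(2)]] by (intro eqI) simp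
  have 3: "\<phi> (A o\<^sub>L A') = \<phi> A o\<^sub>L \<phi> A'" if "A \<in> toeplitz G P X" "A' \<in> toeplitz G P X" for A A'
  proof (rule eqI)
    let ?f = "\<lambda>y z :: ('a, 'a group_space) toeplitz_space op \<times> 'h op. (fst y o\<^sub>L fst z, snd y o\<^sub>L
      snd z)"
    have "?f (A, \<phi> A) (A', \<phi> A') \<in> ?C"
    proof (rule closure_span_bilinear[of ?f ?C ?B ?B])
      show "bounded_linear (\<lambda>y. ?f y z)" for z
        by (intro bounded_linear_Pair bounded_linear_compose[OF bounded_linear_comp_left]
            bounded_linear_fst bounded_linear_snd)
      show "bounded_linear (?f y)" for y
        by (intro bounded_linear_Pair bounded_linear_compose[OF bounded_linear_comp_right]
            bounded_linear_fst bounded_linear_snd)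
      fix y z assume "y \<in> ?B" "z \<in> ?B"
      then obtain c d \<alpha> \<beta> where yz: "y = (c \<cdot>\<^sub>C word_op S \<alpha>, c \<cdot>\<^sub>C word_op w \<alpha>)" "\<alpha> \<in> words P"
        "z = (d \<cdot>\<^sub>C word_op S \<beta>, d \<cdot>\<^sub>C word_op w \<beta>)" "\<beta> \<in> words P" by blast
      have "?f y z = ((c * d) \<cdot>\<^sub>C word_op S (\<alpha> @ \<beta>), (c * d) \<cdot>\<^sub>C word_op w (\<alpha> @ \<beta>))"
        using yz(2) unfolding yz(1,3) by (simp add: scale_comp words_bops[OF wb] words_bops[OF Sb]
          word_op_append)
      thus "?f y z \<in> ?C" using BC words_append[OF yz(2,4)] by simp
    qed (use subC clC \<phi>C[OF that(1)] \<phi>C[OF that(2)] C in auto)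
    thus "(A o\<^sub>L A', \<phi> A o\<^sub>L \<phi> A') \<in> ?C" by simp
  qed
  have 4: "\<phi> (c \<cdot>\<^sub>C A) = c \<cdot>\<^sub>C \<phi> A" if "A \<in> toeplitz G P X" for c A
  proof (rule eqI)
    let ?f = "\<lambda>y :: ('a, 'a group_space) toeplitz_space op \<times> 'h op. (c \<cdot>\<^sub>C fst y, c \<cdot>\<^sub>C snd y)"
    have "?f (A, \<phi> A) \<in> ?C"
    proof (rule closure_span_linear[of ?f ?C ?B])
      show "bounded_linear ?f"
        by (intro bounded_linear_Pair bounded_linear_compose[OF bounded_linear_scale_op]
            bounded_linear_fst bounded_linear_snd)
      show "?f y \<in> ?C" if "y \<in> ?B" for y
        using that BC by (auto simp: scale_op_scale_op)
    qed (use subC clC \<phi>C[OF that] C in auto)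
    thus "(c \<cdot>\<^sub>C A, c \<cdot>\<^sub>C \<phi> A) \<in> ?C" by simp
  qed
  have 5: "\<phi> (adj A) = adj (\<phi> A)" if "A \<in> toeplitz G P X" for A
  proof (rule eqI)
    \<comment> \<open>Taking adjoints is not complex linear, so the pairs whose adjoint pair lies in
      the closure are shown to form a closed subspace by hand.\<close>
    let ?D = "{y :: ('a, 'a group_space) toeplitz_space op \<times> 'h op.
      fst y \<in> bops \<and> snd y \<in> bops \<and> (adj (fst y), adj (snd y)) \<in> ?C}"
    have "closure (span ?B) \<subseteq> ?D"
    proof (rule closure_span_minimal)
      show "subspace ?D"
        unfolding subspace_def
      proof (intro conjI ballI allI)
        show "0 \<in> ?D" using subspace_0[OF subC]
          by (simp add: adj_zero zero_prod_def subspace_0[OF subspace_bops])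
        show "y + z \<in> ?D" if "y \<in> ?D" "z \<in> ?D" for y z
          using that subspace_add[OF subC, of "(adj (fst y), adj (snd y))"
            "(adj (fst z), adj (snd z))"]
          by (auto simp: adj_add intro: subspace_add[OF subspace_bops])
        show "c *\<^sub>R y \<in> ?D" if "y \<in> ?D" for c y
          using that subspace_scale[OF subC, of "(adj (fst y), adj (snd y))" c]
            adj_scale[of "fst y" "complex_of_real c"] adj_scale[of "snd y" "complex_of_real c"]
          by (auto simp: scale_op_of_real intro: subspace_scale[OF subspace_bops])
      qed
      show "closed ?D" unfolding closed_sequential_limits
      proof (intro allI impI, elim conjE)
        fix Y z assume Y: "\<forall>n. Y n \<in> ?D" "Y \<longlonglongrightarrow> z"
        have f: "(\<lambda>n. fst (Y n)) \<longlonglongrightarrow> fst z" and s: "(\<lambda>n. snd (Y n)) \<longlonglongrightarrow> snd z"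
          by (rule tendsto_fst[OF Y(2)], rule tendsto_snd[OF Y(2)])
        have "(\<lambda>n. (adj (fst (Y n)), adj (snd (Y n)))) \<longlonglongrightarrow> (adj (fst z), adj (snd z))"
          by (intro tendsto_Pair tendsto_adj f s) (use Y(1) in auto)
        hence "(adj (fst z), adj (snd z)) \<in> ?C"
          by (rule closed_sequentially[OF clC, rotated]) (use Y(1) in auto)
        moreover have "fst z \<in> bops" by (rule closed_sequentially[OF closed_bops _ f]) (use Y(1) in
          auto)
        moreover have "snd z \<in> bops" by (rule closed_sequentially[OF closed_bops _ s]) (use Y(1) in
          auto)
        ultimately show "z \<in> ?D" by simp
      qed
      show "?B \<subseteq> ?D"
      proof
        fix y assume "y \<in> ?B"
        then obtain c \<alpha> where y: "y = (c \<cdot>\<^sub>C word_op S \<alpha>, c \<cdot>\<^sub>C word_op w \<alpha>)" and \<alpha>: "\<alpha> \<in> words P"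
          by blast
        have b: "word_op S \<alpha> \<in> bops" "word_op w \<alpha> \<in> bops"
          by (rule words_bops[OF Sb \<alpha>], rule words_bops[OF wb \<alpha>])
        show "y \<in> ?D" using BC[OF words_reverse[OF \<alpha>], of "cnj c"]
          by (simp add: y scale_bops b adj_scale words_adj[OF wb \<alpha>] words_adj[OF Sb \<alpha>])
      qed
    qed
    hence "(A, \<phi> A) \<in> ?D" using \<phi>C[OF that] unfolding C by (rule subsetD)
    thus "(adj A, adj (\<phi> A)) \<in> ?C" by simp
  qed
  have "\<phi> (S p) = w p" if "p \<in> P" for p
  proof (rule eqI)
    have "[(\<one>, p)] \<in> words P" using that by (simp add: words_def)
    from BC[OF this, of 1] show "(S p, w p) \<in> ?C"
      by (simp only: scale_op_one word_op_single[OF w that] word_op_single[OF S_corner that])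
  qed
  thus ?thesis unfolding star_hom_def using 1 2 3 4 5 by (intro exI[of _ \<phi>]) simp
qed

end

section \<open>Automatic continuity\<close>

lemma closed_self_adjoint: "closed {T \<in> bops. adj T = (T :: 'h::complex_hilbert op)}"
  unfolding closed_sequential_limits
proof (intro allI impI, elim conjE)
  fix Y and T :: "'h op" assume Y: "\<forall>n. Y n \<in> {T \<in> bops. adj T = T}" "Y \<longlonglongrightarrow> T"
  have T: "T \<in> bops" by (rule closed_sequentially[OF closed_bops _ Y(2)]) (use Y(1) in auto)
  have "(\<lambda>n. adj (Y n)) \<longlonglongrightarrow> adj T" by (rule tendsto_adj[OF _ Y(2)]) (use Y(1) in auto)
  hence "Y \<longlonglongrightarrow> adj T" using Y(1) by simp
  hence "adj T = T" by (rule LIMSEQ_unique[OF _ Y(2)])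
  thus "T \<in> {T \<in> bops. adj T = T}" using T by simp
qed

text \<open>The element b below is 1 - sqrt (1 - a a), found as a fixed point in order to avoid both
  power series and a unit.\<close>

lemma contraction_root:
  fixes a :: "'h::complex_hilbert op"
  assumes A: "cstar_algebra A" and a: "a \<in> A" "adj a = a" "norm a \<le> 1/2"
  shows "\<exists>b\<in>A. adj b = b \<and> (a o\<^sub>L a) = 2 *\<^sub>R b - (b o\<^sub>L b)"
proof -
  note AD = cstar_algebraD[OF A]
  \<comment> \<open>The radius fits both requirements: the map f sends the ball of radius 1/4 into
    itself because \<open>norm a\<close> is at most 1/2, and it contracts there by the factor
    1/4.\<close>
  define s where "s = A \<inter> {T \<in> bops. adj T = T} \<inter> cball 0 (1/4)"
  define f where "f b = (1/2) *\<^sub>R ((a o\<^sub>L a) + (b o\<^sub>L b))" for b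
  have sR: "r *\<^sub>R T \<in> A" if "T \<in> A" for r T
    by (rule subspace_scale[OF subspace_cstar_algebra[OF A] that])
  have "\<exists>!b. b \<in> s \<and> f b = b"
  proof (rule Banach_fix[of s "1/4"])
    show "complete s"
      unfolding s_def complete_eq_closed by (intro closed_Int AD(3) closed_self_adjoint
        closed_cball)
    have "0 \<in> s" unfolding s_def using AD(2) subspace_0[OF subspace_bops] by (simp add: adj_zero)
    thus "s \<noteq> {}" by blast
    show "f ` s \<subseteq> s"
    proof (rule image_subsetI)
      fix b assume b: "b \<in> s"
      hence b': "b \<in> A" "adj b = b" "norm b \<le> 1/4" by (auto simp: s_def)
      have ab: "a \<in> bops" "b \<in> bops" using AD(1) a b' by auto
      have "f b \<in> A" unfolding f_def by (intro sR AD(4,5) a b')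
      moreover have "adj (f b) = f b"
        using adj_scale[of "(a o\<^sub>L a) + (b o\<^sub>L b)" "complex_of_real (1/2)"] ab
        unfolding f_def scale_op_of_real[symmetric]
        by (simp add: adj_add adj_comp comp_bops a b' subspace_add[OF subspace_bops])
      moreover have "norm (f b) \<le> 1/4"
      proof -
        have "norm (a o\<^sub>L a) \<le> 1/2 * (1/2)"
          by (rule order_trans[OF norm_blinfun_compose]) (intro mult_mono a, simp_all)
        moreover have "norm (b o\<^sub>L b) \<le> 1/4 * (1/4)"
          by (rule order_trans[OF norm_blinfun_compose]) (intro mult_mono b', simp_all)
        ultimately have "norm ((a o\<^sub>L a) + (b o\<^sub>L b)) \<le> 1/2"
          using norm_triangle_ineq[of "a o\<^sub>L a" "b o\<^sub>L b"] by linarith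
        thus ?thesis by (simp add: f_def)
      qed
      moreover have "f b \<in> bops" using \<open>f b \<in> A\<close> AD(1) by blast
      ultimately show "f b \<in> s" by (simp add: s_def)
    qed
    fix b c assume "b \<in> s" "c \<in> s"
    hence bc: "norm b \<le> 1/4" "norm c \<le> 1/4" by (auto simp: s_def)
    have "f b - f c = (1/2) *\<^sub>R ((b o\<^sub>L (b - c)) + ((b - c) o\<^sub>L c))"
      by (rule blinfun_eqI) (simp add: f_def blinfun.add_left blinfun.diff_left blinfun.scaleR_left
        blinfun.diff_right algebra_simps)
    moreover have "norm (b o\<^sub>L (b - c)) \<le> 1/4 * norm (b - c)"
      "norm ((b - c) o\<^sub>L c) \<le> norm (b - c) * (1/4)"
      by (rule order_trans[OF norm_blinfun_compose], intro mult_right_mono mult_left_mono bc, simp)+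
    ultimately show "dist (f b) (f c) \<le> 1/4 * dist b c"
      using norm_triangle_ineq[of "b o\<^sub>L (b - c)" "(b - c) o\<^sub>L c"] by (simp add: dist_norm)
  qed simp_all
  then obtain b where b: "b \<in> s" "f b = b" by blast
  have "2 *\<^sub>R f b = (a o\<^sub>L a) + (b o\<^sub>L b)" by (simp add: f_def)
  hence "(a o\<^sub>L a) = 2 *\<^sub>R b - (b o\<^sub>L b)" by (simp add: b(2))
  thus ?thesis using b(1) by (auto simp: s_def)
qed

text \<open>A substitute for spectral theory. If a is self-adjoint of norm at most 1/2 and
  \<open>a a = 2 b - b b\<close>, then \<open>(norm (x - \<Psi> b x))^2\<close> equals
  \<open>(norm x)^2 - (norm (\<Psi> a x))^2\<close>, so \<open>\<Psi> a\<close> does not increase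
  norms; rescaling to norm 1/2 produces the factor 2, and a general a is reduced to
  \<open>adj a\<close> times a. The values of \<open>\<Psi>\<close> are plain maps on a set D, as
  for an abstract Fock homomorphism nothing more is known in advance.\<close>

lemma star_action_bound:
  fixes \<Psi> :: "'h::complex_hilbert op \<Rightarrow> 'k::complex_hilbert \<Rightarrow> 'k"
  assumes A: "cstar_algebra A" and D: "\<And>a x. a \<in> A \<Longrightarrow> x \<in> D \<Longrightarrow> \<Psi> a x \<in> D"
    and add: "\<And>a b x. a \<in> A \<Longrightarrow> b \<in> A \<Longrightarrow> x \<in> D \<Longrightarrow> \<Psi> (a + b) x = \<Psi> a x + \<Psi> b x"
    and sc: "\<And>a c x. a \<in> A \<Longrightarrow> x \<in> D \<Longrightarrow> \<Psi> (c \<cdot>\<^sub>C a) x = c *\<^sub>C \<Psi> a x"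
    and comp: "\<And>a b x. a \<in> A \<Longrightarrow> b \<in> A \<Longrightarrow> x \<in> D \<Longrightarrow> \<Psi> (a o\<^sub>L b) x = \<Psi> a (\<Psi> b x)"
    and adj: "\<And>a x y. a \<in> A \<Longrightarrow> x \<in> D \<Longrightarrow> y \<in> D \<Longrightarrow> cinner (\<Psi> (adj a) x) y = cinner x (\<Psi> a y)"
    and a: "a \<in> A" and x: "x \<in> D"
  shows "norm (\<Psi> a x) \<le> 2 * norm a * norm x"
proof -
  note AD = cstar_algebraD[OF A]
  have scR: "\<Psi> (r *\<^sub>R a) x = r *\<^sub>R \<Psi> a x" if "a \<in> A" "x \<in> D" for r a x
    using sc[OF that, of "complex_of_real r"] by (simp add: scale_op_of_real scaleC_of_real)
  have sR: "r *\<^sub>R T \<in> A" if "T \<in> A" for r T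
    by (rule subspace_scale[OF subspace_cstar_algebra[OF A] that])
  have contr: "norm (\<Psi> a x) \<le> norm x" if a: "a \<in> A" "adj a = a" "norm a \<le> 1/2" and x: "x \<in> D"
    for a x
  proof -
    obtain b where b: "b \<in> A" "adj b = b" "(a o\<^sub>L a) = 2 *\<^sub>R b - (b o\<^sub>L b)"
      using contraction_root[OF A a] by blast
    have bb: "b o\<^sub>L b \<in> A" by (rule AD(5)[OF b(1) b(1)])
    have "(a o\<^sub>L a) + (b o\<^sub>L b) = 2 *\<^sub>R b" by (simp only: b(3) diff_add_cancel)
    hence "\<Psi> (2 *\<^sub>R b) x = \<Psi> a (\<Psi> a x) + \<Psi> b (\<Psi> b x)"
      using add[OF AD(5)[OF a(1) a(1)] bb x] comp[OF a(1) a(1) x] comp[OF b(1) b(1) x] by simp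
    hence eq: "2 *\<^sub>R \<Psi> b x = \<Psi> a (\<Psi> a x) + \<Psi> b (\<Psi> b x)" using scR[OF b(1) x] by simp
    have na: "cinner (\<Psi> a x) (\<Psi> a x) = cinner x (\<Psi> a (\<Psi> a x))"
      using adj[OF a(1) x D[OF a(1) x]] by (simp only: a(2))
    have nb: "cinner (\<Psi> b x) (\<Psi> b x) = cinner x (\<Psi> b (\<Psi> b x))"
      using adj[OF b(1) x D[OF b(1) x]] by (simp only: b(2))
    have "cinner x (2 *\<^sub>R \<Psi> b x) = cinner (\<Psi> a x) (\<Psi> a x) + cinner (\<Psi> b x) (\<Psi> b x)"
      by (simp only: eq cinner_add_right na nb)
    hence "2 * Re (cinner x (\<Psi> b x)) = (norm (\<Psi> a x))\<^sup>2 + (norm (\<Psi> b x))\<^sup>2"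
      by (simp add: cinner_scaleR_right cinner_self complex_eq_iff)
    moreover have "(norm (x - \<Psi> b x))\<^sup>2 = (norm x)\<^sup>2 - 2 * Re (cinner x (\<Psi> b x)) + (norm (\<Psi> b x))\<^sup>2"
      using norm_add_sq[of x "- \<Psi> b x"] cinner_diff_right[of x 0 "\<Psi> b x"] by simp
    moreover have "0 \<le> (norm (x - \<Psi> b x))\<^sup>2" by simp
    ultimately have "(norm (\<Psi> a x))\<^sup>2 \<le> (norm x)\<^sup>2" by linarith
    thus ?thesis by (rule power2_le_imp_le) simp
  qed
  have sa: "norm (\<Psi> a x) \<le> 2 * norm a * norm x" if a: "a \<in> A" "adj a = a" and x: "x \<in> D" for a x
  proof (cases "a = 0")
    case True
    thus ?thesis using scR[OF AD(2) x, of 0] by simp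
  next
    case False
    let ?r = "inverse (2 * norm a)"
    have ab: "a \<in> bops" using AD(1) a by blast
    have "adj (?r *\<^sub>R a) = ?r *\<^sub>R a"
      using adj_scale[OF ab, of "complex_of_real ?r"]
        unfolding complex_cnj_complex_of_real scale_op_of_real a(2) .
    moreover have "norm (?r *\<^sub>R a) \<le> 1/2" using False by simp
    ultimately have "norm (\<Psi> (?r *\<^sub>R a) x) \<le> norm x" using sR[OF a(1)] x by (intro contr)
    hence "?r * norm (\<Psi> a x) \<le> norm x" by (simp add: scR[OF a(1) x])
    thus ?thesis using False by (simp add: field_simps)
  qed
  have ab: "a \<in> bops" "adj a \<in> A" using AD(1,6) a by auto
  let ?c = "adj a o\<^sub>L a"
  have c: "?c \<in> A" "adj ?c = ?c"
    using AD(5)[OF ab(2) a] ab(1) by (simp_all add: adj_comp adj_adj adj_bops)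
  have "(norm (\<Psi> a x))\<^sup>2 = cmod (cinner (\<Psi> a x) (\<Psi> a x))" by (simp add: cinner_self norm_power)
  also have "cinner (\<Psi> a x) (\<Psi> a x) = cinner x (\<Psi> ?c x)"
    using adj[OF ab(2) x D[OF a x]] by (simp add: adj_adj ab comp a x)
  also have "cmod \<dots> \<le> norm x * (2 * norm ?c * norm x)"
    by (rule order_trans[OF cauchy_schwarz]) (intro mult_left_mono sa c x, simp)
  also have "\<dots> \<le> norm x * (2 * (norm a * norm a) * norm x)"
    by (intro mult_left_mono mult_right_mono order_trans[OF norm_blinfun_compose] norm_adj_le ab)
      simp_all
  also have "\<dots> \<le> (2 * norm a * norm x)\<^sup>2" by (simp add: power2_eq_square mult_ac)
  finally show ?thesis by (rule power2_le_imp_le) simp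
qed

lemma star_homD:
  assumes "star_hom A B \<phi>"
  shows "\<And>T. T \<in> A \<Longrightarrow> \<phi> T \<in> B" "\<And>S T. S \<in> A \<Longrightarrow> T \<in> A \<Longrightarrow> \<phi> (S + T) = \<phi> S + \<phi> T"
    "\<And>S T. S \<in> A \<Longrightarrow> T \<in> A \<Longrightarrow> \<phi> (S o\<^sub>L T) = \<phi> S o\<^sub>L \<phi> T"
    "\<And>T. T \<in> A \<Longrightarrow> \<phi> (adj T) = adj (\<phi> T)" "\<And>c T. T \<in> A \<Longrightarrow> \<phi> (c \<cdot>\<^sub>C T) = c \<cdot>\<^sub>C \<phi> T"
  using assms unfolding star_hom_def by blast+

lemma star_hom_norm:
  assumes h: "star_hom A B \<phi>" and A: "cstar_algebra A" and B: "B \<subseteq> bops" and a: "a \<in> A"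
  shows "norm (\<phi> a) \<le> 2 * norm a"
proof (rule norm_blinfun_bound)
  note hD = star_homD[OF h]
  show "norm (blinfun_apply (\<phi> a) x) \<le> 2 * norm a * norm x" for x
  proof (rule star_action_bound[OF A, of UNIV "\<lambda>a. blinfun_apply (\<phi> a)"])
    show "cinner (blinfun_apply (\<phi> (adj a)) x) y = cinner x (blinfun_apply (\<phi> a) y)" if "a \<in> A"
      for a x y
      using hD(1)[OF that] B by (simp add: hD(4)[OF that] cinner_adj subsetD)
  qed (simp_all add: hD a blinfun.add_left)
qed simp

text \<open>The analogue of \<open>closure_span_linear\<close> for a homomorphism that is known to
  be linear and bounded only on A and not on all operators.\<close>

lemma star_hom_closure_span:
  assumes h: "star_hom A B \<phi>" and A: "cstar_algebra A" and B: "B \<subseteq> bops"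
    and Y: "A = closure (span Y)"
    and C: "subspace C" "closed C" and YC: "\<And>x. x \<in> Y \<Longrightarrow> \<phi> x \<in> C" and a: "a \<in> A"
  shows "\<phi> a \<in> C"
proof -
  note hD = star_homD[OF h] and AD = cstar_algebraD[OF A]
  have scR: "\<phi> (r *\<^sub>R T) = r *\<^sub>R \<phi> T" if "T \<in> A" for r T
    using hD(5)[OF that, of "complex_of_real r"] by (simp add: scale_op_of_real)
  have sub: "subspace A" by (rule subspace_cstar_algebra[OF A])
  have "span Y \<subseteq> {x \<in> A. \<phi> x \<in> C}"
  proof (rule span_minimal)
    show "Y \<subseteq> {x \<in> A. \<phi> x \<in> C}" using YC closure_span_superset[of Y] Y by auto
    have "\<phi> 0 = 0" using scR[OF AD(2), of 0] by simp
    thus "subspace {x \<in> A. \<phi> x \<in> C}"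
      by (intro subspaceI)
        (simp_all add: hD(2) scR AD(2) subspace_0[OF C(1)] subspace_add[OF sub] subspace_add[OF
          C(1)]
          subspace_scale[OF sub] subspace_scale[OF C(1)])
  qed
  moreover obtain Z where Z: "\<forall>n. Z n \<in> span Y" "Z \<longlonglongrightarrow> a"
    using a unfolding Y closure_sequential by blast
  ultimately have "\<forall>n. Z n \<in> A \<and> \<phi> (Z n) \<in> C" by blast
  hence ZA: "Z n \<in> A" "\<phi> (Z n) \<in> C" for n by simp_all
  have le: "norm (\<phi> (Z n) - \<phi> a) \<le> 2 * norm (Z n - a)" for n
  proof -
    have "Z n - a \<in> A" by (rule subspace_diff[OF sub ZA(1) a])
    moreover have "\<phi> ((Z n - a) + a) = \<phi> (Z n - a) + \<phi> a" by (rule hD(2)) fact+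
    ultimately show ?thesis using star_hom_norm[OF h A B, of "Z n - a"] by simp
  qed
  have "(\<lambda>n. 2 * norm (Z n - a)) \<longlonglongrightarrow> 0"
    by (rule tendsto_mult_right_zero[OF tendsto_norm_zero[OF LIM_zero[OF Z(2)]]])
  hence "(\<lambda>n. \<phi> (Z n) - \<phi> a) \<longlonglongrightarrow> 0"
    by (rule Lim_null_comparison[rotated]) (simp add: le)
  hence "(\<lambda>n. \<phi> (Z n)) \<longlonglongrightarrow> \<phi> a" by (simp add: LIM_zero_cancel)
  thus ?thesis by (rule closed_sequentially[OF C(2), rotated]) (rule ZA(2))
qed

lemma min_tensor_bops:
  assumes "A \<subseteq> bops" "B \<subseteq> bops" shows "min_tensor A B \<subseteq> bops"
  unfolding min_tensor_def
  by (rule closure_span_minimal[OF subspace_bops closed_bops]) (use assms in \<open>auto intro!: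
    tensor_op_bops\<close>)

lemma tensor_op_min_tensor: "S \<in> A \<Longrightarrow> T \<in> B \<Longrightarrow> S \<otimes>\<^sub>C T \<in> min_tensor A B"
  unfolding min_tensor_def by (rule subsetD[OF closure_span_superset]) blast

lemma word_op_cong: "(\<And>p. p \<in> P \<Longrightarrow> w p = w' p) \<Longrightarrow> set \<alpha> \<subseteq> P \<times> P \<Longrightarrow> word_op w \<alpha> = word_op w' \<alpha>"
  by (induction \<alpha>) auto

lemma star_hom_word:
  assumes h: "star_hom A B \<phi>" and A: "cstar_algebra A" "w ` P \<subseteq> A" and "\<alpha> \<in> words P"
  shows "word_op w \<alpha> \<in> A \<and> \<phi> (word_op w \<alpha>) = word_op (\<lambda>p. \<phi> (w p)) \<alpha>"
  using assms(4)
proof (induction \<alpha>)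
  case (Cons a \<alpha>)
  note hD = star_homD[OF h] and AD = cstar_algebraD[OF A(1)]
  obtain p q where a: "a = (p, q)" by (cases a)
  have pq: "w p \<in> A" "w q \<in> A" using Cons.prems A(2) by (auto simp: a words_def)
  have *: "adj (w p) o\<^sub>L w q \<in> A" "\<phi> (adj (w p) o\<^sub>L w q) = adj (\<phi> (w p)) o\<^sub>L \<phi> (w q)"
    using pq by (auto intro!: AD simp: hD(3)[OF AD(6)] hD(4))
  show ?case
  proof (cases "\<alpha> = []")
    case True
    thus ?thesis using * by (simp add: a compose_id)
  next
    case False
    hence IH: "word_op w \<alpha> \<in> A" "\<phi> (word_op w \<alpha>) = word_op (\<lambda>p. \<phi> (w p)) \<alpha>"
      using Cons by (auto simp: words_def)
    show ?thesis using * IH AD(5)[OF *(1) IH(1)] by (simp add: a hD(3)[OF *(1) IH(1)])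
  qed
qed (simp add: words_def)

section \<open>The coaction and its fixed point algebra\<close>

context semigroup_in_group
begin

lemma word_val_carrier: "set \<alpha> \<subseteq> P \<times> P \<Longrightarrow> word_val G \<alpha> \<in> carrier G"
  by (induction \<alpha>) (auto simp: P_carrier)

lemma group_cstar_bops: "group_cstar G \<subseteq> bops"
proof -
  have "cstar_algebra (group_cstar G)" unfolding group_cstar_def
    by (rule cstar_algebra_cstar) (auto intro: group_unitary_bops)
  thus ?thesis by (rule cstar_algebraD)
qed

lemma group_unitary_group_cstar: "g \<in> carrier G \<Longrightarrow> group_unitary G g \<in> group_cstar G"
  unfolding group_cstar_def by (rule subsetD[OF cstar_superset]) simp

text \<open>In the second leg a starred letter is an inverse group element, so the word collapses
  there to its value in G.\<close>

lemma word_op_tensor: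
  fixes w :: "'a \<Rightarrow> 'h::complex_hilbert op"
  assumes w: "w \<in> P \<rightarrow> bops" and "set \<alpha> \<subseteq> P \<times> P"
  shows "word_op (\<lambda>p. w p \<otimes>\<^sub>C group_unitary G p) \<alpha> = word_op w \<alpha> \<otimes>\<^sub>C group_unitary G (word_val G \<alpha>)"
  using assms(2)
proof (induction \<alpha>)
  case Nil
  have "(id_blinfun :: 'h op) \<otimes>\<^sub>C (id_blinfun :: 'a group_space op) = id_blinfun"
    by (rule tensor_op_eqI) (simp_all add: id_bops)
  thus ?case by (simp add: group_unitary_one)
next
  case (Cons a \<alpha>)
  obtain p q where a: "a = (p, q)" by (cases a)
  have pq: "p \<in> P" "q \<in> P" and \<alpha>: "set \<alpha> \<subseteq> P \<times> P" using Cons.prems by (auto simp: a)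
  have b: "w p \<in> bops" "w q \<in> bops" "word_op w \<alpha> \<in> bops"
    using w pq word_op_bops[OF w \<alpha>] by auto
  have u: "group_unitary G p \<in> bops" "group_unitary G q \<in> bops" "group_unitary G (inv p) \<in> bops"
    "group_unitary G (word_val G \<alpha>) \<in> bops"
    using pq word_val_carrier[OF \<alpha>] by (auto intro!: group_unitary_bops simp: P_carrier)
  show ?case using Cons.IH[OF \<alpha>] pq word_val_carrier[OF \<alpha>]
    by (simp add: a adj_tensor_op b u adj_group_unitary P_carrier tensor_op_comp adj_bops comp_bops
        group_unitary_mult)
qed

lemma corner_rep_tensor:
  assumes w: "corner_rep G P w"
  shows "corner_rep G P (\<lambda>p. w p \<otimes>\<^sub>C group_unitary G p)"
proof -
  have b: "w p \<in> bops" if "p \<in> P" for p using corner_repD(1)[OF w] that by blast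
  show ?thesis unfolding corner_rep_def
    by (auto simp: tensor_op_bops b group_unitary_bops P_carrier adj_tensor_op tensor_op_comp
      adj_bops
        adj_group_unitary corner_repD(2,3)[OF w] group_unitary_mult[symmetric])
qed

lemma neutral_iff: "\<alpha> \<in> neutral_words G P \<longleftrightarrow> \<alpha> \<in> words P \<and> word_val G \<alpha> = \<one>"
  by (auto simp: neutral_words_def words_def)

text \<open>The tensor products \<open>S p\<close> with \<open>u_p\<close> satisfy the relations of
  \<open>corner_rep\<close>, so the universal property provides the map. Its range lies in the
  minimal tensor product because each of its words is an elementary tensor.\<close>

lemma coaction_exists: "\<exists>\<delta>. coaction G P X (univ_ps_rep G P X) \<delta>"
proof -
  let ?w = "\<lambda>p. S p \<otimes>\<^sub>C group_unitary G p"
  have w: "corner_rep G P ?w" by (rule corner_rep_tensor[OF S_corner])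
  have Sb: "S \<in> P \<rightarrow> bops" by (rule corner_repD(1)[OF S_corner])
  obtain \<delta> where \<delta>: "star_hom (toeplitz G P X) (cstar (?w ` P)) \<delta>" "\<forall>p\<in>P. \<delta> (S p) = ?w p"
    using universal_hom[OF w] by blast
  have "cstar (?w ` P) \<subseteq> min_tensor (toeplitz G P X) (group_cstar G)"
    unfolding cstar_word_span[OF w]
  proof (rule closure_span_minimal)
    show "subspace (min_tensor (toeplitz G P X) (group_cstar G))"
      unfolding min_tensor_def by (intro subspace_closure subspace_span)
    show "closed (min_tensor (toeplitz G P X) (group_cstar G))" unfolding min_tensor_def by simp
    show "word_span ?w \<subseteq> min_tensor (toeplitz G P X) (group_cstar G)"
    proof
      fix T assume "T \<in> word_span ?w"
      then obtain c \<alpha> where T: "T = c \<cdot>\<^sub>C word_op ?w \<alpha>" and \<alpha>: "\<alpha> \<in> words P"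
        unfolding word_span_def by blast
      have \<alpha>': "set \<alpha> \<subseteq> P \<times> P" using \<alpha> by (simp add: words_def)
      have "T = (c \<cdot>\<^sub>C word_op S \<alpha>) \<otimes>\<^sub>C group_unitary G (word_val G \<alpha>)"
        by (simp add: T word_op_tensor[OF Sb \<alpha>'] tensor_op_scale words_bops[OF Sb \<alpha>]
          group_unitary_bops word_val_carrier[OF \<alpha>'])
      moreover have "c \<cdot>\<^sub>C word_op S \<alpha> \<in> toeplitz G P X"
        unfolding toeplitz_span by (rule subsetD[OF closure_span_superset word_spanI[OF \<alpha>]])
      ultimately show "T \<in> min_tensor (toeplitz G P X) (group_cstar G)"
        by (simp add: tensor_op_min_tensor group_unitary_group_cstar word_val_carrier[OF \<alpha>'])
    qed
  qed
  hence "star_hom (toeplitz G P X) (min_tensor (toeplitz G P X) (group_cstar G)) \<delta>"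
    using \<delta>(1) unfolding star_hom_def by blast
  moreover have "\<delta> (univ_ps_rep G P X p \<xi>) = univ_ps_rep G P X p \<xi> \<otimes>\<^sub>C group_unitary G p"
    if p: "p \<in> P" and X: "\<xi> \<in> X p" for p \<xi>
  proof -
    obtain c where c: "\<xi> = c \<cdot>\<^sub>C v p" using X unfolding X_iff by blast
    show ?thesis using p \<delta>(2)
      by (simp add: c univ_ps_rep_scale star_homD(5)[OF \<delta>(1) S_toeplitz] tensor_op_scale S_bops
        group_unitary_bops P_carrier)
  qed
  ultimately show ?thesis unfolding coaction_def toeplitz_def by blast
qed

text \<open>A name for the choice made inside \<open>toeplitz_fixed\<close>.\<close>

definition coact where "coact = (SOME \<delta>. coaction G P X (univ_ps_rep G P X) \<delta>)"

lemma coact: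
  "star_hom (toeplitz G P X) (min_tensor (toeplitz G P X) (group_cstar G)) coact"
  "p \<in> P \<Longrightarrow> coact (S p) = S p \<otimes>\<^sub>C group_unitary G p"
proof -
  have c: "coaction G P X (univ_ps_rep G P X) coact"
    unfolding coact_def by (rule someI_ex[OF coaction_exists])
  show "star_hom (toeplitz G P X) (min_tensor (toeplitz G P X) (group_cstar G)) coact"
    using c unfolding coaction_def toeplitz_def by (rule conjunct1)
  show "p \<in> P \<Longrightarrow> coact (S p) = S p \<otimes>\<^sub>C group_unitary G p"
    using c v_X(2)[of p] unfolding coaction_def by simp
qed

lemma toeplitz_fixed_iff:
  "c \<in> toeplitz_fixed G P X \<longleftrightarrow> c \<in> toeplitz G P X \<and> coact c = c \<otimes>\<^sub>C group_unitary G \<one>"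
  by (simp add: toeplitz_fixed_def coact_def)

lemma word_toeplitz: "\<alpha> \<in> words P \<Longrightarrow> word_op S \<alpha> \<in> toeplitz G P X"
  using closure_span_superset[of "word_span S"] word_spanI[of \<alpha> 1 S] unfolding toeplitz_span by auto

lemma hom_word:
  assumes h: "star_hom (toeplitz G P X) B \<phi>" and w: "\<And>p. p \<in> P \<Longrightarrow> \<phi> (S p) = w p" and \<alpha>: "\<alpha> \<in> words P"
  shows "\<phi> (word_op S \<alpha>) = word_op w \<alpha>"
proof -
  have "S ` P \<subseteq> toeplitz G P X" using S_toeplitz by blast
  hence "\<phi> (word_op S \<alpha>) = word_op (\<lambda>p. \<phi> (S p)) \<alpha>"
    using star_hom_word[OF h cstar_algebra_toeplitz _ \<alpha>] by simp
  also have "\<dots> = word_op w \<alpha>"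
    by (rule word_op_cong[where P = P]) (use \<alpha> in \<open>auto simp: w words_def\<close>)
  finally show ?thesis .
qed

lemma coact_word:
  assumes \<alpha>: "\<alpha> \<in> words P"
  shows "coact (word_op S \<alpha>) = word_op S \<alpha> \<otimes>\<^sub>C group_unitary G (word_val G \<alpha>)"
proof -
  have "coact (word_op S \<alpha>) = word_op (\<lambda>p. S p \<otimes>\<^sub>C group_unitary G p) \<alpha>"
    by (rule hom_word[OF coact \<alpha>])
  also have "\<dots> = word_op S \<alpha> \<otimes>\<^sub>C group_unitary G (word_val G \<alpha>)"
    by (rule word_op_tensor[OF corner_repD(1)[OF S_corner]]) (use \<alpha> in \<open>simp add: words_def\<close>)
  finally show ?thesis .
qed

lemma neutral_word_fixed: "\<alpha> \<in> neutral_words G P \<Longrightarrow> word_op S \<alpha> \<in> toeplitz_fixed G P X"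
  by (simp add: toeplitz_fixed_iff neutral_iff word_toeplitz coact_word)

lemma toeplitz_bops: "toeplitz G P X \<subseteq> bops"
  by (rule cstar_algebraD(1)[OF cstar_algebra_toeplitz])

lemma toeplitz_fixed_comp:
  assumes "c \<in> toeplitz_fixed G P X" "d \<in> toeplitz_fixed G P X"
  shows "c o\<^sub>L d \<in> toeplitz_fixed G P X"
proof -
  have "c \<in> bops" "d \<in> bops" using assms toeplitz_bops by (auto simp: toeplitz_fixed_iff)
  thus ?thesis using assms
    by (simp add: toeplitz_fixed_iff cstar_algebraD(5)[OF cstar_algebra_toeplitz] star_homD(3)[OF
      coact(1)]
        tensor_op_comp group_unitary_one id_bops id_compose)
qed

lemma toeplitz_fixed_diff:
  assumes "c \<in> toeplitz_fixed G P X" "d \<in> toeplitz_fixed G P X"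
  shows "c - d \<in> toeplitz_fixed G P X"
proof -
  have b: "c \<in> bops" "d \<in> bops" using assms toeplitz_bops by (auto simp: toeplitz_fixed_iff)
  have eq: "c - d = c + (- 1) \<cdot>\<^sub>C d" by (simp add: scale_op_minus_one)
  have d: "(- 1) \<cdot>\<^sub>C d \<in> toeplitz G P X"
    using assms(2) by (intro cstar_algebraD(7)[OF cstar_algebra_toeplitz]) (simp add:
      toeplitz_fixed_iff)
  show ?thesis using assms d b
    unfolding eq toeplitz_fixed_iff
    by (simp add: cstar_algebraD(4)[OF cstar_algebra_toeplitz] star_homD(2,5)[OF coact(1)]
        tensor_op_add tensor_op_scale scale_bops group_unitary_one id_bops)
qed

text \<open>The compression of the coaction to the vacuum is the conditional expectation onto the fixed
  point algebra; it sends every word that is not neutral to zero.\<close>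

lemma toeplitz_fixed_approx:
  assumes c: "c \<in> toeplitz_fixed G P X"
  shows "c \<in> closure (span {k \<cdot>\<^sub>C word_op S \<alpha> | k \<alpha>. \<alpha> \<in> neutral_words G P})"
proof -
  let ?N = "closure (span {k \<cdot>\<^sub>C word_op S \<alpha> | k \<alpha>. \<alpha> \<in> neutral_words G P})"
  have N: "subspace ?N" "closed ?N" by (intro subspace_closure subspace_span) simp
  have cT: "c \<in> toeplitz G P X" and cb: "c \<in> bops" using c toeplitz_bops
    by (auto simp: toeplitz_fixed_iff)
  let ?E = "Blinfun (entry vacuum :: _ \<Rightarrow> ('a, 'a group_space) toeplitz_space op)"
  have E: "blinfun_apply ?E F = entry vacuum F" for F
    by (simp add: bounded_linear_Blinfun_apply bounded_linear_entry)
  \<comment> \<open>The condition on the vacuum entry describes a closed subspace of the codomain,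
    so it only has to be checked on the words spanning the Toeplitz algebra.\<close>
  have "coact c \<in> {F. blinfun_apply ?E F \<in> ?N}"
  proof (rule star_hom_closure_span[OF coact(1) cstar_algebra_toeplitz _ toeplitz_span _ _ _ cT])
    show "min_tensor (toeplitz G P X) (group_cstar G) \<subseteq> bops"
      by (rule min_tensor_bops[OF toeplitz_bops group_cstar_bops])
    show "subspace {F. blinfun_apply ?E F \<in> ?N}" by (rule subspace_vimage_blinfun[OF N(1)])
    show "closed {F. blinfun_apply ?E F \<in> ?N}" by (rule closed_vimage_blinfun[OF N(2)])
    fix x assume "x \<in> word_span S"
    then obtain k \<alpha> where x: "x = k \<cdot>\<^sub>C word_op S \<alpha>" and \<alpha>: "\<alpha> \<in> words P" unfolding word_span_def
      by blast
    have \<alpha>': "word_val G \<alpha> \<in> carrier G" using \<alpha> by (intro word_val_carrier) (simp add: words_def)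
    have b: "word_op S \<alpha> \<in> bops" using word_toeplitz[OF \<alpha>] toeplitz_bops by blast
    have "entry vacuum (coact x) = entry vacuum (x \<otimes>\<^sub>C group_unitary G (word_val G \<alpha>))"
      by (simp add: x star_homD(5)[OF coact(1) word_toeplitz[OF \<alpha>]] coact_word[OF \<alpha>] tensor_op_scale
        b group_unitary_bops[OF \<alpha>'])
    also have "\<dots> = (if word_val G \<alpha> = \<one> then 1 else 0) \<cdot>\<^sub>C x"
      by (simp add: entry_tensor_op x scale_bops b group_unitary_bops[OF \<alpha>'] vacuum_state[OF \<alpha>'])
    finally have e: "entry vacuum (coact x) = (if word_val G \<alpha> = \<one> then 1 else 0) \<cdot>\<^sub>C x" .
    show "coact x \<in> {F. blinfun_apply ?E F \<in> ?N}"
    proof (cases "word_val G \<alpha> = \<one>")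
      case True
      hence "x \<in> {k \<cdot>\<^sub>C word_op S \<alpha> | k \<alpha>. \<alpha> \<in> neutral_words G P}" using \<alpha> unfolding x neutral_iff
        by blast
      hence "x \<in> ?N" by (rule subsetD[OF closure_span_superset])
      thus ?thesis using True by (simp add: E e)
    qed (simp add: E e subspace_0[OF N(1)])
  qed
  moreover have "entry vacuum (coact c) = c"
    using c by (simp add: toeplitz_fixed_iff entry_tensor_op cb group_unitary_bops vacuum_state)
  ultimately show ?thesis by (simp add: E)
qed

end

section \<open>The Fock representation\<close>

lemma Rep_partial_shift:
  fixes c :: "('i, complex) ell2"
  assumes s: "inj_on s A"
  shows "Rep_ell2 (blinfun_apply (partial_shift A s) c) j =
    (if j \<in> s ` A then Rep_ell2 c (the_inv_into A s j) else 0)"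
proof -
  have R: "Rep_ell2 d i = cinner (single i 1) d" for d :: "('i, complex) ell2" and i
    by (simp add: cinner_single cinner_complex_def)
  have b: "(partial_shift A s :: ('i, complex) ell2 op) \<in> bops" by (rule partial_shift_bops[OF s])
  have "Rep_ell2 (blinfun_apply (partial_shift A s) c) j
    = cinner (blinfun_apply (adj (partial_shift A s)) (single j 1)) c"
    by (simp only: R cinner_adj[OF b])
  thus ?thesis by (simp add: adj_partial_shift[OF s] R)
qed

lemma Rep_ell2_Abs:
  "(\<lambda>i. (norm (f i))\<^sup>2) summable_on UNIV \<Longrightarrow> Rep_ell2 (Abs_ell2 f) = f"
  by (simp add: Abs_ell2_inverse)

context semigroup_in_group
begin

text \<open>The left regular representation of P on families over the whole type of G. Coordinates
  outside P are killed, so \<open>reg \<one>\<close> is the projection onto the families supported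
  in P and \<open>reg\<close> is in general not unital.\<close>

definition reg :: "'a \<Rightarrow> ('a, complex) ell2 op"
  where "reg p = partial_shift P (\<lambda>r. p \<otimes> r)"

definition supp_P :: "('a, complex) ell2 set"
  where "supp_P = {c. \<forall>r. r \<notin> P \<longrightarrow> Rep_ell2 c r = 0}"

text \<open>The identification of square summable coefficients with the Fock module. As
  \<open>v r\<close> is an isometry, the module inner product of multiples of it is a scalar
  multiple of the identity.\<close>

definition emb :: "('a, complex) ell2 \<Rightarrow> 'a \<Rightarrow> 'a group_space op"
  where "emb c = (\<lambda>r. if r \<in> P then Rep_ell2 c r \<cdot>\<^sub>C v r else 0)"

lemma inj_translate: "p \<in> P \<Longrightarrow> inj_on (\<lambda>r. p \<otimes> r) P"
  by (auto simp: inj_on_def P_carrier)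

lemma reg_single: "p \<in> P \<Longrightarrow> blinfun_apply (reg p) (single r x) =
  (if r \<in> P then single (p \<otimes> r) x else 0)"
  by (simp add: reg_def partial_shift_single[OF inj_translate])

lemma reg_bops: "p \<in> P \<Longrightarrow> reg p \<in> bops"
  by (simp add: reg_def partial_shift_bops[OF inj_translate])

lemma adj_reg_single:
  assumes p: "p \<in> P"
  shows "blinfun_apply (adj (reg p)) (single s x) =
    (if s \<in> carrier G \<and> inv p \<otimes> s \<in> P then single (inv p \<otimes> s) x else 0)"
proof -
  have 1: "s \<in> (\<lambda>r. p \<otimes> r) ` P \<longleftrightarrow> s \<in> carrier G \<and> inv p \<otimes> s \<in> P"
    using p by (force simp: P_carrier m_assoc[symmetric])
  have "the_inv_into P (\<lambda>r. p \<otimes> r) s = inv p \<otimes> s" if "s \<in> carrier G" "inv p \<otimes> s \<in> P"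
    using that p by (intro the_inv_into_f_eq[OF inj_translate[OF p]]) (simp_all add: P_carrier
      m_assoc[symmetric])
  thus ?thesis unfolding reg_def adj_partial_shift[OF inj_translate[OF p]] 1 by simp
qed

lemma reg_one: "reg \<one> = partial_shift P (\<lambda>r. r)"
  unfolding reg_def by (rule partial_shift_cong) (auto simp: P_carrier inj_on_def)

lemma reg_corner: "corner_rep G P reg"
  unfolding corner_rep_def
proof (intro conjI ballI)
  show "reg \<in> P \<rightarrow> bops" using reg_bops by blast
  fix p assume p: "p \<in> P"
  show "adj (reg p) o\<^sub>L reg p = reg \<one>"
    unfolding reg_one unfolding reg_def by (rule adj_partial_shift_comp[OF inj_translate[OF p]])
  fix q assume q: "q \<in> P"
  show "reg (p \<otimes> q) = reg p o\<^sub>L reg q"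
    by (rule ell2_blinfun_eqI) (simp add: reg_single p q m_assoc P_carrier)
qed

lemma supp_P_iff: "c \<in> supp_P \<longleftrightarrow> blinfun_apply (reg \<one>) c = c"
proof -
  have i: "inj_on (\<lambda>r. r) P" by simp
  have "Rep_ell2 (blinfun_apply (reg \<one>) c) r = (if r \<in> P then Rep_ell2 c r else 0)" for r
    unfolding reg_one Rep_partial_shift[OF i] using the_inv_into_f_f[OF i, of r] by simp
  thus ?thesis unfolding supp_P_def mem_Collect_eq by (metis ell2_eqI)
qed

lemma single_supp_P: "r \<in> P \<Longrightarrow> single r x \<in> supp_P"
  by (auto simp: supp_P_def)

lemma v_comp: "r \<in> P \<Longrightarrow> adj (c \<cdot>\<^sub>C v r) o\<^sub>L (d \<cdot>\<^sub>C v r) = (cnj c * d) \<cdot>\<^sub>C id_blinfun"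
  by (simp add: adj_scale v_bops scale_comp adj_bops v_adj)

lemma bounded_linear_scalar_op: "bounded_linear (\<lambda>z. z \<cdot>\<^sub>C (T :: 'h::complex_hilbert op))"
proof (rule bounded_linear_intro[of _ "norm T"])
  show "(r *\<^sub>R z) \<cdot>\<^sub>C T = r *\<^sub>R z \<cdot>\<^sub>C T" for r and z
    by (simp only: scaleR_conv_of_real scale_op_scale_op[symmetric] scale_op_of_real)
qed (simp_all add: scale_op_add_left norm_scale_op)

lemma summable_on_supp:
  fixes f :: "'a \<Rightarrow> 'z::real_normed_vector"
  assumes "\<And>r. r \<notin> P \<Longrightarrow> f r = 0"
  shows "f summable_on UNIV \<longleftrightarrow> f summable_on P" "infsum f UNIV = infsum f P"
  by (rule summable_on_cong_neutral; simp add: assms) (rule infsum_cong_neutral; simp add: assms)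

lemma emb_fock: "emb c \<in> fock_module P X"
proof -
  have "(\<lambda>r. (norm (Rep_ell2 c r))\<^sup>2) summable_on UNIV" using Rep_ell2[of c] by simp
  hence "(\<lambda>r. (norm (Rep_ell2 c r))\<^sup>2) summable_on P" by (rule summable_on_subset_banach) simp
  hence "(\<lambda>r. complex_of_real ((norm (Rep_ell2 c r))\<^sup>2)) summable_on P"
    by (rule summable_on_of_real)
  hence "(\<lambda>r. complex_of_real ((norm (Rep_ell2 c r))\<^sup>2) \<cdot>\<^sub>C (id_blinfun :: 'a group_space op))
    summable_on P"
    by (rule summable_on_bounded_linear[OF bounded_linear_scalar_op])
  moreover have "adj (emb c r) o\<^sub>L emb c r =
    complex_of_real ((norm (Rep_ell2 c r))\<^sup>2) \<cdot>\<^sub>C id_blinfun" if "r \<in> P" for r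
    using that by (simp add: emb_def v_comp complex_norm_square mult.commute del: of_real_power)
  ultimately have "(\<lambda>r. adj (emb c r) o\<^sub>L emb c r) summable_on P"
    by (simp cong: summable_on_cong)
  thus ?thesis by (simp add: fock_module_def emb_def v_X)
qed

text \<open>Membership in the module is summability of operators that are non-negative multiples of
  the identity; evaluated at a unit vector this is square summability of the coefficients.\<close>

lemma fock_emb:
  assumes f: "f \<in> fock_module P X"
  shows "\<exists>c\<in>supp_P. f = emb c"
proof -
  define g where "g r = (if r \<in> P then coef r (f r) else 0)" for r
  have fg: "f r = g r \<cdot>\<^sub>C v r" if "r \<in> P" for r
    using f that by (simp add: g_def fock_module_def coef_X)
  let ?x = "single undefined 1 :: 'a group_space"
  have bl: "bounded_linear (\<lambda>T :: 'a group_space op. Re (cinner ?x (blinfun_apply T ?x)))"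
    by (rule bounded_linear_compose[OF bounded_linear_Re bounded_linear_compose[OF
      bounded_linear_cinner
          blinfun.bounded_linear_left]])
  have "(\<lambda>r. adj (f r) o\<^sub>L f r) summable_on P" using f by (simp add: fock_module_def)
  hence "(\<lambda>r. Re (cinner ?x (blinfun_apply (adj (f r) o\<^sub>L f r) ?x))) summable_on P"
    by (rule summable_on_bounded_linear[OF bl])
  moreover have "Re (cinner ?x (blinfun_apply (adj (f r) o\<^sub>L f r) ?x)) = (norm (g r))\<^sup>2" if "r \<in> P"
    for r
  proof -
    have "adj (f r) o\<^sub>L f r = complex_of_real ((norm (g r))\<^sup>2) \<cdot>\<^sub>C id_blinfun"
      using that by (simp only: fg v_comp complex_norm_square) (simp add: mult.commute)
    thus ?thesis by (simp add: cinner_scaleC_right cinner_self)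
  qed
  ultimately have "(\<lambda>r. (norm (g r))\<^sup>2) summable_on P" by (simp cong: summable_on_cong)
  hence "(\<lambda>r. (norm (g r))\<^sup>2) summable_on UNIV"
    by (subst summable_on_supp(1)) (simp_all add: g_def)
  hence R: "Rep_ell2 (Abs_ell2 g) = g" by (rule Rep_ell2_Abs)
  have "f = emb (Abs_ell2 g)"
    using f fg by (auto simp: emb_def R fock_module_def)
  moreover have "Abs_ell2 g \<in> supp_P" by (simp add: supp_P_def R g_def)
  ultimately show ?thesis by blast
qed

lemma emb_inj: "c \<in> supp_P \<Longrightarrow> d \<in> supp_P \<Longrightarrow> emb c = emb d \<Longrightarrow> c = d"
proof (rule ell2_eqI)
  fix r assume cd: "c \<in> supp_P" "d \<in> supp_P" "emb c = emb d"
  show "Rep_ell2 c r = Rep_ell2 d r"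
  proof (cases "r \<in> P")
    case True
    thus ?thesis using fun_cong[OF cd(3), of r] by (auto simp: emb_def intro: v_scale_inj)
  qed (use cd in \<open>simp add: supp_P_def\<close>)
qed

lemma emb_add: "emb (c + d) = (\<lambda>r. emb c r + emb d r)"
  by (auto simp: emb_def plus_ell2.rep_eq scale_op_add_left)

lemma emb_scale: "emb (k *\<^sub>C c) = (\<lambda>r. k \<cdot>\<^sub>C emb c r)"
  by (auto simp: emb_def scaleC_ell2.rep_eq scale_op_scale_op scaleC_complex_def)

lemma emb_zero: "emb 0 = (\<lambda>_. 0)"
  by (auto simp: emb_def)

lemma fock_inner_emb:
  assumes "c \<in> supp_P"
  shows "fock_inner P (emb c) (emb d) = cinner c d \<cdot>\<^sub>C id_blinfun"
proof -
  have s: "(\<lambda>r. cinner (Rep_ell2 c r) (Rep_ell2 d r)) summable_on UNIV"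
    using Rep_ell2[of c] Rep_ell2[of d] by (intro cinner_summable) auto
  have 0: "cinner (Rep_ell2 c r) (Rep_ell2 d r) = 0" if "r \<notin> P" for r
    using assms that by (simp add: supp_P_def)
  have "fock_inner P (emb c) (emb d) = (\<Sum>\<^sub>\<infinity>r\<in>P. cinner (Rep_ell2 c r) (Rep_ell2 d r) \<cdot>\<^sub>C
    id_blinfun)"
    unfolding fock_inner_def by (rule infsum_cong) (simp add: emb_def v_comp cinner_complex_def)
  also have "\<dots> = (\<Sum>\<^sub>\<infinity>r\<in>P. cinner (Rep_ell2 c r) (Rep_ell2 d r)) \<cdot>\<^sub>C id_blinfun"
  proof (rule infsumI, rule has_sum_bounded_linear[OF bounded_linear_scalar_op], rule
    has_sum_infsum)
    show "(\<lambda>r. cinner (Rep_ell2 c r) (Rep_ell2 d r)) summable_on P"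
      using s summable_on_supp(1)[OF 0] by simp
  qed
  also have "(\<Sum>\<^sub>\<infinity>r\<in>P. cinner (Rep_ell2 c r) (Rep_ell2 d r)) = cinner c d"
    using summable_on_supp(2)[OF 0] by (simp add: cinner_ell2.rep_eq)
  finally show ?thesis .
qed

lemma scale_id_inj: "c \<cdot>\<^sub>C (id_blinfun :: 'a group_space op) = d \<cdot>\<^sub>C id_blinfun \<Longrightarrow> c = d"
  using v_scale_inj[of \<one> c d] by (simp add: v_one)

lemma fock_rep_emb:
  assumes p: "p \<in> P"
  shows "fock_rep G P p (k \<cdot>\<^sub>C v p) (emb c) = emb (k *\<^sub>C blinfun_apply (reg p) c)"
proof
  fix s
  have coset: "p <# P = (\<lambda>r. p \<otimes> r) ` P" by (auto simp: l_coset_def)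
  show "fock_rep G P p (k \<cdot>\<^sub>C v p) (emb c) s = emb (k *\<^sub>C blinfun_apply (reg p) c) s"
  proof (cases "s \<in> p <# P")
    case True
    then obtain r where r: "r \<in> P" "s = p \<otimes> r" unfolding coset by blast
    have "Rep_ell2 (blinfun_apply (reg p) c) s = Rep_ell2 c r"
      using r by (simp add: reg_def Rep_partial_shift inj_translate[OF p] the_inv_into_f_f[OF
        inj_translate[OF p]])
    thus ?thesis using p r True
      by (simp add: fock_rep_def emb_def m_assoc[symmetric] P_carrier scale_comp v_bops v_mult
          scaleC_ell2.rep_eq scaleC_complex_def)
  next
    case False
    hence "Rep_ell2 (blinfun_apply (reg p) c) s = 0"
      by (simp add: reg_def Rep_partial_shift inj_translate[OF p] coset)
    thus ?thesis using False by (simp add: fock_rep_def emb_def scaleC_ell2.rep_eq)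
  qed
qed

section \<open>The regular representation as the Fock homomorphism\<close>

definition reg_hom :: "('a, 'a group_space) toeplitz_space op \<Rightarrow> ('a, complex) ell2 op"
  where "reg_hom = (SOME \<phi>. star_hom (toeplitz G P X) (cstar (reg ` P)) \<phi> \<and> (\<forall>p\<in>P. \<phi> (S p) =
    reg p))"

lemma reg_hom:
  "star_hom (toeplitz G P X) (cstar (reg ` P)) reg_hom" "p \<in> P \<Longrightarrow> reg_hom (S p) = reg p"
  using someI_ex[OF universal_hom[OF reg_corner]] unfolding reg_hom_def by blast+

lemma reg_cstar_bops: "cstar (reg ` P) \<subseteq> bops"
  by (rule cstar_algebraD(1)[OF cstar_algebra_cstar]) (use reg_bops in blast)

lemma reg_hom_bops: "a \<in> toeplitz G P X \<Longrightarrow> reg_hom a \<in> bops"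
  using star_homD(1)[OF reg_hom(1)] reg_cstar_bops by blast

text \<open>Each word starts with an adjoint of a generator, which absorbs \<open>S \<one>\<close>
  on the left; the right-hand version follows by adjoints. The unit of the algebra is thus
  \<open>S \<one>\<close>, which need not be the identity operator.\<close>

lemma toeplitz_unit:
  assumes a: "a \<in> toeplitz G P X"
  shows "S \<one> o\<^sub>L a = a" "a o\<^sub>L S \<one> = a"
proof -
  have 1: "S \<one> o\<^sub>L a = a" if a: "a \<in> toeplitz G P X" for a
  proof -
    have bl: "bounded_linear (\<lambda>a. (S \<one> o\<^sub>L a) - a)"
      by (intro bounded_linear_sub bounded_linear_comp_right bounded_linear_ident)
    have adjS: "S \<one> o\<^sub>L adj (S p) = adj (S p)" if "p \<in> P" for p
    proof -
      have "adj (S p o\<^sub>L S \<one>) = S \<one> o\<^sub>L adj (S p)"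
        using that by (simp add: adj_comp S_bops corner_rep_one(1)[OF S_corner])
      thus ?thesis by (simp only: corner_rep_one(3)[OF S_corner that])
    qed
    have "(S \<one> o\<^sub>L a) - a \<in> {0}"
    proof (rule closure_span_linear[OF bl])
      show "a \<in> closure (span (word_span S))" using a by (simp only: toeplitz_span)
      fix x assume "x \<in> word_span S"
      then obtain k \<alpha> where x: "x = k \<cdot>\<^sub>C word_op S \<alpha>" "\<alpha> \<in> words P" unfolding word_span_def
        by blast
      then obtain p q \<beta> where \<alpha>: "\<alpha> = (p, q) # \<beta>" "p \<in> P" by (cases \<alpha>) (auto simp: words_def)
      have "S \<one> o\<^sub>L word_op S \<alpha> = word_op S \<alpha>"
        using \<alpha>(2) by (simp add: \<alpha>(1) compose_assoc[symmetric] adjS)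
      thus "(S \<one> o\<^sub>L x) - x \<in> {0}" by (simp add: x(1) scale_op_comp_right S_bops)
    qed auto
    thus ?thesis by simp
  qed
  show "S \<one> o\<^sub>L a = a" by (rule 1[OF a])
  have ab: "a \<in> bops" "adj a \<in> toeplitz G P X"
    using a toeplitz_bops cstar_algebraD(6)[OF cstar_algebra_toeplitz] by auto
  have "adj (S \<one> o\<^sub>L adj a) = a o\<^sub>L S \<one>"
    using ab by (simp add: adj_comp S_bops adj_bops adj_adj corner_rep_one(1)[OF S_corner])
  thus "a o\<^sub>L S \<one> = a" using ab(1) by (simp only: 1[OF ab(2)] adj_adj)
qed

lemma reg_hom_supp: "a \<in> toeplitz G P X \<Longrightarrow> blinfun_apply (reg_hom a) c \<in> supp_P"
proof -
  assume a: "a \<in> toeplitz G P X"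
  have "reg \<one> o\<^sub>L reg_hom a = reg_hom (S \<one> o\<^sub>L a)"
    by (simp add: star_homD(3)[OF reg_hom(1) S_toeplitz a] reg_hom(2))
  also have "\<dots> = reg_hom a" by (simp only: toeplitz_unit(1)[OF a])
  finally show ?thesis unfolding supp_P_iff by (metis blinfun_apply_blinfun_compose)
qed

text \<open>\<open>reg_hom\<close> is transported along \<open>emb\<close>. Existence is needed
  before anything can be said about the chosen Fock homomorphism in
  \<open>fock_kernel\<close>.\<close>

lemma fock_hom_exists: "\<exists>\<Phi>. fock_hom G P X \<Phi>"
proof -
  define cf where "cf f = (SOME c. c \<in> supp_P \<and> f = emb c)" for f
  have cf: "cf (emb c) = c" if "c \<in> supp_P" for c
    unfolding cf_def by (rule some_equality) (use that emb_inj in auto)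
  define \<Phi> where "\<Phi> a f = emb (blinfun_apply (reg_hom a) (cf f))" for a f
  have \<Phi>: "\<Phi> a (emb c) = emb (blinfun_apply (reg_hom a) c)" if "c \<in> supp_P" for a c
    by (simp add: \<Phi>_def cf that)
  note hD = star_homD[OF reg_hom(1)]
  have "fock_hom G P X \<Phi>" unfolding fock_hom_def
  proof (intro conjI ballI allI)
    fix a f assume a: "a \<in> toeplitz G P X" and "f \<in> fock_module P X"
    then obtain c where c: "c \<in> supp_P" "f = emb c" using fock_emb by blast
    show "\<Phi> a f \<in> fock_module P X" by (simp add: \<Phi>_def emb_fock)
    show "\<Phi> (k \<cdot>\<^sub>C a) f = (\<lambda>r. k \<cdot>\<^sub>C \<Phi> a f r)" for k
      by (simp add: c \<Phi> hD(5)[OF a] emb_scale)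
    fix b assume b: "b \<in> toeplitz G P X"
    show "\<Phi> (a + b) f = (\<lambda>r. \<Phi> a f r + \<Phi> b f r)"
      by (simp add: c \<Phi> hD(2)[OF a b] blinfun.add_left emb_add)
    show "\<Phi> (a o\<^sub>L b) f = \<Phi> a (\<Phi> b f)"
      by (simp add: c \<Phi> hD(3)[OF a b] reg_hom_supp[OF b])
  next
    fix a f g assume a: "a \<in> toeplitz G P X" and "f \<in> fock_module P X" "g \<in> fock_module P X"
    then obtain c d where c: "c \<in> supp_P" "f = emb c" and d: "d \<in> supp_P" "g = emb d" using fock_emb
      by blast
    have "adj a \<in> toeplitz G P X" by (rule cstar_algebraD(6)[OF cstar_algebra_toeplitz a])
    thus "fock_inner P (\<Phi> (adj a) f) g = fock_inner P f (\<Phi> a g)"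
      by (simp add: c d \<Phi> fock_inner_emb reg_hom_supp) (simp add: hD(4)[OF a] cinner_adj
        reg_hom_bops a)
  next
    fix p \<xi> f assume p: "p \<in> P" and "\<xi> \<in> X p" "f \<in> fock_module P X"
    then obtain c k where c: "c \<in> supp_P" "f = emb c" and k: "\<xi> = k \<cdot>\<^sub>C v p" using fock_emb
      unfolding X_iff by blast
    show "\<Phi> (univ_ps_rep G P X p \<xi>) f = fock_rep G P p \<xi> f"
      by (simp add: c k \<Phi> fock_rep_emb p univ_ps_rep_scale hD(5)[OF S_toeplitz] reg_hom(2))
  qed
  thus ?thesis by blast
qed

text \<open>Boundedness of an abstract Fock homomorphism is not part of its definition but follows from
  the bound on actions by adjointable maps; hence it is determined by its values on words.\<close>

lemma fock_kernel_eq: "fock_kernel G P X = {c \<in> toeplitz G P X. reg_hom c = 0}"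
proof -
  define \<Phi> where "\<Phi> = (SOME \<Phi>. fock_hom G P X \<Phi>)"
  have F: "fock_hom G P X \<Phi>" unfolding \<Phi>_def by (rule someI_ex[OF fock_hom_exists])
  note F1 = F[unfolded fock_hom_def, THEN conjunct1, rule_format]
  \<comment> \<open>The abstract homomorphism read in coordinates; restricting to families supported
    in P makes the coordinates unique.\<close>
  define act where "act a c = (SOME d. d \<in> supp_P \<and> \<Phi> a (emb c) = emb d)" for a c
  have act: "act a c \<in> supp_P" "emb (act a c) = \<Phi> a (emb c)" if "a \<in> toeplitz G P X" for a c
  proof -
    have "\<exists>d. d \<in> supp_P \<and> \<Phi> a (emb c) = emb d"
      using fock_emb[of "\<Phi> a (emb c)"] F1[OF that emb_fock[of c]] by blast
    from someI_ex[OF this] show "act a c \<in> supp_P" "emb (act a c) = \<Phi> a (emb c)"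
      unfolding act_def by auto
  qed
  note TD = cstar_algebraD[OF cstar_algebra_toeplitz]
  note hD = star_homD[OF reg_hom(1)]
  have supp_add: "c + d \<in> supp_P" if "c \<in> supp_P" "d \<in> supp_P" for c d
    using that by (auto simp: supp_P_def plus_ell2.rep_eq)
  have supp_scale: "k *\<^sub>C c \<in> supp_P" if "c \<in> supp_P" for c k
    using that by (auto simp: supp_P_def scaleC_ell2.rep_eq)
  have add: "act (a + b) c = act a c + act b c" if "a \<in> toeplitz G P X" "b \<in> toeplitz G P X"
    for a b c
    using that F1[OF that(1) emb_fock[of c]]
    by (intro emb_inj act supp_add TD) (simp_all add: act emb_add TD)
  have sc: "act (k \<cdot>\<^sub>C a) c = k *\<^sub>C act a c" if "a \<in> toeplitz G P X" for a c k
    using that F1[OF that emb_fock[of c]]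
    by (intro emb_inj act supp_scale TD) (simp_all add: act emb_scale TD)
  have comp: "act (a o\<^sub>L b) c = act a (act b c)" if "a \<in> toeplitz G P X" "b \<in> toeplitz G P X"
    for a b c
    using that F1[OF that(1) emb_fock[of c]]
    by (intro emb_inj act TD) (simp_all add: act TD)
  have adj: "cinner (act (adj a) c) d = cinner c (act a d)"
    if "a \<in> toeplitz G P X" "c \<in> supp_P" "d \<in> supp_P" for a c d
  proof -
    have "fock_inner P (emb (act (adj a) c)) (emb d) = fock_inner P (emb c) (emb (act a d))"
      using F1[OF that(1) emb_fock[of c]] emb_fock[of d] by (simp add: act that TD)
    thus ?thesis
      unfolding fock_inner_emb[OF act(1)[OF TD(6)[OF that(1)]]] fock_inner_emb[OF that(2)]
      by (rule scale_id_inj)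
  qed
  have gen: "act (S p) c = blinfun_apply (reg p) c" if p: "p \<in> P" and c: "c \<in> supp_P" for p c
  proof (rule emb_inj)
    show "act (S p) c \<in> supp_P" by (rule act[OF S_toeplitz[OF p]])
    show "blinfun_apply (reg p) c \<in> supp_P"
      using reg_hom_supp[OF S_toeplitz[OF p]] by (simp add: reg_hom(2) p)
    have "\<Phi> (S p) (emb c) = fock_rep G P p (v p) (emb c)"
      using F p v_X(2)[of p] emb_fock[of c] unfolding fock_hom_def by blast
    also have "\<dots> = emb (blinfun_apply (reg p) c)" using fock_rep_emb[OF p, of 1] by simp
    finally show "emb (act (S p) c) = emb (blinfun_apply (reg p) c)" by (simp add: act S_toeplitz p)
  qed
  have ext: "c = d" if "c \<in> supp_P" "d \<in> supp_P" "\<And>e. e \<in> supp_P \<Longrightarrow> cinner c e = cinner d e" for c d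
  proof (rule ell2_ext_cinner)
    show "cinner c (single i x) = cinner d (single i x)" for i x
    proof (cases "i \<in> P")
      case True
      show ?thesis by (rule that(3)[OF single_supp_P[OF True]])
    qed (use that(1,2) in \<open>simp add: cinner_single_right supp_P_def\<close>)
  qed
  \<comment> \<open>The action of an adjoint is determined by duality against the families supported
    in P, which are preserved by both sides.\<close>
  have gen': "act (adj (S p)) c = blinfun_apply (adj (reg p)) c" if p: "p \<in> P" and c: "c \<in> supp_P"
    for p c
  proof (rule ext)
    have a: "adj (S p) \<in> toeplitz G P X" by (rule TD(6)[OF S_toeplitz[OF p]])
    show "act (adj (S p)) c \<in> supp_P" by (rule act[OF a])
    show "blinfun_apply (adj (reg p)) c \<in> supp_P"
      using reg_hom_supp[OF a, of c] by (simp add: hD(4)[OF S_toeplitz[OF p]] reg_hom(2) p)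
    show "cinner (act (adj (S p)) c) e = cinner (blinfun_apply (adj (reg p)) c) e" if "e \<in> supp_P"
      for e
      by (simp add: adj S_toeplitz p c that gen cinner_adj reg_bops)
  qed
  have supp_word: "blinfun_apply (word_op reg \<alpha>) c \<in> supp_P" if "set \<alpha> \<subseteq> P \<times> P" "c \<in> supp_P" for \<alpha> c
    using that(1)
  proof (induction \<alpha>)
    case (Cons b \<alpha>)
    obtain p q where b: "b = (p, q)" by (cases b)
    have pq: "p \<in> P" "q \<in> P" using Cons.prems by (auto simp: b)
    have "blinfun_apply (reg q) d \<in> supp_P" "blinfun_apply (adj (reg p)) d \<in> supp_P" for d
      using reg_hom_supp[OF S_toeplitz[OF pq(2)], of d] reg_hom_supp[OF TD(6)[OF S_toeplitz[OF
        pq(1)]], of d]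
      by (simp_all add: hD(4)[OF S_toeplitz[OF pq(1)]] reg_hom(2) pq)
    thus ?case by (simp add: b)
  qed (simp add: that)
  have word: "act (word_op S \<alpha>) c = blinfun_apply (word_op reg \<alpha>) c" if "\<alpha> \<in> words P" "c \<in> supp_P"
    for \<alpha> c
    using that(1)
  proof (induction \<alpha>)
    case (Cons b \<alpha>)
    obtain p q where b: "b = (p, q)" by (cases b)
    have pq: "p \<in> P" "q \<in> P" and \<alpha>: "set \<alpha> \<subseteq> P \<times> P" using Cons.prems by (auto simp: b words_def)
    have T: "adj (S p) \<in> toeplitz G P X" "S q \<in> toeplitz G P X" "adj (S p) o\<^sub>L S q \<in> toeplitz G P X"
      by (intro TD S_toeplitz pq)+
    have reg_supp: "blinfun_apply (reg q) d \<in> supp_P" for d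
      using reg_hom_supp[OF S_toeplitz[OF pq(2)], of d] by (simp add: reg_hom(2) pq)
    have 1: "act (adj (S p) o\<^sub>L S q) d = blinfun_apply (adj (reg p)) (blinfun_apply (reg q) d)"
      if "d \<in> supp_P" for d
      by (simp add: comp T gen pq that gen' reg_supp)
    show ?case
    proof (cases "\<alpha> = []")
      case True
      thus ?thesis using 1[OF that(2)] by (simp add: b compose_id)
    next
      case False
      hence "\<alpha> \<in> words P" using \<alpha> by (simp add: words_def)
      hence "act (adj (S p) o\<^sub>L S q o\<^sub>L word_op S \<alpha>) c =
        act (adj (S p) o\<^sub>L S q) (blinfun_apply (word_op reg \<alpha>) c)"
        using comp[OF T(3) word_toeplitz] Cons.IH by simp
      thus ?thesis by (simp add: b 1 supp_word \<alpha> that(2))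
    qed
  qed (simp add: words_def)
  have eq: "act a c = blinfun_apply (reg_hom a) c" if a: "a \<in> toeplitz G P X" and c: "c \<in> supp_P"
    for a c
  proof -
    have bound: "norm (act a c) \<le> 2 * norm a * norm c" if "a \<in> toeplitz G P X" for a
      by (rule star_action_bound[OF cstar_algebra_toeplitz, of supp_P act]) (simp_all add: act add
        sc comp adj that c)
    obtain Z where Z: "\<forall>n. Z n \<in> span (word_span S)" "Z \<longlonglongrightarrow> a"
      using a unfolding toeplitz_span closure_sequential by blast
    have sub: "subspace (toeplitz G P X)"
      by (rule subspace_cstar_algebra[OF cstar_algebra_toeplitz])
    have scR: "act (k *\<^sub>R b) c = k *\<^sub>R act b c" "reg_hom (k *\<^sub>R b) = k *\<^sub>R reg_hom b"
      if "b \<in> toeplitz G P X" for k b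
      using sc[OF that, of "complex_of_real k" c] hD(5)[OF that, of "complex_of_real k"]
      by (simp_all add: scale_op_of_real scaleC_of_real)
    have "span (word_span S) \<subseteq> {b \<in> toeplitz G P X. act b c = blinfun_apply (reg_hom b) c}"
    proof (rule span_minimal)
      show "word_span S \<subseteq> {b \<in> toeplitz G P X. act b c = blinfun_apply (reg_hom b) c}"
      proof
        fix x assume "x \<in> word_span S"
        then obtain k \<alpha> where x: "x = k \<cdot>\<^sub>C word_op S \<alpha>" and \<alpha>: "\<alpha> \<in> words P"
          unfolding word_span_def by blast
        have "reg_hom (word_op S \<alpha>) = word_op reg \<alpha>" by (rule hom_word[OF reg_hom \<alpha>])
        thus "x \<in> {b \<in> toeplitz G P X. act b c = blinfun_apply (reg_hom b) c}"
          by (simp add: x TD word_toeplitz[OF \<alpha>] sc hD(5) word \<alpha> c)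
      qed
      have "act 0 c = 0" "reg_hom 0 = 0" using scR[OF TD(2), of 0] by simp_all
      thus "subspace {b \<in> toeplitz G P X. act b c = blinfun_apply (reg_hom b) c}"
        by (intro subspaceI)
          (simp_all add: TD add hD(2) blinfun.add_left scR blinfun.scaleR_left subspace_scale[OF
            sub])
    qed
    hence "\<forall>n. Z n \<in> toeplitz G P X \<and> act (Z n) c = blinfun_apply (reg_hom (Z n)) c" using Z(1)
      by blast
    hence ZT: "Z n \<in> toeplitz G P X" "act (Z n) c = blinfun_apply (reg_hom (Z n)) c" for n
      by simp_all
    \<comment> \<open>Both actions agree on \<open>Z n\<close>, so only their values at the
      difference count, and each is bounded with factor 2.\<close>
    have le: "norm (act a c - blinfun_apply (reg_hom a) c) \<le> 4 * norm c * norm (a - Z n)" for n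
    proof -
      have d: "a - Z n \<in> toeplitz G P X" by (rule subspace_diff[OF sub a ZT(1)])
      have "act ((a - Z n) + Z n) c = act (a - Z n) c + act (Z n) c"
        "reg_hom ((a - Z n) + Z n) = reg_hom (a - Z n) + reg_hom (Z n)"
        by (rule add[OF d ZT(1)], rule hD(2)[OF d ZT(1)])
      hence "act a c - blinfun_apply (reg_hom a) c =
        act (a - Z n) c - blinfun_apply (reg_hom (a - Z n)) c"
        by (simp add: ZT(2) blinfun.add_left)
      also have "norm \<dots> \<le> norm (act (a - Z n) c) + norm (blinfun_apply (reg_hom (a - Z n)) c)"
        by (rule norm_triangle_ineq4)
      also have "\<dots> \<le> 2 * norm (a - Z n) * norm c + 2 * norm (a - Z n) * norm c"
        by (intro add_mono bound d order_trans[OF norm_blinfun mult_right_mono[OF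
              star_hom_norm[OF reg_hom(1) cstar_algebra_toeplitz reg_cstar_bops d]]]) simp
      finally show ?thesis by (simp add: mult_ac)
    qed
    have "(\<lambda>n. 4 * norm c * norm (a - Z n)) \<longlonglongrightarrow> 0"
      using tendsto_mult_right_zero[OF tendsto_norm_zero[OF LIM_zero[OF Z(2)]], of "4 * norm c"]
      by (simp add: norm_minus_commute)
    hence "norm (act a c - blinfun_apply (reg_hom a) c) \<le> 0"
      by (rule LIMSEQ_le_const) (use le in blast)
    thus ?thesis by simp
  qed
  have "(\<forall>f\<in>fock_module P X. \<Phi> a f = (\<lambda>_. 0)) \<longleftrightarrow> reg_hom a = 0" if a: "a \<in> toeplitz G P X" for a
  proof
    assume z: "\<forall>f\<in>fock_module P X. \<Phi> a f = (\<lambda>_. 0)"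
    have z': "blinfun_apply (reg_hom a) c = 0" if "c \<in> supp_P" for c
    proof -
      have "emb (act a c) = emb 0" using z emb_fock[of c] by (simp add: act a emb_zero)
      hence "act a c = 0" by (intro emb_inj act a) (simp_all add: supp_P_def)
      thus ?thesis using eq[OF a that] by simp
    qed
    \<comment> \<open>Vanishing on families supported in P suffices, because the unit of the
      Toeplitz algebra acts as the projection onto them.\<close>
    have "reg_hom a = reg_hom a o\<^sub>L reg \<one>"
      using hD(3)[OF a S_toeplitz[of \<one>]] by (simp add: reg_hom(2) toeplitz_unit(2)[OF a])
    moreover have "reg_hom a o\<^sub>L reg \<one> = 0"
      by (rule ell2_blinfun_eqI) (simp add: reg_single z' single_supp_P P_carrier)
    ultimately show "reg_hom a = 0" by simp
  next
    assume z: "reg_hom a = 0"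
    show "\<forall>f\<in>fock_module P X. \<Phi> a f = (\<lambda>_. 0)"
    proof
      fix f assume "f \<in> fock_module P X"
      then obtain c where c: "c \<in> supp_P" "f = emb c" using fock_emb by blast
      have "act a c = 0" using eq[OF a c(1)] z by simp
      thus "\<Phi> a f = (\<lambda>_. 0)" using act(2)[OF a, of c] by (simp add: c(2) emb_zero)
    qed
  qed
  thus ?thesis unfolding fock_kernel_def \<Phi>_def by blast
qed

end

section \<open>Ideals of words\<close>

context semigroup_in_group
begin

lemma word_ideal_sub: "word_ideal G P \<alpha> \<subseteq> P"
  unfolding word_ideal_def by (induction \<alpha> rule: rev_induct) (auto simp: left_preimage_def)

lemma left_preimage_coset:
  assumes pq: "p \<in> carrier G" "q \<in> carrier G" and Z: "Z \<subseteq> P"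
  shows "u \<in> left_preimage G P q (p <# Z) \<longleftrightarrow> u \<in> P \<and> (inv p \<otimes> q) \<otimes> u \<in> Z"
proof -
  have "q \<otimes> u \<in> p <# Z \<longleftrightarrow> inv p \<otimes> (q \<otimes> u) \<in> Z" if u: "u \<in> P"
  proof
    assume "q \<otimes> u \<in> p <# Z"
    then obtain z where z: "z \<in> Z" "q \<otimes> u = p \<otimes> z" by (auto simp: l_coset_def)
    thus "inv p \<otimes> (q \<otimes> u) \<in> Z" using pq P_carrier[OF subsetD[OF Z z(1)]]
      by (simp add: m_assoc[symmetric])
  next
    assume "inv p \<otimes> (q \<otimes> u) \<in> Z"
    moreover have "q \<otimes> u = p \<otimes> (inv p \<otimes> (q \<otimes> u))" using pq P_carrier[OF u]
      by (simp add: m_assoc[symmetric])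
    ultimately show "q \<otimes> u \<in> p <# Z" by (auto simp: l_coset_def)
  qed
  thus ?thesis using pq P_carrier[of u] by (auto simp: left_preimage_def m_assoc)
qed

text \<open>The starting set is generalised from P to Z so that the induction can consume the first
  letter. A word acts on its ideal as translation by its value, and the last translated point has to
  land in Z.\<close>

lemma foldl_word_ideal:
  assumes "set \<alpha> \<subseteq> P \<times> P" "Z \<subseteq> P"
  shows "y \<in> foldl (\<lambda>Z (p, q). left_preimage G P q (p <# Z)) Z \<alpha> \<longleftrightarrow>
    y \<in> word_ideal G P \<alpha> \<and> word_val G \<alpha> \<otimes> y \<in> Z"
  using assms
proof (induction \<alpha> arbitrary: Z)
  case Nil
  thus ?case by (auto simp: word_ideal_def P_carrier)
next
  case (Cons a \<alpha>)
  obtain p q where a: "a = (p, q)" by (cases a)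
  have pq: "p \<in> carrier G" "q \<in> carrier G" and \<alpha>: "set \<alpha> \<subseteq> P \<times> P"
    using Cons.prems by (auto simp: a P_carrier)
  have sub: "left_preimage G P q (p <# Z) \<subseteq> P" for Z by (auto simp: left_preimage_def)
  have val: "word_val G (a # \<alpha>) \<otimes> y = (inv p \<otimes> q) \<otimes> (word_val G \<alpha> \<otimes> y)" if "y \<in> word_ideal G P \<alpha>"
  proof -
    have "y \<in> carrier G" using subsetD[OF word_ideal_sub that] by (rule P_carrier)
    thus ?thesis using pq word_val_carrier[OF \<alpha>] by (simp add: a m_assoc)
  qed
  \<comment> \<open>The instance with P for Z describes the ideal of the longer word; as Z is
    contained in P, the general case then adds only the condition on the translated point.\<close>
  have 1: "y \<in> foldl (\<lambda>Z (p, q). left_preimage G P q (p <# Z)) Z (a # \<alpha>) \<longleftrightarrow>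
      y \<in> word_ideal G P \<alpha> \<and> word_val G \<alpha> \<otimes> y \<in> P \<and> word_val G (a # \<alpha>) \<otimes> y \<in> Z" if "Z \<subseteq> P" for Z
    using Cons.IH[OF \<alpha> sub, of Z] val by (auto simp: a left_preimage_coset[OF pq that])
  have "y \<in> word_ideal G P (a # \<alpha>) \<longleftrightarrow>
      y \<in> word_ideal G P \<alpha> \<and> word_val G \<alpha> \<otimes> y \<in> P \<and> word_val G (a # \<alpha>) \<otimes> y \<in> P"
    using 1[of P] by (simp add: word_ideal_def)
  thus ?case unfolding 1[OF Cons.prems(2)] using Cons.prems(2) by auto
qed

lemma word_ideal_Nil: "word_ideal G P [] = P"
  by (simp add: word_ideal_def)

lemma word_ideal_val: "set \<alpha> \<subseteq> P \<times> P \<Longrightarrow> y \<in> word_ideal G P \<alpha> \<Longrightarrow> word_val G \<alpha> \<otimes> y \<in> P"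
  by (rule conjunct2[OF iffD1[OF foldl_word_ideal[OF _ subset_refl]]]) (simp_all only:
    word_ideal_def)

lemma word_ideal_append:
  assumes "set \<alpha> \<subseteq> P \<times> P" "set \<beta> \<subseteq> P \<times> P"
  shows "y \<in> word_ideal G P (\<alpha> @ \<beta>) \<longleftrightarrow> y \<in> word_ideal G P \<beta> \<and> word_val G \<beta> \<otimes> y \<in> word_ideal G P \<alpha>"
  using foldl_word_ideal[OF assms(2) word_ideal_sub, of y \<alpha>] by (simp add: word_ideal_def)

lemma word_ideal_Cons:
  assumes "p \<in> P" "q \<in> P" "set \<alpha> \<subseteq> P \<times> P"
  shows "y \<in> word_ideal G P ((p, q) # \<alpha>) \<longleftrightarrow>
    y \<in> word_ideal G P \<alpha> \<and> (inv p \<otimes> q) \<otimes> (word_val G \<alpha> \<otimes> y) \<in> P"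
proof -
  have "u \<in> word_ideal G P [(p, q)] \<longleftrightarrow> u \<in> P \<and> (inv p \<otimes> q) \<otimes> u \<in> P" for u
    using left_preimage_coset[OF assms(1,2)[THEN P_carrier] subset_refl]
      by (simp add: word_ideal_def)
  thus ?thesis using word_ideal_append[of "[(p, q)]" \<alpha> y] word_ideal_val[OF assms(3)] assms by auto
qed

lemma neutralD: "\<alpha> \<in> neutral_words G P \<Longrightarrow> \<alpha> \<in> words P \<and> set \<alpha> \<subseteq> P \<times> P \<and> word_val G \<alpha> = \<one>"
  by (auto simp: neutral_words_def words_def)

lemma word_val_append:
  "set \<alpha> \<subseteq> P \<times> P \<Longrightarrow> set \<beta> \<subseteq> P \<times> P \<Longrightarrow> word_val G (\<alpha> @ \<beta>) = word_val G \<alpha> \<otimes> word_val G \<beta>"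
  by (induction \<alpha>) (auto simp: P_carrier m_assoc word_val_carrier)

lemma neutral_append: "\<alpha> \<in> neutral_words G P \<Longrightarrow> \<beta> \<in> neutral_words G P \<Longrightarrow> \<alpha> @ \<beta> \<in> neutral_words G P"
  by (auto simp: neutral_words_def word_val_append)

lemma word_val_reverse: "set \<alpha> \<subseteq> P \<times> P \<Longrightarrow> word_val G (reverse_word \<alpha>) = inv (word_val G \<alpha>)"
proof (induction \<alpha>)
  case (Cons a \<alpha>)
  obtain p q where a: "a = (p, q)" by (cases a)
  have "set (reverse_word \<alpha>) \<subseteq> P \<times> P" using Cons.prems by (auto simp: reverse_word_def)
  thus ?case using Cons
    by (simp add: a reverse_word_Cons word_val_append P_carrier inv_mult_group word_val_carrier)
qed (simp add: reverse_word_def)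

lemma neutral_reverse: "\<alpha> \<in> neutral_words G P \<Longrightarrow> reverse_word \<alpha> \<in> neutral_words G P"
  unfolding neutral_iff by (elim conjE, intro conjI words_reverse) (auto simp: words_def
    word_val_reverse)

text \<open>The value of a neutral word is the unit, so the translation in
  \<open>word_ideal_append\<close> disappears. Intersections of ideals are thus realised by
  concatenation; under (T3) this yields that neutral words commute and are idempotent.\<close>

lemma word_ideal_neutral_append:
  assumes "\<alpha> \<in> neutral_words G P" "\<beta> \<in> neutral_words G P"
  shows "word_ideal G P (\<alpha> @ \<beta>) = word_ideal G P \<alpha> \<inter> word_ideal G P \<beta>"
proof -
  have "word_val G \<beta> \<otimes> y = y" if "y \<in> word_ideal G P \<beta>" for y
    using subsetD[OF word_ideal_sub that] neutralD[OF assms(2)] by (simp add: P_carrier)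
  thus ?thesis using neutralD[OF assms(1)] neutralD[OF assms(2)] by (auto simp: word_ideal_append)
qed

lemma neutral_trivial: "p \<in> P \<Longrightarrow> [(p, p)] \<in> neutral_words G P" "p \<in> P \<Longrightarrow> word_ideal G P [(p, p)] = P"
  by (auto simp: neutral_words_def P_carrier word_ideal_Cons word_ideal_Nil)

text \<open>A word translates y letter by letter as long as every intermediate point stays in P,
  which is the condition for y to lie in its ideal; otherwise some letter kills the vector.\<close>

lemma reg_word_single:
  assumes "set \<alpha> \<subseteq> P \<times> P" "y \<in> P"
  shows "blinfun_apply (word_op reg \<alpha>) (single y x) =
    (if y \<in> word_ideal G P \<alpha> then single (word_val G \<alpha> \<otimes> y) x else 0)"
  using assms(1)
proof (induction \<alpha>)
  case Nil
  show ?case using assms(2) by (simp add: word_ideal_Nil P_carrier)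
next
  case (Cons a \<alpha>)
  obtain p q where a: "a = (p, q)" by (cases a)
  have pq: "p \<in> P" "q \<in> P" and \<alpha>: "set \<alpha> \<subseteq> P \<times> P" using Cons.prems by (auto simp: a)
  have c: "word_val G \<alpha> \<in> carrier G" "y \<in> carrier G" using word_val_carrier[OF \<alpha>] assms(2) P_carrier
    by auto
  have *: "inv p \<otimes> (q \<otimes> (word_val G \<alpha> \<otimes> y)) = (inv p \<otimes> q) \<otimes> (word_val G \<alpha> \<otimes> y)"
    using pq c by (simp add: m_assoc P_carrier)
  show ?case
  proof (cases "y \<in> word_ideal G P \<alpha>")
    case True
    have "word_val G \<alpha> \<otimes> y \<in> P" by (rule word_ideal_val[OF \<alpha> True])
    hence "blinfun_apply (word_op reg (a # \<alpha>)) (single y x) =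
      (if (inv p \<otimes> q) \<otimes> (word_val G \<alpha> \<otimes> y) \<in> P then single ((inv p \<otimes> q) \<otimes> (word_val G \<alpha> \<otimes> y)) x else
        0)"
      using pq c True by (simp add: a Cons.IH[OF \<alpha>] reg_single adj_reg_single * P_carrier)
    thus ?thesis using True pq c by (simp add: a word_ideal_Cons[OF pq \<alpha>] m_assoc P_carrier)
  next
    case False
    thus ?thesis by (simp add: a Cons.IH[OF \<alpha>] word_ideal_Cons[OF pq \<alpha>])
  qed
qed

lemma reg_hom_outside:
  assumes "a \<in> toeplitz G P X" "y \<notin> P"
  shows "blinfun_apply (reg_hom a) (single y x) = 0"
proof -
  have "reg_hom a = reg_hom a o\<^sub>L reg \<one>"
    using star_homD(3)[OF reg_hom(1) assms(1) S_toeplitz[of \<one>]]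
      by (simp add: reg_hom(2) toeplitz_unit(2)[OF assms(1)])
  hence "blinfun_apply (reg_hom a) (single y x) = blinfun_apply (reg_hom a o\<^sub>L reg \<one>) (single y x)"
    by simp
  thus ?thesis using assms(2) by (simp add: reg_single)
qed

lemma reg_neutral_single:
  assumes "\<alpha> \<in> neutral_words G P"
  shows "blinfun_apply (word_op reg \<alpha>) (single y x) =
    (if y \<in> word_ideal G P \<alpha> then single y x else 0)"
proof (cases "y \<in> P")
  case True
  thus ?thesis using reg_word_single[of \<alpha> y x] neutralD[OF assms] by (simp add: P_carrier)
next
  case False
  have \<alpha>: "\<alpha> \<in> words P" using assms by (simp add: neutral_iff)
  show ?thesis using reg_hom_outside[OF word_toeplitz[OF \<alpha>] False] subsetD[OF word_ideal_sub] False
    by (auto simp: hom_word[OF reg_hom \<alpha>])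
qed

text \<open>The regular representation turns a neutral word into the projection onto its ideal, and the
  reversed word into the adjoint of that projection.\<close>

lemma word_ideal_reverse:
  assumes "\<alpha> \<in> neutral_words G P"
  shows "word_ideal G P (reverse_word \<alpha>) = word_ideal G P \<alpha>"
proof -
  have \<alpha>: "\<alpha> \<in> words P" using assms by (simp add: neutral_iff)
  have rb: "reg \<in> P \<rightarrow> bops" using reg_bops by blast
  have "y \<in> word_ideal G P (reverse_word \<alpha>) \<longleftrightarrow> y \<in> word_ideal G P \<alpha>" for y
  proof -
    have "cinner (blinfun_apply (word_op reg (reverse_word \<alpha>)) (single y (1::complex))) (single y 1)
        = cinner (single y 1) (blinfun_apply (word_op reg \<alpha>) (single y 1))"
      unfolding words_adj[OF rb \<alpha>, symmetric] by (rule cinner_adj[OF words_bops[OF rb \<alpha>]])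
    thus ?thesis
      unfolding reg_neutral_single[OF assms] reg_neutral_single[OF neutral_reverse[OF assms]]
      by (simp add: cinner_single cinner_complex_def split: if_splits)
  qed
  thus ?thesis by blast
qed

section \<open>Fock covariance and the conditions on words\<close>

text \<open>The product in (T4), formed along a list.\<close>

definition word_defect :: "('a \<Rightarrow> 'h::complex_hilbert op) \<Rightarrow> ('a \<times> 'a) list \<Rightarrow> ('a \<times> 'a) list list \<Rightarrow> 'h
  op"
  where "word_defect w \<alpha> bs = foldr (\<lambda>\<beta> T. (word_op w \<alpha> - word_op w \<beta>) o\<^sub>L T) bs id_blinfun"

lemma word_defect_Cons: "word_defect w \<alpha> (\<beta> # bs) =
  (word_op w \<alpha> - word_op w \<beta>) o\<^sub>L word_defect w \<alpha> bs"
  by (simp add: word_defect_def)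

lemma star_hom_diff:
  assumes h: "star_hom A B \<phi>" and A: "cstar_algebra A" "a \<in> A" "b \<in> A"
  shows "\<phi> (a - b) = \<phi> a - \<phi> b"
proof -
  have "a - b \<in> A" by (rule subspace_diff[OF subspace_cstar_algebra[OF A(1)] A(2,3)])
  from star_homD(2)[OF h this A(3)] show ?thesis by simp
qed

text \<open>The list is non-empty because the empty product is the identity of the ambient space,
  which need not belong to the Toeplitz algebra.\<close>

lemma word_defect_fixed:
  assumes \<alpha>: "\<alpha> \<in> neutral_words G P" and bs: "bs \<noteq> []" "set bs \<subseteq> neutral_words G P"
  shows "word_defect S \<alpha> bs \<in> toeplitz_fixed G P X"
  using bs
proof (induction bs)
  case (Cons \<beta> bs)
  have 1: "word_op S \<alpha> - word_op S \<beta> \<in> toeplitz_fixed G P X"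
    using Cons.prems by (intro toeplitz_fixed_diff neutral_word_fixed \<alpha>) simp
  show ?case
  proof (cases "bs = []")
    case True
    thus ?thesis using 1 by (simp add: word_defect_def compose_id)
  next
    case False
    thus ?thesis unfolding word_defect_Cons using Cons by (intro toeplitz_fixed_comp 1) simp
  qed
qed simp

lemma hom_word_defect:
  assumes h: "star_hom (toeplitz G P X) B \<phi>" and w: "\<And>p. p \<in> P \<Longrightarrow> \<phi> (S p) = w p"
    and \<alpha>: "\<alpha> \<in> neutral_words G P" and bs: "bs \<noteq> []" "set bs \<subseteq> neutral_words G P"
  shows "\<phi> (word_defect S \<alpha> bs) = word_defect w \<alpha> bs"
  using bs
proof (induction bs)
  case (Cons \<beta> bs)
  have n: "\<alpha> \<in> words P" "\<beta> \<in> words P" using \<alpha> Cons.prems by (auto simp: neutral_iff)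
  have 1: "word_op S \<alpha> - word_op S \<beta> \<in> toeplitz G P X"
    using toeplitz_fixed_diff[OF neutral_word_fixed[OF \<alpha>] neutral_word_fixed, of \<beta>] Cons.prems
    by (simp add: toeplitz_fixed_iff)
  have 2: "\<phi> (word_op S \<alpha> - word_op S \<beta>) = word_op w \<alpha> - word_op w \<beta>"
    by (simp add: star_hom_diff[OF h cstar_algebra_toeplitz word_toeplitz word_toeplitz] n
      hom_word[OF h w])
  show ?case
  proof (cases "bs = []")
    case True
    thus ?thesis using 2 by (simp add: word_defect_def compose_id)
  next
    case False
    hence "word_defect S \<alpha> bs \<in> toeplitz G P X"
      using word_defect_fixed[OF \<alpha> False] Cons.prems by (simp add: toeplitz_fixed_iff)
    thus ?thesis unfolding word_defect_Cons using Cons False by (simp add: star_homD(3)[OF h 1] 2)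
  qed
qed simp

text \<open>In the regular representation the product is the projection onto the points of the ideal
  of \<open>\<alpha>\<close> that lie in none of the ideals in the list, and the covering leaves no
  such point.\<close>

lemma reg_word_defect:
  assumes \<alpha>: "\<alpha> \<in> neutral_words G P" and bs: "bs \<noteq> []" "set bs \<subseteq> neutral_words G P"
    and K: "word_ideal G P \<alpha> = (\<Union>\<beta>\<in>set bs. word_ideal G P \<beta>)"
  shows "word_defect reg \<alpha> bs = 0"
proof (rule ell2_blinfun_eqI)
  fix y x
  have "blinfun_apply (word_defect reg \<alpha> cs) (single y x) =
      (if \<forall>\<beta>\<in>set cs. y \<in> word_ideal G P \<alpha> - word_ideal G P \<beta> then single y x else 0)"
    if "set cs \<subseteq> set bs" for cs
    using that
  proof (induction cs)
    case Nil
    show ?case by (simp add: word_defect_def)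
  next
    case (Cons \<beta> cs)
    have \<beta>: "\<beta> \<in> neutral_words G P" "word_ideal G P \<beta> \<subseteq> word_ideal G P \<alpha>" using Cons.prems bs K
      by auto
    show ?case using Cons \<beta>(2) unfolding word_defect_Cons
      by (auto simp: blinfun.diff_left reg_neutral_single[OF \<alpha>] reg_neutral_single[OF \<beta>(1)])
  qed
  from this[OF subset_refl] show "blinfun_apply (word_defect reg \<alpha> bs) (single y x) =
    blinfun_apply 0 (single y x)"
    using bs(1) K by (cases bs) auto
qed

text \<open>The generating set of the Fock ideal.\<close>

definition gauge_kernel where "gauge_kernel = fock_kernel G P X \<inter> toeplitz_fixed G P X"

lemma gauge_kernel_iff:
  "c \<in> gauge_kernel \<longleftrightarrow> c \<in> toeplitz_fixed G P X \<and> reg_hom c = 0"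
  by (auto simp: gauge_kernel_def fock_kernel_eq toeplitz_fixed_iff)

section \<open>Fock covariance as vanishing on the generators of the Fock ideal\<close>

lemma induced_hom:
  assumes t: "t \<in> ps_reps G P X"
  shows "star_hom (toeplitz G P X) (ps_cstar P X t) (induced_hom G P X t)"
    "p \<in> P \<Longrightarrow> induced_hom G P X t (S p) = t p (v p)" "ps_cstar P X t \<subseteq> bops"
proof -
  have c: "corner_rep G P (\<lambda>p. t p (v p))" by (rule ps_reps_corner[OF t])
  have b: "t p (v p) \<in> bops" if "p \<in> P" for p using corner_repD(1)[OF c] that by blast
  have eq: "ps_cstar P X t = cstar ((\<lambda>p. t p (v p)) ` P)"
    by (rule ps_cstar_eq) (simp_all add: ps_reps_scale[OF t] b)
  show "ps_cstar P X t \<subseteq> bops"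
    unfolding eq by (rule cstar_algebraD(1)[OF cstar_algebra_cstar]) (use b in blast)
  obtain \<phi> where \<phi>: "star_hom (toeplitz G P X) (ps_cstar P X t) \<phi>" "\<forall>p\<in>P. \<phi> (S p) = t p (v p)"
    using universal_hom[OF c] unfolding eq by blast
  have "\<phi> (univ_ps_rep G P X p \<xi>) = t p \<xi>" if p: "p \<in> P" and X: "\<xi> \<in> X p" for p \<xi>
  proof -
    obtain k where k: "\<xi> = k \<cdot>\<^sub>C v p" using X unfolding X_iff by blast
    show ?thesis using p \<phi>(2)
      by (simp add: k univ_ps_rep_scale star_homD(5)[OF \<phi>(1) S_toeplitz] ps_reps_scale[OF t])
  qed
  hence "\<exists>\<phi>. star_hom (toeplitz G P X) (ps_cstar P X t) \<phi> \<and>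
    (\<forall>p\<in>P. \<forall>\<xi>\<in>X p. \<phi> (univ_ps_rep G P X p \<xi>) = t p \<xi>)" using \<phi>(1) by blast
  from someI_ex[OF this]
  have i: "star_hom (toeplitz G P X) (ps_cstar P X t) (induced_hom G P X t) \<and>
    (\<forall>p\<in>P. \<forall>\<xi>\<in>X p. induced_hom G P X t (univ_ps_rep G P X p \<xi>) = t p \<xi>)"
    unfolding induced_hom_def .
  show "star_hom (toeplitz G P X) (ps_cstar P X t) (induced_hom G P X t)" by (rule conjunct1[OF i])
  show "p \<in> P \<Longrightarrow> induced_hom G P X t (S p) = t p (v p)" using conjunct2[OF i] v_X(2)[of p] by simp
qed

text \<open>Closedness is the point: a *-homomorphism is not continuous by definition, so the bound
  with factor 2 is needed.\<close>

lemma closed_ideal_kernel: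
  assumes h: "star_hom A B \<phi>" and A: "cstar_algebra A" and B: "B \<subseteq> bops"
  shows "closed_ideal A {c \<in> A. \<phi> c = 0}"
proof -
  note hD = star_homD[OF h] and AD = cstar_algebraD[OF A]
  have 0: "\<phi> 0 = 0" using star_hom_diff[OF h A AD(2) AD(2)] by simp
  have "closed {c \<in> A. \<phi> c = 0}" unfolding closed_sequential_limits
  proof (intro allI impI, elim conjE)
    fix Z c assume Z: "\<forall>n. Z n \<in> {c \<in> A. \<phi> c = 0}" "Z \<longlonglongrightarrow> c"
    have c: "c \<in> A" by (rule closed_sequentially[OF AD(3) _ Z(2)]) (use Z(1) in auto)
    have le: "norm (\<phi> c) \<le> 2 * norm (c - Z n)" for n
    proof -
      have Zn: "Z n \<in> A" "\<phi> (Z n) = 0" using Z(1) by auto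
      have "\<phi> (c - Z n) = \<phi> c" by (simp add: star_hom_diff[OF h A c Zn(1)] Zn(2))
      thus ?thesis using star_hom_norm[OF h A B subspace_diff[OF subspace_cstar_algebra[OF A] c
        Zn(1)]] by simp
    qed
    have "(\<lambda>n. 2 * norm (c - Z n)) \<longlonglongrightarrow> 0"
      using tendsto_mult_right_zero[OF tendsto_norm_zero[OF LIM_zero[OF Z(2)]], of 2]
        by (simp add: norm_minus_commute)
    hence "norm (\<phi> c) \<le> 0" by (rule LIMSEQ_le_const) (use le in blast)
    thus "c \<in> {c \<in> A. \<phi> c = 0}" using c by simp
  qed
  thus ?thesis unfolding closed_ideal_def
    by (auto simp: 0 AD hD)
qed

lemma fock_ideal_zero: "0 \<in> fock_ideal G P X"
  and fock_ideal_add: "a \<in> fock_ideal G P X \<Longrightarrow> b \<in> fock_ideal G P X \<Longrightarrow> a + b \<in> fock_ideal G P X"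
  and fock_ideal_scale: "a \<in> fock_ideal G P X \<Longrightarrow> k \<cdot>\<^sub>C a \<in> fock_ideal G P X"
  unfolding fock_ideal_def hull_def by (auto simp: closed_ideal_def)

lemma gauge_kernel_fock_ideal: "gauge_kernel \<subseteq> fock_ideal G P X"
  unfolding fock_ideal_def gauge_kernel_def by (rule hull_subset)

text \<open>The kernel of the induced homomorphism is a closed ideal, so it contains the Fock ideal
  once it contains the generators. Conversely, a generator has the same coset as 0, and the factor
  map cannot separate the two.\<close>

lemma fock_covariant_iff:
  assumes t: "t \<in> ps_reps G P X"
  shows "fock_covariant G P X t \<longleftrightarrow> (\<forall>c\<in>gauge_kernel. induced_hom G P X t c = 0)"
proof
  let ?\<tau> = "induced_hom G P X t" and ?J = "fock_ideal G P X"
  note h = induced_hom(1)[OF t] and TD = cstar_algebraD[OF cstar_algebra_toeplitz]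
  have 0: "?\<tau> 0 = 0" using star_hom_diff[OF h cstar_algebra_toeplitz TD(2) TD(2)] by simp
  {
    assume "fock_covariant G P X t"
    then obtain \<psi> where \<psi>: "\<forall>c\<in>toeplitz G P X. \<psi> ((+) c ` ?J) = ?\<tau> c"
      unfolding fock_covariant_def ..
    show "\<forall>c\<in>gauge_kernel. ?\<tau> c = 0"
    proof
      fix c assume c: "c \<in> gauge_kernel"
      hence cJ: "c \<in> ?J" and cT: "c \<in> toeplitz G P X"
        using gauge_kernel_fock_ideal by (auto simp: gauge_kernel_iff toeplitz_fixed_iff)
      have "(+) c ` ?J = ?J"
      proof
        show "(+) c ` ?J \<subseteq> ?J" using fock_ideal_add[OF cJ] by blast
        show "?J \<subseteq> (+) c ` ?J"
        proof
          fix d assume "d \<in> ?J"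
          hence "d + (- 1) \<cdot>\<^sub>C c \<in> ?J" by (intro fock_ideal_add fock_ideal_scale cJ)
          moreover have "d = c + (d + (- 1) \<cdot>\<^sub>C c)" by (simp add: scale_op_minus_one)
          ultimately show "d \<in> (+) c ` ?J" by (rule rev_image_eqI)
        qed
      qed
      moreover have "(+) 0 ` ?J = ?J" by simp
      ultimately have "?\<tau> c = ?\<tau> 0" using \<psi> cT TD(2) by metis
      thus "?\<tau> c = 0" by (simp only: 0)
    qed
  }
  assume k: "\<forall>c\<in>gauge_kernel. ?\<tau> c = 0"
  have "?J \<subseteq> {c \<in> toeplitz G P X. ?\<tau> c = 0}"
    unfolding fock_ideal_def gauge_kernel_def[symmetric]
  proof (rule hull_minimal)
    show "gauge_kernel \<subseteq> {c \<in> toeplitz G P X. ?\<tau> c = 0}"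
      using k by (auto simp: gauge_kernel_iff toeplitz_fixed_iff)
    show "closed_ideal (toeplitz G P X) {c \<in> toeplitz G P X. ?\<tau> c = 0}"
      by (rule closed_ideal_kernel[OF h cstar_algebra_toeplitz induced_hom(3)[OF t]])
  qed
  hence J: "d \<in> toeplitz G P X" "?\<tau> d = 0" if "d \<in> ?J" for d using that by auto
  \<comment> \<open>The representative chosen for a coset differs from any other one by an element
    of the ideal, on which the homomorphism vanishes.\<close>
  define \<psi> where "\<psi> A = ?\<tau> (SOME c. c \<in> toeplitz G P X \<and> (+) c ` ?J = A)" for A
  have "\<psi> ((+) c ` ?J) = ?\<tau> c" if c: "c \<in> toeplitz G P X" for c
  proof -
    define d where "d = (SOME d. d \<in> toeplitz G P X \<and> (+) d ` ?J = (+) c ` ?J)"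
    have "d \<in> toeplitz G P X \<and> (+) d ` ?J = (+) c ` ?J"
      unfolding d_def by (rule someI[of _ c]) (simp add: c)
    moreover have "d + 0 \<in> (+) d ` ?J" using fock_ideal_zero by (rule imageI)
    ultimately obtain j where j: "j \<in> ?J" "d = c + j" by auto
    have "?\<tau> d = ?\<tau> c" by (simp add: j(2) star_homD(2)[OF h c J(1)[OF j(1)]] J(2)[OF j(1)])
    thus ?thesis by (simp add: \<psi>_def d_def)
  qed
  thus "fock_covariant G P X t" unfolding fock_covariant_def by blast
qed

lemma fock_covariant_conditions:
  assumes t: "t \<in> ps_reps G P X" and F: "fock_covariant G P X t"
  defines "w \<equiv> \<lambda>p\<in>P. t p (v p)"
  shows "cond_T2 G P w" "cond_T3 G P w" "cond_T4 G P w"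
proof -
  let ?\<tau> = "induced_hom G P X t"
  have w: "?\<tau> (S p) = w p" if "p \<in> P" for p using induced_hom(2)[OF t that] that
    by (simp add: w_def)
  note h = induced_hom(1)[OF t]
  have kill: "?\<tau> c = 0" if "c \<in> toeplitz_fixed G P X" "reg_hom c = 0" for c
    using F that unfolding fock_covariant_iff[OF t] by (simp add: gauge_kernel_iff)
  have \<tau>w: "?\<tau> (word_op S \<alpha>) = word_op w \<alpha>" if "\<alpha> \<in> neutral_words G P" for \<alpha>
    using that by (intro hom_word[OF h w]) (auto simp: neutral_iff)
  have rw: "reg_hom (word_op S \<alpha>) = word_op reg \<alpha>" if "\<alpha> \<in> neutral_words G P" for \<alpha>
    using that by (intro hom_word[OF reg_hom]) (auto simp: neutral_iff)
  have T: "word_op S \<alpha> \<in> toeplitz G P X" if "\<alpha> \<in> neutral_words G P" for \<alpha>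
    using neutral_word_fixed[OF that] by (simp add: toeplitz_fixed_iff)
  show "cond_T2 G P w" unfolding cond_T2_def
  proof (intro ballI impI)
    fix \<alpha> assume \<alpha>: "\<alpha> \<in> neutral_words G P" and "word_ideal G P \<alpha> = {}"
    hence "word_op reg \<alpha> = 0" by (intro ell2_blinfun_eqI) (simp add: reg_neutral_single)
    hence "?\<tau> (word_op S \<alpha>) = 0" by (intro kill neutral_word_fixed \<alpha>) (simp add: rw \<alpha>)
    thus "word_op w \<alpha> = 0" by (simp add: \<tau>w \<alpha>)
  qed
  show "cond_T3 G P w" unfolding cond_T3_def
  proof (intro ballI impI)
    fix \<alpha> \<beta> assume \<alpha>: "\<alpha> \<in> neutral_words G P" and \<beta>: "\<beta> \<in> neutral_words G P"
      and "word_ideal G P \<alpha> = word_ideal G P \<beta>"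
    hence "word_op reg \<alpha> = word_op reg \<beta>" by (intro ell2_blinfun_eqI) (simp add: reg_neutral_single)
    hence "?\<tau> (word_op S \<alpha> - word_op S \<beta>) = 0"
      by (intro kill toeplitz_fixed_diff neutral_word_fixed \<alpha> \<beta>)
        (simp add: star_hom_diff[OF reg_hom(1) cstar_algebra_toeplitz] T rw \<alpha> \<beta>)
    thus "word_op w \<alpha> = word_op w \<beta>"
      by (simp add: star_hom_diff[OF h cstar_algebra_toeplitz] T \<tau>w \<alpha> \<beta>)
  qed
  show "cond_T4 G P w" unfolding cond_T4_def
  proof (intro ballI allI impI, elim conjE)
    fix \<alpha> bs assume \<alpha>: "\<alpha> \<in> neutral_words G P" and bs: "bs \<noteq> []" "set bs \<subseteq> neutral_words G P"
      and K: "word_ideal G P \<alpha> = (\<Union>\<beta>\<in>set bs. word_ideal G P \<beta>)"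
    have "?\<tau> (word_defect S \<alpha> bs) = 0"
      by (intro kill word_defect_fixed \<alpha> bs) (simp add: hom_word_defect[OF reg_hom \<alpha> bs]
        reg_word_defect[OF \<alpha> bs K])
    hence "word_defect w \<alpha> bs = 0" by (simp add: hom_word_defect[OF h w \<alpha> bs])
    thus "foldr (\<lambda>\<beta> T. (word_op w \<alpha> - word_op w \<beta>) o\<^sub>L T) bs id_blinfun = 0"
      by (simp add: word_defect_def)
  qed
qed

section \<open>From the conditions on words to Fock covariance\<close>

lemma T3_isometric:
  fixes w :: "'a \<Rightarrow> 'h::complex_hilbert op"
  assumes w: "w \<in> semigroup_reps G P" and T1: "cond_T1 G w" and T3: "cond_T3 G P w"
  shows "corner_rep G P w"
proof -
  have b: "w p \<in> bops" if "p \<in> P" for p using w that by (auto simp: semigroup_reps_def)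
  have 1: "w \<one> = id_blinfun" using T1 by (simp add: cond_T1_def)
  have "adj (w p) o\<^sub>L w p = w \<one>" if p: "p \<in> P" for p
  proof -
    \<comment> \<open>Both words are neutral with ideal P, so (T3) equates \<open>adj (w p)\<close>
      times \<open>w p\<close> with the same product at the unit.\<close>
    have "word_op w [(p, p)] = word_op w [(\<one>, \<one>)]"
      by (rule T3[unfolded cond_T3_def, rule_format]) (simp_all only: neutral_trivial p
        sub.one_closed)
    thus ?thesis by (simp add: 1 adj_id compose_id)
  qed
  thus ?thesis using w b unfolding corner_rep_def semigroup_reps_def by auto
qed

text \<open>Splitting off the eigenvectors of one projection at a time, a vector x on which the remaining
  scalars act is in the joint spectral subspace given by the ideals containing and avoiding a point;
  by (T2) and (T4) such a point exists unless x vanishes.\<close>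

lemma neutral_sum_bound:
  fixes w :: "'a \<Rightarrow> 'h::complex_hilbert op"
  assumes w: "corner_rep G P w" and T2: "cond_T2 G P w" and T3: "cond_T3 G P w"
    and T4: "cond_T4 G P w"
    and "snd ` set L \<subseteq> neutral_words G P" "\<gamma> \<in> neutral_words G P" "set N \<subseteq> neutral_words G P"
    and "blinfun_apply (word_op w \<gamma>) x = x" "\<And>\<beta>. \<beta> \<in> set N \<Longrightarrow> blinfun_apply (word_op w \<beta>) x = 0"
    and "\<And>y. y \<in> word_ideal G P \<gamma> \<Longrightarrow> (\<And>\<beta>. \<beta> \<in> set N \<Longrightarrow> y \<notin> word_ideal G P \<beta>) \<Longrightarrow>
      cmod (c + (\<Sum>(a, \<alpha>)\<leftarrow>L. if y \<in> word_ideal G P \<alpha> then a else 0)) \<le> M"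
    and M: "0 \<le> M"
  shows "norm (c *\<^sub>C x + (\<Sum>(a, \<alpha>)\<leftarrow>L. a *\<^sub>C blinfun_apply (word_op w \<alpha>) x)) \<le> M * norm x"
  using assms(5-10)
\<comment> \<open>\<open>\<gamma>\<close> accumulates the words whose projections fix x and N those
  that annihilate x, while c is the sum of the coefficients already decided. All of them change
  along the induction.\<close>
proof (induction L arbitrary: \<gamma> N c x)
  case Nil
  let ?e = "\<lambda>\<alpha>. blinfun_apply (word_op w \<alpha>)"
  show ?case
  proof (cases "x = 0")
    case False
    have "\<exists>y\<in>word_ideal G P \<gamma>. \<forall>\<beta>\<in>set N. y \<notin> word_ideal G P \<beta>"
    proof (rule ccontr)
      assume "\<not> ?thesis"
      hence cover: "word_ideal G P \<gamma> \<subseteq> (\<Union>\<beta>\<in>set N. word_ideal G P \<beta>)" by blast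
      show False
      proof (cases "N = []")
        case True
        hence "word_op w \<gamma> = 0" using T2 Nil.prems(2) cover by (simp add: cond_T2_def)
        thus False using Nil.prems(4) False by simp
      next
        case N: False
        \<comment> \<open>(T4) demands an equality of ideals and not only a covering; prefixing
          \<open>\<gamma>\<close> intersects each ideal with that of \<open>\<gamma>\<close>.
          Duplicates are removed because (T4) speaks of distinct enumerations.\<close>
        let ?bs = "remdups (map ((@) \<gamma>) N)"
        have n: "\<gamma> @ \<beta> \<in> neutral_words G P" if "\<beta> \<in> set N" for \<beta>
          using that Nil.prems(2,3) by (intro neutral_append) auto
        have "word_ideal G P \<gamma> = (\<Union>\<beta>\<in>set ?bs. word_ideal G P \<beta>)"
        proof -
          have "word_ideal G P (\<gamma> @ \<beta>) = word_ideal G P \<gamma> \<inter> word_ideal G P \<beta>" if "\<beta> \<in> set N" for \<beta>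
            using that Nil.prems(2,3) by (intro word_ideal_neutral_append) auto
          thus ?thesis using cover by auto
        qed
        moreover have "?bs \<noteq> []" "distinct ?bs" "set ?bs \<subseteq> neutral_words G P" using N n by auto
        ultimately have z: "word_defect w \<gamma> ?bs = 0"
          using T4 Nil.prems(2) unfolding cond_T4_def word_defect_def by blast
        \<comment> \<open>Every factor fixes x, since \<open>\<gamma>\<close> does and the
          subtracted word annihilates it. A product that is 0 would therefore force x to be
          0.\<close>
        have "blinfun_apply (word_defect w \<gamma> cs) x = x" if "set cs \<subseteq> set ?bs" for cs
          using that
        proof (induction cs)
          case Nil
          show ?case by (simp add: word_defect_def)
        next
          case (Cons \<delta> cs)
          obtain \<beta> where \<beta>: "\<beta> \<in> set N" "\<delta> = \<gamma> @ \<beta>" using Cons.prems by auto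
          have "?e \<delta> x = 0" using Nil.prems(5)[OF \<beta>(1)] by (simp add: \<beta>(2) word_op_append)
          thus ?case using Cons Nil.prems(4) by (simp add: word_defect_Cons blinfun.diff_left)
        qed
        from this[OF subset_refl] show False using False by (simp add: z)
      qed
    qed
    then obtain y where "y \<in> word_ideal G P \<gamma>" "\<forall>\<beta>\<in>set N. y \<notin> word_ideal G P \<beta>" by blast
    hence "cmod c \<le> M" using Nil.prems(6)[of y] by simp
    thus ?thesis by (simp add: norm_scaleC mult_right_mono)
  qed simp
next
  case (Cons a\<alpha> L)
  let ?e = "\<lambda>\<alpha>. blinfun_apply (word_op w \<alpha>)"
  obtain a \<alpha> where a: "a\<alpha> = (a, \<alpha>)" by (cases a\<alpha>)
  have wb: "w \<in> P \<rightarrow> bops" by (rule corner_repD(1)[OF w])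
  have \<alpha>: "\<alpha> \<in> neutral_words G P" and L: "snd ` set L \<subseteq> neutral_words G P" using Cons.prems(1)
    by (auto simp: a)
  note \<gamma> = Cons.prems(2) and N = Cons.prems(3)
  \<comment> \<open>Through (T3) an identity between neutral words is checked on ideals alone.
    Concatenation gives intersections and reversal keeps the ideal, so the operators are commuting
    self-adjoint idempotents.\<close>
  have eq: "word_op w \<beta> = word_op w \<delta>" if "\<beta> \<in> neutral_words G P" "\<delta> \<in> neutral_words G P"
    "word_ideal G P \<beta> = word_ideal G P \<delta>" for \<beta> \<delta>
    using T3 that unfolding cond_T3_def by blast
  have comm: "?e \<beta> (?e \<delta> z) = ?e \<delta> (?e \<beta> z)" if "\<beta> \<in> neutral_words G P" "\<delta> \<in> neutral_words G P"
    for \<beta> \<delta> z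
  proof -
    have "word_op w (\<beta> @ \<delta>) = word_op w (\<delta> @ \<beta>)"
      using that by (intro eq neutral_append) (auto simp: word_ideal_neutral_append)
    thus ?thesis by (simp add: word_op_append) (metis blinfun_apply_blinfun_compose)
  qed
  have "word_op w (\<alpha> @ \<alpha>) = word_op w \<alpha>"
    by (intro eq neutral_append \<alpha>) (simp add: word_ideal_neutral_append \<alpha>)
  hence idem: "?e \<alpha> (?e \<alpha> z) = ?e \<alpha> z" for z
    by (simp add: word_op_append) (metis blinfun_apply_blinfun_compose)
  have \<alpha>w: "\<alpha> \<in> words P" using \<alpha> by (simp add: neutral_iff)
  have "adj (word_op w \<alpha>) = word_op w \<alpha>"
    unfolding words_adj[OF wb \<alpha>w] by (intro eq neutral_reverse \<alpha> word_ideal_reverse)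
  hence sa: "cinner (?e \<alpha> z) z' = cinner z (?e \<alpha> z')" for z z'
    using cinner_adj[OF words_bops[OF wb \<alpha>w], of z z'] by simp
  \<comment> \<open>The components of x in the range and in the kernel of the projection of
    \<open>\<alpha>\<close>; on the first the leading term contributes the scalar a, on the second
    it contributes nothing.\<close>
  define x1 where "x1 = ?e \<alpha> x"
  define x2 where "x2 = x - x1"
  define F where "F z = (\<Sum>(a, \<alpha>)\<leftarrow>L. a *\<^sub>C ?e \<alpha> z)" for z
  have x1: "?e \<alpha> x1 = x1" and x2: "?e \<alpha> x2 = 0"
    by (simp_all add: x1_def x2_def idem blinfun.diff_right)
  have F_add: "F (y + z) = F y + F z" for y z
    unfolding F_def by (induction L) (auto simp: blinfun.add_right scaleC_add_right)
  have F_comm: "?e \<alpha> (F z) = F (?e \<alpha> z)" for z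
    unfolding F_def using L
  proof (induction L)
    case (Cons b L)
    obtain k \<beta> where b: "b = (k, \<beta>)" by (cases b)
    have "\<beta> \<in> neutral_words G P" using Cons.prems by (simp add: b)
    thus ?case using Cons
      by (simp add: b blinfun.add_right bopsD[OF words_bops[OF wb \<alpha>w]] comm[OF \<alpha>])
  qed simp
  define y1 where "y1 = (c + a) *\<^sub>C x1 + F x1"
  define y2 where "y2 = c *\<^sub>C x2 + F x2"
  have ey1: "?e \<alpha> y1 = y1" and ey2: "?e \<alpha> y2 = 0"
  proof -
    show "?e \<alpha> y1 = y1" by (simp add: y1_def blinfun.add_right bopsD[OF words_bops[OF wb \<alpha>w]] F_comm
      x1)
    have "F 0 = 0" using F_add[of 0 0] by simp
    thus "?e \<alpha> y2 = 0" by (simp add: y2_def blinfun.add_right bopsD[OF words_bops[OF wb \<alpha>w]] F_comm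
      x2)
  qed
  have n1: "norm y1 \<le> M * norm x1" unfolding y1_def F_def
  proof (rule Cons.IH[OF L neutral_append[OF \<gamma> \<alpha>] N])
    show "?e (\<gamma> @ \<alpha>) x1 = x1"
      using x1 comm[OF \<gamma> \<alpha>] Cons.prems(4) by (simp add: word_op_append x1_def idem)
    show "?e \<beta> x1 = 0" if "\<beta> \<in> set N" for \<beta>
      using comm[of \<beta> \<alpha> x] \<alpha> subsetD[OF N that] Cons.prems(5)[OF that] by (simp add: x1_def)
    show "cmod (c + a + (\<Sum>(a, \<alpha>)\<leftarrow>L. if y \<in> word_ideal G P \<alpha> then a else 0)) \<le> M"
      if "y \<in> word_ideal G P (\<gamma> @ \<alpha>)" "\<And>\<beta>. \<beta> \<in> set N \<Longrightarrow> y \<notin> word_ideal G P \<beta>" for y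
      using Cons.prems(6)[of y] that by (simp add: a word_ideal_neutral_append[OF \<gamma> \<alpha>] add.assoc)
  qed
  have n2: "norm y2 \<le> M * norm x2" unfolding y2_def F_def
  proof (rule Cons.IH[OF L \<gamma>, of "\<alpha> # N"])
    show "set (\<alpha> # N) \<subseteq> neutral_words G P" using \<alpha> N by simp
    show "?e \<gamma> x2 = x2"
      using comm[OF \<gamma> \<alpha>, of x] Cons.prems(4) by (simp add: x2_def x1_def blinfun.diff_right)
    show "?e \<beta> x2 = 0" if "\<beta> \<in> set (\<alpha> # N)" for \<beta>
    proof (cases "\<beta> = \<alpha>")
      case False
      hence "\<beta> \<in> set N" using that by simp
      thus ?thesis using comm[of \<beta> \<alpha> x] \<alpha> N Cons.prems(5)
        by (auto simp: x2_def x1_def blinfun.diff_right)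
    qed (simp add: x2)
    show "cmod (c + (\<Sum>(a, \<alpha>)\<leftarrow>L. if y \<in> word_ideal G P \<alpha> then a else 0)) \<le> M"
      if "y \<in> word_ideal G P \<gamma>" "\<And>\<beta>. \<beta> \<in> set (\<alpha> # N) \<Longrightarrow> y \<notin> word_ideal G P \<beta>" for y
      using Cons.prems(6)[of y] that by (simp add: a)
  qed
  have split: "c *\<^sub>C x + (\<Sum>(a, \<alpha>)\<leftarrow>a\<alpha> # L. a *\<^sub>C ?e \<alpha> x) = y1 + y2"
  proof -
    have "c *\<^sub>C x = c *\<^sub>C x1 + c *\<^sub>C x2" "F x = F x1 + F x2"
      unfolding F_add[symmetric] scaleC_add_right[symmetric] by (simp_all add: x2_def)
    thus ?thesis by (simp add: a F_def[symmetric] y1_def y2_def scaleC_add_left x1_def[symmetric])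
  qed
  \<comment> \<open>The two parts of the sum and the two parts of x are orthogonal, so both
    estimates combine by the Pythagorean theorem with the same constant M.\<close>
  have "cinner y1 y2 = 0" using sa[of y1 y2] by (simp add: ey1 ey2)
  hence "(norm (y1 + y2))\<^sup>2 = (norm y1)\<^sup>2 + (norm y2)\<^sup>2" by (rule norm_add_orthogonal)
  also have "\<dots> \<le> (M * norm x1)\<^sup>2 + (M * norm x2)\<^sup>2"
    by (intro add_mono power_mono n1 n2 norm_ge_zero)
  also have "\<dots> = M\<^sup>2 * ((norm x1)\<^sup>2 + (norm x2)\<^sup>2)" by (simp add: power_mult_distrib distrib_left)
  also have "(norm x1)\<^sup>2 + (norm x2)\<^sup>2 = (norm (x1 + x2))\<^sup>2"
    using sa[of x1 x2] by (intro norm_add_orthogonal[symmetric]) (simp add: x1 x2)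
  also have "x1 + x2 = x" by (simp add: x2_def)
  finally have "(norm (y1 + y2))\<^sup>2 \<le> (M * norm x)\<^sup>2" by (simp only: power_mult_distrib)
  hence "norm (y1 + y2) \<le> M * norm x" by (rule power2_le_imp_le) (simp add: M)
  thus ?case by (simp only: split)
qed

text \<open>A list with possible repetitions lets the induction of \<open>neutral_sum_bound\<close>
  remove one term at a time; the real scalars of \<open>span\<close> are absorbed into the complex
  coefficients.\<close>

lemma neutral_span_list:
  assumes "T \<in> span {k \<cdot>\<^sub>C word_op S \<alpha> | k \<alpha>. \<alpha> \<in> neutral_words G P}"
  shows "\<exists>L. snd ` set L \<subseteq> neutral_words G P \<and> T = (\<Sum>(a, \<alpha>)\<leftarrow>L. a \<cdot>\<^sub>C word_op S \<alpha>)"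
  using assms
proof (induction rule: span_induct_alt)
  case base
  show ?case by (rule exI[of _ "[]"]) simp
next
  case (step c x y)
  then obtain k \<alpha> L where x: "x = k \<cdot>\<^sub>C word_op S \<alpha>" "\<alpha> \<in> neutral_words G P"
    and y: "snd ` set L \<subseteq> neutral_words G P" "y = (\<Sum>(a, \<alpha>)\<leftarrow>L. a \<cdot>\<^sub>C word_op S \<alpha>)" by blast
  have "c *\<^sub>R x = (complex_of_real c * k) \<cdot>\<^sub>C word_op S \<alpha>"
    by (simp add: x(1) scale_op_of_real[symmetric] scale_op_scale_op)
  thus ?case using x(2) y by (intro exI[of _ "(complex_of_real c * k, \<alpha>) # L"]) simp
qed

lemma hom_neutral_sum:
  assumes h: "star_hom (toeplitz G P X) B \<phi>" and w: "\<And>p. p \<in> P \<Longrightarrow> \<phi> (S p) = w p"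
    and L: "snd ` set L \<subseteq> neutral_words G P"
  shows "(\<Sum>(a, \<alpha>)\<leftarrow>L. a \<cdot>\<^sub>C word_op S \<alpha>) \<in> toeplitz G P X \<and>
    \<phi> (\<Sum>(a, \<alpha>)\<leftarrow>L. a \<cdot>\<^sub>C word_op S \<alpha>) = (\<Sum>(a, \<alpha>)\<leftarrow>L. a \<cdot>\<^sub>C word_op w \<alpha>)"
  using L
proof (induction L)
  case Nil
  note TD = cstar_algebraD[OF cstar_algebra_toeplitz]
  show ?case using star_hom_diff[OF h cstar_algebra_toeplitz TD(2) TD(2)] TD(2) by simp
next
  case (Cons b L)
  note TD = cstar_algebraD[OF cstar_algebra_toeplitz]
  obtain a \<alpha> where b: "b = (a, \<alpha>)" by (cases b)
  have \<alpha>: "\<alpha> \<in> words P" using Cons.prems by (simp add: b neutral_iff)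
  have T: "a \<cdot>\<^sub>C word_op S \<alpha> \<in> toeplitz G P X" by (rule TD(7)[OF word_toeplitz[OF \<alpha>]])
  have "\<phi> (a \<cdot>\<^sub>C word_op S \<alpha>) = a \<cdot>\<^sub>C word_op w \<alpha>"
    by (simp add: star_homD(5)[OF h word_toeplitz[OF \<alpha>]] hom_word[OF h w \<alpha>])
  thus ?case using Cons T by (simp add: b TD(4) star_homD(2)[OF h T])
qed

lemma apply_sum_list:
  "blinfun_apply (\<Sum>(a, \<alpha>)\<leftarrow>L. a \<cdot>\<^sub>C f \<alpha>) x = (\<Sum>(a, \<alpha>)\<leftarrow>L. a *\<^sub>C blinfun_apply (f \<alpha>) x)"
  by (induction L) (auto simp: blinfun.add_left)

lemma conditions_kill_gauge_kernel:
  fixes w :: "'a \<Rightarrow> 'h::complex_hilbert op"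
  assumes w: "corner_rep G P w" and w1: "w \<one> = id_blinfun"
    and cond: "cond_T2 G P w" "cond_T3 G P w" "cond_T4 G P w"
    and h: "star_hom (toeplitz G P X) B \<phi>" "B \<subseteq> bops" and \<phi>w: "\<And>p. p \<in> P \<Longrightarrow> \<phi> (S p) = w p"
    and c: "c \<in> gauge_kernel"
  shows "\<phi> c = 0"
proof -
  let ?N = "{k \<cdot>\<^sub>C word_op S \<alpha> | k \<alpha>. \<alpha> \<in> neutral_words G P}"
  have cF: "c \<in> toeplitz_fixed G P X" and c0: "reg_hom c = 0" using c
    by (auto simp: gauge_kernel_iff)
  have cT: "c \<in> toeplitz G P X" using cF by (simp add: toeplitz_fixed_iff)
  have bound: "T \<in> toeplitz G P X \<and> norm (\<phi> T) \<le> norm (reg_hom T)" if T: "T \<in> span ?N" for T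
  proof -
    obtain L where L: "snd ` set L \<subseteq> neutral_words G P" "T = (\<Sum>(a, \<alpha>)\<leftarrow>L. a \<cdot>\<^sub>C word_op S \<alpha>)"
      using neutral_span_list[OF T] by blast
    note \<phi>T = hom_neutral_sum[OF h(1) \<phi>w L(1)] and regT = hom_neutral_sum[OF reg_hom L(1)]
    \<comment> \<open>\<open>single y 1\<close> is an eigenvector of \<open>reg_hom T\<close> whose
      eigenvalue is the sum of the coefficients of the words with y in their ideal.\<close>
    have pt: "cmod (\<Sum>(a, \<alpha>)\<leftarrow>L. if y \<in> word_ideal G P \<alpha> then a else 0) \<le> norm (reg_hom T)" for y
    proof -
      have "blinfun_apply (reg_hom T) (single y 1) =
        (\<Sum>(a, \<alpha>)\<leftarrow>L. a *\<^sub>C blinfun_apply (word_op reg \<alpha>) (single y 1))"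
        using regT by (simp add: L(2) apply_sum_list)
      also have "\<dots> = (\<Sum>(a, \<alpha>)\<leftarrow>L. if y \<in> word_ideal G P \<alpha> then a else 0) *\<^sub>C single y 1"
        using L(1) by (induction L) (auto simp: reg_neutral_single scaleC_add_left)
      finally have "norm (blinfun_apply (reg_hom T) (single y 1)) =
        cmod (\<Sum>(a, \<alpha>)\<leftarrow>L. if y \<in> word_ideal G P \<alpha> then a else 0)" by (simp add: norm_scaleC)
      thus ?thesis using norm_blinfun[of "reg_hom T" "single y 1"] by simp
    qed
    have "norm (\<phi> T) \<le> norm (reg_hom T)"
    proof (rule norm_blinfun_bound)
      fix x
      \<comment> \<open>At the start nothing is decided: \<open>\<gamma>\<close> is the word of the
        unit, which acts as the identity because \<open>w\<close> is unital, N is empty and the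
        collected scalar is 0.\<close>
      have "norm (0 *\<^sub>C x + (\<Sum>(a, \<alpha>)\<leftarrow>L. a *\<^sub>C blinfun_apply (word_op w \<alpha>) x)) \<le>
        norm (reg_hom T) * norm x"
        by (rule neutral_sum_bound[OF w cond L(1) neutral_trivial(1)[OF sub.one_closed], of "[]"])
          (simp_all add: w1 adj_id pt)
      thus "norm (blinfun_apply (\<phi> T) x) \<le> norm (reg_hom T) * norm x"
        using \<phi>T by (simp add: L(2) apply_sum_list)
    qed simp
    thus ?thesis using \<phi>T L(2) by simp
  qed
  obtain Z where Z: "\<forall>n. Z n \<in> span ?N" "Z \<longlonglongrightarrow> c"
    using toeplitz_fixed_approx[OF cF] unfolding closure_sequential by blast
  \<comment> \<open>Factor 2 for the image of \<open>c - Z n\<close> under \<open>\<phi>\<close>,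
    and factor 2 again for its image under \<open>reg_hom\<close>, which is
    \<open>- reg_hom (Z n)\<close> as c is in the kernel and thereby bounds
    \<open>\<phi> (Z n)\<close>.\<close>
  have le: "norm (\<phi> c) \<le> 4 * norm (c - Z n)" for n
  proof -
    have ZT: "Z n \<in> toeplitz G P X" and Zn: "norm (\<phi> (Z n)) \<le> norm (reg_hom (Z n))" using bound Z(1)
      by auto
    have d: "c - Z n \<in> toeplitz G P X"
      by (rule subspace_diff[OF subspace_cstar_algebra[OF cstar_algebra_toeplitz] cT ZT])
    have "norm (\<phi> (c - Z n)) \<le> 2 * norm (c - Z n)"
      by (rule star_hom_norm[OF h(1) cstar_algebra_toeplitz h(2) d])
    moreover have "norm (reg_hom (c - Z n)) \<le> 2 * norm (c - Z n)"
      by (rule star_hom_norm[OF reg_hom(1) cstar_algebra_toeplitz reg_cstar_bops d])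
    moreover have "reg_hom (c - Z n) = - reg_hom (Z n)"
      by (simp add: star_hom_diff[OF reg_hom(1) cstar_algebra_toeplitz cT ZT] c0)
    moreover have "\<phi> c = \<phi> (c - Z n) + \<phi> (Z n)"
      by (simp add: star_hom_diff[OF h(1) cstar_algebra_toeplitz cT ZT])
    ultimately show ?thesis using Zn norm_triangle_ineq[of "\<phi> (c - Z n)" "\<phi> (Z n)"] by simp
  qed
  have "(\<lambda>n. 4 * norm (c - Z n)) \<longlonglongrightarrow> 0"
    using tendsto_mult_right_zero[OF tendsto_norm_zero[OF LIM_zero[OF Z(2)]], of 4]
      by (simp add: norm_minus_commute)
  hence "norm (\<phi> c) \<le> 0" by (rule LIMSEQ_le_const) (use le in blast)
  thus ?thesis by simp
qed

section \<open>Recovering a representation and transporting equivariance\<close>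

lemma ps_reps_eq_ps_rep_of:
  assumes t: "t \<in> ps_reps G P X"
  shows "t = ps_rep_of (\<lambda>p\<in>P. t p (v p))"
proof (intro ext)
  fix p \<xi>
  \<comment> \<open>Extensionality in both arguments fixes the values of t outside P and outside the
    fibres, so that the equation holds between functions on the whole types.\<close>
  have E: "t \<in> (\<Pi>\<^sub>E p\<in>P. X p \<rightarrow>\<^sub>E bops)" using t by (simp add: ps_reps_def)
  show "t p \<xi> = ps_rep_of (\<lambda>p\<in>P. t p (v p)) p \<xi>"
  proof (cases "p \<in> P")
    case p: True
    hence tp: "t p \<in> X p \<rightarrow>\<^sub>E bops" using E by blast
    show ?thesis
    proof (cases "\<xi> \<in> X p")
      case True
      then obtain c where "\<xi> = c \<cdot>\<^sub>C v p" unfolding X_iff by blast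
      thus ?thesis using p by (simp add: ps_rep_of_scale ps_reps_scale[OF t])
    next
      case False
      thus ?thesis using p PiE_arb[OF tp False] by (simp add: ps_rep_of_def)
    qed
  next
    case False
    thus ?thesis using PiE_arb[OF E False] by (simp add: ps_rep_of_def)
  qed
qed

text \<open>The two generated C*-algebras coincide, and linearity reduces the condition on a fibre
  to its spanning vector, so the same homomorphism witnesses both notions.\<close>

lemma equivariant_iff:
  assumes t: "t \<in> ps_reps G P X"
  shows "equivariant_ps_rep G P X t \<longleftrightarrow> equivariant_semigroup_rep G P (\<lambda>p\<in>P. t p (v p))"
proof -
  have b: "t p (v p) \<in> bops" if "p \<in> P" for p using corner_repD(1)[OF ps_reps_corner[OF t]] that
    by blast
  have C: "ps_cstar P X t = cstar ((\<lambda>p\<in>P. t p (v p)) ` P)"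
    using ps_cstar_eq[of t] by (simp add: ps_reps_scale[OF t] b)
  have gen: "t p (v p) \<in> ps_cstar P X t" if "p \<in> P" for p
    unfolding C by (rule subsetD[OF cstar_superset]) (use that in auto)
  have "(\<forall>p\<in>P. \<forall>\<xi>\<in>X p. \<delta> (t p \<xi>) = t p \<xi> \<otimes>\<^sub>C group_unitary G p) \<longleftrightarrow>
      (\<forall>p\<in>P. \<delta> (t p (v p)) = t p (v p) \<otimes>\<^sub>C group_unitary G p)"
    if h: "star_hom (ps_cstar P X t) (min_tensor (ps_cstar P X t) (group_cstar G)) \<delta>" for \<delta>
  proof (intro iffI ballI)
    fix p \<xi> assume g: "\<forall>p\<in>P. \<delta> (t p (v p)) = t p (v p) \<otimes>\<^sub>C group_unitary G p" and p: "p \<in> P"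
      and "\<xi> \<in> X p"
    then obtain k where "\<xi> = k \<cdot>\<^sub>C v p" unfolding X_iff by blast
    thus "\<delta> (t p \<xi>) = t p \<xi> \<otimes>\<^sub>C group_unitary G p"
      using g p by (simp add: ps_reps_scale[OF t] star_homD(5)[OF h gen] tensor_op_scale b
        group_unitary_bops P_carrier)
  qed (use v_X(2) in auto)
  thus ?thesis
    unfolding equivariant_ps_rep_def equivariant_semigroup_rep_def coaction_def C[symmetric]
    by (intro arg_cong[where f = Ex] ext) auto
qed

end

theorem proposition3p9:
  fixes G :: "('g, 'm) monoid_scheme" and P :: "'g set"
  assumes "group G" and "submonoid P G"
  shows "bij_betw (\<lambda>t. \<lambda>p\<in>P. t p (univ_isometry G P p))
    {t \<in> ps_reps G P (semigroup_ps G P). unital_ps_rep G P t \<and>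
      equivariant_ps_rep G P (semigroup_ps G P) t \<and> fock_covariant G P (semigroup_ps G P) t}
    {w :: 'g \<Rightarrow> 'k::complex_hilbert op. w \<in> semigroup_reps G P \<and> equivariant_semigroup_rep G P w \<and>
      cond_T1 G w \<and> cond_T2 G P w \<and> cond_T3 G P w \<and> cond_T4 G P w}"
    (is "bij_betw ?f ?A ?B")
proof (rule bij_betw_imageI)
  interpret semigroup_in_group P G using assms by (rule semigroup_in_group.intro)
  have f_inv: "ps_rep_of (?f t) = t" if "t \<in> ps_reps G P X"
    for t :: "'g \<Rightarrow> 'g group_space op \<Rightarrow> 'k op"
    by (rule ps_reps_eq_ps_rep_of[OF that, symmetric])
  show "inj_on ?f ?A"
  proof (rule inj_onI)
    fix t t' assume t: "t \<in> ?A" "t' \<in> ?A" and "?f t = ?f t'"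
    hence "ps_rep_of (?f t) = ps_rep_of (?f t')" by simp
    thus "t = t'" using t f_inv by simp
  qed
  show "?f ` ?A = ?B"
  proof (intro equalityI subsetI)
    fix w assume "w \<in> ?f ` ?A"
    then obtain t where t: "t \<in> ps_reps G P X" "unital_ps_rep G P t" "equivariant_ps_rep G P X t"
      "fock_covariant G P X t" and w: "w = ?f t" by blast
    note cD = corner_repD[OF ps_reps_corner[OF t(1)]]
    have "w \<in> semigroup_reps G P"
      unfolding semigroup_reps_def w using cD(1,2) by auto
    moreover have "cond_T1 G w" using t(2) by (simp add: w cond_T1_def unital_ps_rep_def)
    moreover have "equivariant_semigroup_rep G P w"
      using t(3) unfolding w equivariant_iff[OF t(1)] .
    ultimately show "w \<in> ?B"
      using fock_covariant_conditions[OF t(1,4)] by (simp add: w)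
  next
    fix w :: "'g \<Rightarrow> 'k op" assume "w \<in> ?B"
    hence w: "w \<in> semigroup_reps G P" "equivariant_semigroup_rep G P w"
      and T: "cond_T1 G w" "cond_T2 G P w" "cond_T3 G P w" "cond_T4 G P w" by auto
    \<comment> \<open>Elements of \<open>semigroup_reps\<close> are arbitrary homomorphisms into the
      bounded operators; that w consists of isometries comes from (T1) and (T3).\<close>
    have c: "corner_rep G P w" by (rule T3_isometric[OF w(1) T(1,3)])
    let ?t = "ps_rep_of w"
    have t: "?t \<in> ps_reps G P X" by (rule ps_rep_of_ps_reps[OF c])
    have ft: "?f ?t = w"
    proof
      show "?f ?t p = w p" for p
        using w(1) by (cases "p \<in> P") (auto simp: ps_rep_of_v semigroup_reps_def)
    qed
    have "unital_ps_rep G P ?t" using T(1) by (simp add: unital_ps_rep_def ps_rep_of_v cond_T1_def)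
    moreover have "equivariant_ps_rep G P X ?t" using w(2) by (simp only: equivariant_iff[OF t] ft)
    moreover have "fock_covariant G P X ?t"
      unfolding fock_covariant_iff[OF t]
    proof
      fix d assume "d \<in> gauge_kernel"
      thus "induced_hom G P X ?t d = 0"
        using T(1) by (intro conditions_kill_gauge_kernel[OF c _ T(2-4) induced_hom(1)[OF t]
          induced_hom(3)[OF t]])
          (simp_all add: cond_T1_def induced_hom(2)[OF t] ps_rep_of_v)
    qed
    ultimately have "?t \<in> ?A" using t by simp
    thus "w \<in> ?f ` ?A" by (rule image_eqI[of w ?f ?t ?A, OF ft[symmetric]])
  qed
qed

end
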